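(* Let $\vec\mu=(\mu_1,\mu_2)$ be an Angelesco system. Suppose that $d\mu_k(x)=\mu_k'(x)dx$ and $(\mu_k')^{-1}\in L^\infty(\Delta_k)$ for each $k\in\{1,2\}$. Then the spectrum of $\mathcal J_{\vec e_i}$ is purely absolutely continuous for each $i\in\{1,2\}$.
   Context: Angelesco system: $\mu_1,\mu_2$ are finite positive Borel measures on $\mathbb R$ with compact supports of infinite cardinality, $\Delta_i$ is the convex hull of $\operatorname{supp}\mu_i$ (a compact interval), and $\Delta_1\cap\Delta_2=\varnothing$ (the paper labels them so that $\Delta_1$ lies to the left of $\Delta_2$). For $\vec n=(n_1,n_2)\in\mathbb Z_+^2$, $P_{\vec n}$ is the monic polynomial of degree $|\vec n|=n_1+n_2$ with $\int P_{\vec n}(x)x^md\mu_k(x)=0$ for $0\le m<n_k$, $k=1,2$ (it exists and is unique for Angelesco systems). There are uniformly bounded real recurrence coefficients with $xP_{\vec n}=P_{\vec n+\vec e_i}+b_{\vec n,i}P_{\vec n}+a_{\vec n,1}P_{\vec n-\vec e_1}+a_{\vec n,2}P_{\vec n-\vec e_2}$, $\vec n\in\mathbb Z_+^2$, $i\in\{1,2\}$ ($\vec e_1=(1,0)$, $\vec e_2=(0,1)$; terms with negative indices are $0$), and $a_{\vec n,i}>0$ for $\vec n\in\mathbb N^2$. $\mathcal V$ is the vertex set of the infinite rooted binary tree with root $O$: each $Y$ has two children $Y_{(ch),1},Y_{(ch),2}$; $Y_{(p)}$ is the parent of $Y\ne O$. $\Pi(O)=(1,1)$, $\Pi(Y_{(ch),i})=\Pi(Y)+\vec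 e_i$; $\iota_Y=i$ if $Y$ is the $i$-th child of its parent. For $\vec\kappa\in\mathbb R^2$ with $\kappa_1+\kappa_2=1$ (here $\vec\kappa=\vec e_1$ or $\vec\kappa=\vec e_2$): $V_O=\kappa_1b_{(0,1),1}+\kappa_2b_{(1,0),2}$, $W_O=1$; $V_Y=b_{\Pi(Y_{(p)}),\iota_Y}$, $W_Y=a_{\Pi(Y_{(p)}),\iota_Y}>0$ for $Y\neq O$. With $f_{O_{(p)}}:=0$, $$(\mathcal J_{\vec\kappa}f)_Y=V_Yf_Y+W_Y^{1/2}f_{Y_{(p)}}+W_{Y_{(ch),1}}^{1/2}f_{Y_{(ch),1}}+W_{Y_{(ch),2}}^{1/2}f_{Y_{(ch),2}},$$ a bounded self-adjoint operator on $\ell^2(\mathcal V)$. Its spectrum is purely absolutely continuous if for every $f\in\ell^2(\mathcal V)$ the spectral measure of $f$ is absolutely continuous with respect to Lebesgue measure. *)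

theory Defs
  imports "HOL-Analysis.Analysis" "HOL-Computational_Algebra.Polynomial"
begin

section \<open>Angelesco systems\<close>

definition msupp :: "real measure \<Rightarrow> real set" where
  "msupp \<nu> = {x. \<forall>U. open U \<and> x \<in> U \<longrightarrow> emeasure \<nu> U > 0}"

definition angelesco :: "(2 \<Rightarrow> real measure) \<Rightarrow> bool" where
  "angelesco \<mu> \<longleftrightarrow>
     (\<forall>k. finite_measure (\<mu> k) \<and> sets (\<mu> k) = sets borel \<and>
          compact (msupp (\<mu> k)) \<and> infinite (msupp (\<mu> k))) \<and>
     convex hull (msupp (\<mu> 1)) \<inter> convex hull (msupp (\<mu> 2)) = {}"


section \<open>Type II multiple orthogonal polynomials and their recurrences\<close>

text \<open>Multi-indices have type \<^typ>\<open>nat^2\<close>, and \<open>axis i 1\<close> is the \<open>i\<close>-th unit vector.\<close>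

definition is_mop :: "(2 \<Rightarrow> real measure) \<Rightarrow> nat^2 \<Rightarrow> real poly \<Rightarrow> bool" where
  "is_mop \<mu> n p \<longleftrightarrow>
     lead_coeff p = 1 \<and> degree p = n $ 1 + n $ 2 \<and>
     (\<forall>k. \<forall>m < n $ k. (\<integral>x. poly p x * x ^ m \<partial>\<mu> k) = 0)"

definition mop :: "(2 \<Rightarrow> real measure) \<Rightarrow> nat^2 \<Rightarrow> real poly" where
  "mop \<mu> n = (THE p. is_mop \<mu> n p)"

text \<open>The coefficient \<open>a n j\<close> with \<open>n $ j = 0\<close> multiplies a polynomial with a negative index, which
  is zero by convention. It is set to \<open>0\<close> so that the coefficients are uniquely determined.
  (On \<^typ>\<open>nat^2\<close> subtraction truncates, hence the case distinction.)\<close>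

definition recurrence_coeffs ::
  "(2 \<Rightarrow> real measure) \<Rightarrow> (nat^2 \<Rightarrow> 2 \<Rightarrow> real) \<Rightarrow> (nat^2 \<Rightarrow> 2 \<Rightarrow> real) \<Rightarrow> bool" where
  "recurrence_coeffs \<mu> a b \<longleftrightarrow>
     (\<forall>n i. [:0, 1:] * mop \<mu> n =
        mop \<mu> (n + axis i 1) + smult (b n i) (mop \<mu> n) +
        (\<Sum>j\<in>UNIV. if n $ j = 0 then 0 else smult (a n j) (mop \<mu> (n - axis j 1)))) \<and>
     (\<forall>n j. n $ j = 0 \<longrightarrow> a n j = 0)"

definition rec_a :: "(2 \<Rightarrow> real measure) \<Rightarrow> nat^2 \<Rightarrow> 2 \<Rightarrow> real" where
  "rec_a \<mu> = fst (THE ab. recurrence_coeffs \<mu> (fst ab) (snd ab))"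

definition rec_b :: "(2 \<Rightarrow> real measure) \<Rightarrow> nat^2 \<Rightarrow> 2 \<Rightarrow> real" where
  "rec_b \<mu> = snd (THE ab. recurrence_coeffs \<mu> (fst ab) (snd ab))"


section \<open>Jacobi matrices on the rooted binary tree\<close>

text \<open>A vertex is the list of the child numbers on the path from the root to it, the last step
  coming first: \<open>[]\<close> is the root, \<open>i # Y\<close> is the \<open>i\<close>-th child of \<open>Y\<close>, and a vertex \<open>Y \<noteq> []\<close> has
  the parent \<open>tl Y\<close> and is its \<open>hd Y\<close>-th child.\<close>

type_synonym vertex = "2 list"

primrec proj :: "vertex \<Rightarrow> nat^2" where
  "proj [] = (\<chi> i. 1)"
| "proj (i # Y) = proj Y + axis i 1"

primrec potV :: "(2 \<Rightarrow> real measure) \<Rightarrow> real^2 \<Rightarrow> vertex \<Rightarrow> real" where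
  "potV \<mu> \<kappa> [] = \<kappa> $ 1 * rec_b \<mu> (axis 2 1) 1 + \<kappa> $ 2 * rec_b \<mu> (axis 1 1) 2"
| "potV \<mu> \<kappa> (i # Y) = rec_b \<mu> (proj Y) i"

primrec weightW :: "(2 \<Rightarrow> real measure) \<Rightarrow> vertex \<Rightarrow> real" where
  "weightW \<mu> [] = 1"
| "weightW \<mu> (i # Y) = rec_a \<mu> (proj Y) i"

definition jacobi ::
  "(2 \<Rightarrow> real measure) \<Rightarrow> real^2 \<Rightarrow> (vertex \<Rightarrow> complex) \<Rightarrow> vertex \<Rightarrow> complex" where
  "jacobi \<mu> \<kappa> f Y =
     of_real (potV \<mu> \<kappa> Y) * f Y
     + of_real (sqrt (weightW \<mu> Y)) * (if Y = [] then 0 else f (tl Y))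
     + (\<Sum>i\<in>UNIV. of_real (sqrt (weightW \<mu> (i # Y))) * f (i # Y))"


section \<open>Spectral measures on \<open>\<ell>\<^sup>2\<close>\<close>

definition ell2 :: "('v \<Rightarrow> complex) set" where
  "ell2 = {f. (\<lambda>x. (cmod (f x))\<^sup>2) summable_on UNIV}"

definition ell2_inner :: "('v \<Rightarrow> complex) \<Rightarrow> ('v \<Rightarrow> complex) \<Rightarrow> complex" where
  "ell2_inner f g = (\<Sum>\<^sub>\<infinity>x. f x * cnj (g x))"

definition orth_projection :: "(('v \<Rightarrow> complex) \<Rightarrow> 'v \<Rightarrow> complex) \<Rightarrow> bool" where
  "orth_projection P \<longleftrightarrow>
     (\<forall>f\<in>ell2. P f \<in> ell2 \<and> P (P f) = P f) \<and>
     (\<forall>f\<in>ell2. \<forall>g\<in>ell2. \<forall>c. P (\<lambda>x. c * f x + g x) = (\<lambda>x. c * P f x + P g x)) \<and>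
     (\<forall>f\<in>ell2. \<forall>g\<in>ell2. ell2_inner (P f) g = ell2_inner f (P g))"

text \<open>The spectral measure \<open>B \<mapsto> \<langle>E(B) f, f\<rangle>\<close> of \<open>f\<close>; here \<open>\<langle>E(B) f, f\<rangle> = \<parallel>E(B) f\<parallel>\<^sup>2\<close> is real and
  nonnegative.\<close>

definition spectral_measure ::
  "(real set \<Rightarrow> ('v \<Rightarrow> complex) \<Rightarrow> 'v \<Rightarrow> complex) \<Rightarrow> ('v \<Rightarrow> complex) \<Rightarrow> real measure" where
  "spectral_measure E f =
     measure_of UNIV (sets borel) (\<lambda>B. ennreal (Re (ell2_inner (E B f) f)))"

text \<open>\<open>E\<close> is the projection-valued measure of the bounded self-adjoint operator \<open>A\<close>, that is,
  \<open>A = \<integral>x dE(x)\<close>. Countable additivity and the integral are stated for the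
  quadratic forms, which determine the operators by polarization. By the spectral theorem
  a bounded self-adjoint \<open>A\<close> has exactly one such \<open>E\<close> (up to the values of \<open>E\<close> off the Borel sets
  and off \<open>\<ell>\<^sup>2\<close>), and its support is compact.\<close>

definition spectral_resolution ::
  "(('v \<Rightarrow> complex) \<Rightarrow> 'v \<Rightarrow> complex) \<Rightarrow> (real set \<Rightarrow> ('v \<Rightarrow> complex) \<Rightarrow> 'v \<Rightarrow> complex) \<Rightarrow> bool"
where
  "spectral_resolution A E \<longleftrightarrow>
     (\<forall>B\<in>sets borel. orth_projection (E B)) \<and>
     (\<forall>f\<in>ell2. E UNIV f = f) \<and>
     (\<forall>B. range B \<subseteq> sets borel \<and> disjoint_family B \<longrightarrow>
        (\<forall>f\<in>ell2. (\<lambda>n::nat. ell2_inner (E (B n) f) f) sums ell2_inner (E (\<Union>n. B n) f) f)) \<and>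
     (\<exists>R. \<forall>f\<in>ell2. E {-R..R} f = f) \<and>
     (\<forall>f\<in>ell2. A f \<in> ell2 \<and>
        ell2_inner (A f) f = of_real (\<integral>x. x \<partial>spectral_measure E f))"

definition purely_ac_spectrum :: "(('v \<Rightarrow> complex) \<Rightarrow> 'v \<Rightarrow> complex) \<Rightarrow> bool" where
  "purely_ac_spectrum A \<longleftrightarrow>
     (\<forall>E. spectral_resolution A E \<longrightarrow>
        (\<forall>f\<in>ell2. absolutely_continuous lborel (spectral_measure E f)))"

end

theory Submission
  imports Defs "HOL-Probability.Probability" "HOL-Complex_Analysis.Conformal_Mappings"
begin

text \<open>
  Let \<open>L\<^sub>n(z) = \<Sum>\<^sub>k \<integral> A\<^sub>n\<^sub>,\<^sub>k(x) / (z - x) d\<mu>\<^sub>k(x)\<close> be the functions of the second kind of the type I forms.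
  On the tree they solve the eigenvalue equation of the Jacobi matrix, so the spectral measure \<open>\<omega>\<^sub>Y\<close> at
  the root of the subtree below \<open>Y\<close> has the Stieltjes transform \<open>L\<^sub>n / L\<^sub>n\<^sub>'\<close> with \<open>n = \<Pi>(Y)\<close> and
  \<open>n' = n - e\<^sub>i\<close>. Near almost all points of \<open>\<Delta>\<^sub>k\<close>, eliminating the transform of \<open>\<mu>\<^sub>k\<close> between \<open>L\<^sub>n\<close> and
  \<open>L\<^sub>n\<^sub>'\<close> bounds this ratio, because the lower bound on the density keeps \<open>Im L\<^sub>n\<^sub>'\<close> away from zero.
  Poisson integrals of \<open>\<omega>\<^sub>Y\<close> are thus dominated by those of \<open>\<mu>\<^sub>k\<close> and of Lebesgue measure. The finitely
  many exceptional points carry no atom, since \<open>L\<^sub>n\<^sub>'\<close> stays away from zero there. Hence every \<open>\<omega>\<^sub>Y\<close> is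
  absolutely continuous.

  If \<open>N\<close> is a null set and \<open>E(N) \<psi> = \<psi>\<close>, then \<open>\<psi>\<close> vanishes at every vertex, by induction from the root:
  if \<open>\<psi>\<close> and its images under powers of the operator vanish at the parent of \<open>Y\<close>, the operator acts on the
  subtree below \<open>Y\<close> separately, so \<open>\<bar>(p(\<J>) \<psi>)(Y)\<bar> \<le> \<parallel>\<psi>\<parallel> (\<integral> p\<^sup>2 d\<omega>\<^sub>Y)\<^sup>1\<^sup>/\<^sup>2\<close> for every polynomial \<open>p\<close>, and \<open>p\<close> may
  be chosen with \<open>p(\<J>) \<psi>\<close> close to \<open>\<psi>\<close> and with a small integral, because \<open>\<omega>\<^sub>Y(N) = 0\<close>.
\<close>

section \<open>The moment problem on a compact interval\<close>

text \<open>The recurrence of the type II polynomials has one upper neighbour and two lower ones,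
  the wrong shape for a rooted tree; the recurrence of the type I forms has one lower and two upper
  neighbours, just as a vertex has one parent and two children. With \<open>\<kappa> = e_i\<close>
  the root behaves like an \<open>i\<close>-th child too, so it needs no separate treatment. The
  given resolution belongs to the whole matrix only and is tied to it only by first moments
  \<open>\<integral>x d\<sigma>_f\<close>; that the projections commute with the operator, and the
  formula for higher moments, have to be extracted from this. A subtree comes with no resolution at
  all, so its root measure is obtained by solving a moment problem, for which a bound on the
  quadratic form is enough. One sign argument, \<open>sign_polynomial\<close>, is behind both
  normality (unique solvability of the orthogonality conditions) and the nonvanishing of
  \<open>L_n'\<close> at those real points where its imaginary part gives no control. The latter
  include points of an interval \<open>I k\<close> at which \<open>Q n' k\<close> vanishes, and all
  of \<open>I k\<close> when \<open>n'\<close> has a zero entry there.\<close>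

lemma borel_measurable_poly [measurable]: "poly (p :: real poly) \<in> borel_measurable borel"
  by (intro borel_measurable_continuous_onI continuous_intros)

text \<open>After cancelling \<open>j!\<close> the quotient is a product of \<open>j\<close> factors
  \<open>(k - i) / (N - i)\<close>, each of modulus at most 1 and within \<open>j / (N - j)\<close>
  of \<open>k / N\<close>; two such products differ by at most the sum of the differences of their
  factors.\<close>

lemma binomial_falling_quotient_bound:
  fixes N k j :: nat
  assumes "k \<le> N" "j < N"
  shows "\<bar>real (k choose j) / real (N choose j) - (real k / real N) ^ j\<bar> \<le> real j * (real j / real (N - j))"
proof -
  have ch: "real (m choose j) = (\<Prod>i<j. real m - real i) / fact j" for m
    by (simp add: binomial_gbinomial gbinomial_prod_rev atLeast0LessThan)
  define z where "z = (\<lambda>i. if k \<ge> j then (real k - real i) / (real N - real i) else 0)"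
  have N: "real N - real i > 0" if "i < j" for i using that assms by simp
  have q: "real (k choose j) / real (N choose j) = (\<Prod>i<j. z i) \<or> (k < j)"
    unfolding ch z_def by (auto simp: prod_dividef)
  have fac: "\<bar>(real k - real i) / (real N - real i) - real k / real N\<bar> \<le> real j / real (N - j)"
    if i: "i < j" for i
  proof -
    have "(real k - real i) / (real N - real i) - real k / real N
        = (- real i * (real N - real k)) / ((real N - real i) * real N)"
      using N[OF i] assms by (simp add: field_simps)
    also have "\<bar>\<dots>\<bar> = (real i / (real N - real i)) * ((real N - real k) / real N)"
      using N[OF i] assms by (simp add: abs_mult)
    also have "\<dots> \<le> (real j / real (N - j)) * 1"
      using assms i by (intro mult_mono frac_le) (auto simp: of_nat_diff)
    finally show ?thesis by simp
  qed
  show ?thesis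
  proof (cases "k < j")
    case True
    then have "j \<ge> 1" by simp
    \<comment> \<open>For \<open>k < j\<close> the quotient is 0, and \<open>k / N\<close> alone is
      already below the error bound.\<close>
    have "(real k / real N) ^ j \<le> (real k / real N) ^ 1"
      using assms \<open>j \<ge> 1\<close> by (intro power_decreasing) auto
    also have "\<dots> \<le> real j / real (N - j)"
      using True assms by (simp add: frac_le)
    also have "\<dots> \<le> real j * (real j / real (N - j))"
      using \<open>j \<ge> 1\<close> by (simp add: divide_right_mono)
    finally show ?thesis using True by (simp add: binomial_eq_0)
  next
    case False
    have z1: "norm (z i) \<le> 1" if "i < j" for i
      using that False N[OF that] assms by (auto simp: z_def)
    have "\<bar>(\<Prod>i<j. z i) - (\<Prod>i<j. real k / real N)\<bar> \<le> (\<Sum>i<j. norm (z i - real k / real N))"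
      using norm_prod_diff[of "{..<j}" z "\<lambda>_. real k / real N"] z1 assms by auto
    also have "\<dots> \<le> (\<Sum>i<j. real j / real (N - j))"
      using fac False by (intro sum_mono) (auto simp: z_def)
    finally show ?thesis using q False by simp
  qed
qed

text \<open>Since \<open>C(k,j) C(N,k) = C(N,j) C(N-j,k-j)\<close>, the binomial theorem sums what
  remains to \<open>(u + v)^(N-j) = 1\<close>. The ring is general because \<open>u\<close> and
  \<open>v\<close> will be polynomials.\<close>

lemma bernstein_factorial_moment:
  fixes u v :: "'a :: comm_ring_1"
  assumes uv: "u + v = 1" and j: "j \<le> N"
  shows "(\<Sum>k\<le>N. of_nat (k choose j) * (of_nat (N choose k) * (u ^ k * v ^ (N - k)))) = of_nat (N choose j) * u ^ j"
proof -
  have "(\<Sum>k\<le>N. of_nat (k choose j) * (of_nat (N choose k) * (u ^ k * v ^ (N - k))))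
      = (\<Sum>k=j..N. of_nat (k choose j) * (of_nat (N choose k) * (u ^ k * v ^ (N - k))))"
    by (rule sum.mono_neutral_right) (auto simp: binomial_eq_0)
  also have "\<dots> = (\<Sum>k=j..N. of_nat (N choose j) * u ^ j * (of_nat ((N - j) choose (k - j)) * (u ^ (k - j) * v ^ (N - j - (k - j)))))"
  proof (rule sum.cong[OF refl])
    fix k assume k: "k \<in> {j..N}"
    have "(k choose j) * (N choose k) = (N choose j) * ((N - j) choose (k - j))"
      using choose_mult[of j k N] k by (simp add: mult.commute)
    then have a: "(of_nat (k choose j) * of_nat (N choose k) :: 'a) = of_nat (N choose j) * of_nat ((N - j) choose (k - j))"
      by (metis of_nat_mult)
    have b: "u ^ k = u ^ j * u ^ (k - j)" using k by (simp flip: power_add)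
    have c: "N - j - (k - j) = N - k" using k by simp
    show "of_nat (k choose j) * (of_nat (N choose k) * (u ^ k * v ^ (N - k))) =
         of_nat (N choose j) * u ^ j * (of_nat ((N - j) choose (k - j)) * (u ^ (k - j) * v ^ (N - j - (k - j))))"
      unfolding c b using a by (simp add: algebra_simps) (simp add: mult.assoc[symmetric])
  qed
  also have "\<dots> = of_nat (N choose j) * u ^ j * (\<Sum>k=j..N. of_nat ((N - j) choose (k - j)) * (u ^ (k - j) * v ^ (N - j - (k - j))))"
    by (simp add: sum_distrib_left)
  also have "(\<Sum>k=j..N. of_nat ((N - j) choose (k - j)) * (u ^ (k - j) * v ^ (N - j - (k - j))))
     = (\<Sum>k\<le>N-j. of_nat ((N - j) choose k) * (u ^ k * v ^ (N - j - k)))"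
    by (rule sum.reindex_bij_witness[of _ "\<lambda>k. k + j" "\<lambda>k. k - j"]) (use j in auto)
  also have "\<dots> = (u + v) ^ (N - j)"
    by (simp add: binomial_ring mult.assoc)
  finally show ?thesis using uv by simp
qed

text \<open>The approximating measures put the mass \<open>L (b\<^sub>N\<^sub>k)\<close> at the \<open>k\<close>-th node of a uniform grid, where \<open>b\<^sub>N\<^sub>k\<close>
  are the Bernstein polynomials of the interval; a weak limit exists by Helly's theorem.\<close>

theorem moment_measure_exists:
  fixes L :: "real poly \<Rightarrow> real" and R :: real
  assumes R: "R > 0"
    and add: "\<And>p q. L (p + q) = L p + L q" and scale: "\<And>a p. L (smult a p) = a * L p"
    and one: "L 1 = 1"
    and sq: "\<And>p. 0 \<le> L (p * p)"
    and up: "\<And>p. 0 \<le> L ([:R, -1:] * (p * p))" and lo: "\<And>p. 0 \<le> L ([:R, 1:] * (p * p))"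
  shows "\<exists>M. real_distribution M \<and> (AE x in M. \<bar>x\<bar> \<le> R) \<and> (\<forall>p. integral\<^sup>L M (poly p) = L p)"
proof -
  \<comment> \<open>\<open>u\<close> maps \<open>[-R, R]\<close> affinely onto \<open>[0, 1]\<close>
    and \<open>v = 1 - u\<close>; the hypotheses become positivity on squares times 1,
    \<open>u\<close> or \<open>v\<close>.\<close>
  define u v where "u = [:1/2, 1/(2*R):]" and "v = [:1/2, -1/(2*R):]"
  have uv: "u + v = 1" by (simp add: u_def v_def one_pCons)
  have L0: "L 0 = 0" using scale[of 0 0] by simp
  have Lsum: "L (sum f A) = (\<Sum>x\<in>A. L (f x))" for f and A :: "nat set"
    by (induction A rule: infinite_finite_induct) (auto simp: L0 add)
  have us: "u = smult (1/(2*R)) [:R, 1:]" "v = smult (1/(2*R)) [:R, -1:]"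
    using R by (auto simp: u_def v_def)
  have Lu: "0 \<le> L (u * (p * p))" and Lv: "0 \<le> L (v * (p * p))" for p
    unfolding us mult_smult_left scale using R lo[of p] up[of p] by simp_all
  have pos: "0 \<le> L (u ^ k * v ^ l)" for k l
  proof -
    define p where "p = u ^ (k div 2) * v ^ (l div 2)"
    have k: "u ^ k = (u ^ (k div 2) * u ^ (k div 2)) * u ^ (k mod 2)"
      by (metis div_mod_decomp mult_2_right power_add)
    have l: "v ^ l = (v ^ (l div 2) * v ^ (l div 2)) * v ^ (l mod 2)"
      by (metis div_mod_decomp mult_2_right power_add)
    have e: "u ^ k * v ^ l = u ^ (k mod 2) * v ^ (l mod 2) * (p * p)"
      unfolding k l p_def by (simp add: mult_ac)
    have k2: "k mod 2 = 0 \<or> k mod 2 = 1" and l2: "l mod 2 = 0 \<or> l mod 2 = 1" by auto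
    \<comment> \<open>The product \<open>u v\<close> is the one case that no hypothesis covers;
      multiplied by \<open>u + v = 1\<close> it becomes a sum of terms with a single factor
      \<open>u\<close> or \<open>v\<close> and a square.\<close>
    have "u * v * (p * p) = (u + v) * (u * v * (p * p))" using uv by simp
    also have "\<dots> = v * ((u * p) * (u * p)) + u * ((v * p) * (v * p))" by (simp add: algebra_simps)
    finally have "0 \<le> L (u * v * (p * p))" using Lu[of "v * p"] Lv[of "u * p"] by (simp add: add)
    with k2 l2 Lu[of p] Lv[of p] sq[of p] show ?thesis unfolding e by auto
  qed
  define c where "c = (\<lambda>N k. real (N choose k) * L (u ^ k * v ^ (N - k)))"
  have c0: "0 \<le> c N k" for N k using pos by (simp add: c_def)
  have cm: "(\<Sum>k\<le>N. real (k choose j) * c N k) = real (N choose j) * L (u ^ j)" if "j \<le> N" for N j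
  proof -
    have "real (N choose j) * L (u ^ j) = L (of_nat (N choose j) * u ^ j)"
      by (simp add: of_nat_poly scale)
    also have "of_nat (N choose j) * u ^ j = (\<Sum>k\<le>N. of_nat (k choose j) * (of_nat (N choose k) * (u ^ k * v ^ (N - k))))"
      using bernstein_factorial_moment[OF uv that] by simp
    also have "L \<dots> = (\<Sum>k\<le>N. real (k choose j) * c N k)"
      unfolding Lsum by (simp add: of_nat_poly scale c_def mult_ac)
    finally show ?thesis by simp
  qed
  have c1: "(\<Sum>k\<le>N. c N k) = 1" for N using cm[of 0 N] one by simp
  have c1': "(\<Sum>k\<le>N. c (Suc N) k) + c (Suc N) (Suc N) = 1" for N using c1[of "Suc N"] by simp
  define t where "t = (\<lambda>N k. R * (2 * real k / real N - 1))"
  \<comment> \<open>The index \<open>Suc N\<close> avoids the degenerate grid, whose nodes would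
    involve a division by 0.\<close>
  define PM where "PM = (\<lambda>N. point_measure {..Suc N} (\<lambda>k. ennreal (c (Suc N) k)))"
  define M where "M = (\<lambda>N. distr (PM N) borel (t (Suc N)))"
  have tb: "\<bar>t N k\<bar> \<le> R" if "k \<le> N" "N > 0" for N k
  proof -
    have "\<bar>2 * real k / real N - 1\<bar> \<le> 1" using that by (auto simp: abs_le_iff field_simps)
    then show ?thesis using R by (simp add: t_def abs_mult mult_left_le)
  qed
  have tm[measurable]: "t (Suc N) \<in> measurable (PM N) borel" for N
    by (simp add: PM_def measurable_point_measure_eq1)
  have int: "integral\<^sup>L (M N) f = (\<Sum>k\<le>Suc N. c (Suc N) k * f (t (Suc N) k))"
    if "f \<in> borel_measurable borel" for f :: "real \<Rightarrow> real" and N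
  proof -
    have "integral\<^sup>L (M N) f = integral\<^sup>L (PM N) (\<lambda>k. f (t (Suc N) k))"
      unfolding M_def using that by (intro integral_distr) auto
    also have "\<dots> = (\<Sum>k\<le>Suc N. c (Suc N) k * f (t (Suc N) k))"
      unfolding PM_def by (subst lebesgue_integral_point_measure_finite) (auto simp: c0)
    finally show ?thesis .
  qed
  have PMp: "prob_space (PM N)" for N
    unfolding PM_def by (rule prob_spaceI) (simp add: space_point_measure emeasure_point_measure_finite c0 c1 del: sum.atMost_Suc)
  have Md: "real_distribution (M N)" for N
    unfolding M_def real_distribution_def real_distribution_axioms_def
    using prob_space.prob_space_distr[OF PMp tm] by simp
  have tight: "tight M"
    unfolding tight_def
  proof (intro conjI allI impI Md)
    fix e :: real assume "e > 0"
    \<comment> \<open>Tightness is stated with left-open intervals, so the left end moves to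
      \<open>-R - 1\<close> in order to keep the node \<open>-R\<close>.\<close>
    have "Sigma_Algebra.measure (M N) {-R-1<..R} = 1" for N
    proof -
      interpret real_distribution "M N" by (rule Md)
      have "prob {-R-1<..R} = integral\<^sup>L (M N) (indicator {-R-1<..R})" by simp
      also have "\<dots> = (\<Sum>k\<le>Suc N. c (Suc N) k * indicator {-R-1<..R} (t (Suc N) k))"
        by (rule int) auto
      also have "\<dots> = (\<Sum>k\<le>Suc N. c (Suc N) k)"
      proof (rule sum.cong[OF refl])
        fix k assume "k \<in> {..Suc N}"
        then have "t (Suc N) k \<in> {-R-1<..R}" using tb[of k "Suc N"] by auto
        then show "c (Suc N) k * indicator {-R-1<..R} (t (Suc N) k) = c (Suc N) k" by simp
      qed
      finally show ?thesis by (simp add: c1')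
    qed
    then show "\<exists>a b. a < b \<and> (\<forall>n. 1 - e < Sigma_Algebra.measure (M n) {a<..b})"
      using \<open>e > 0\<close> R by (intro exI[of _ "-R-1"] exI[of _ R]) auto
  qed
  have "strict_mono (\<lambda>n::nat. n)" by (simp add: strict_mono_def)
  from tight_imp_convergent_subsubsequence[OF tight this]
  obtain r K where r: "strict_mono r" and K: "real_distribution K" and
    conv: "weak_conv_m (M \<circ> r) K" by (auto simp: comp_def)
  interpret K: real_distribution K by (rule K)
  have wc: "(\<lambda>n. integral\<^sup>L (M (r n)) f) \<longlonglongrightarrow> integral\<^sup>L K f"
    if "\<And>x. isCont f x" "\<And>x. norm (f x) \<le> B" for f :: "real \<Rightarrow> real" and B
    using weak_conv_imp_integral_bdd_continuous_conv[OF _ K conv that] Md by simp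
  have AE: "AE x in K. \<bar>x\<bar> \<le> R"
  proof -
    \<comment> \<open>A bounded continuous function whose zero set is exactly
      \<open>[-R, R]\<close>: it vanishes at all nodes, hence almost everywhere for the weak
      limit.\<close>
    define f where "f = (\<lambda>x::real. min 1 (max 0 (\<bar>x\<bar> - R)))"
    have fm[measurable]: "f \<in> borel_measurable borel" unfolding f_def by simp
    have "integral\<^sup>L (M (r n)) f = 0" for n
      unfolding int[OF fm]
    proof (rule sum.neutral, rule ballI)
      fix k assume "k \<in> {..Suc (r n)}"
      then show "c (Suc (r n)) k * f (t (Suc (r n)) k) = 0"
        using tb[of k "Suc (r n)"] by (simp add: f_def)
    qed
    moreover have "(\<lambda>n. integral\<^sup>L (M (r n)) f) \<longlonglongrightarrow> integral\<^sup>L K f"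
      by (rule wc[of f 1]) (auto simp: f_def intro!: continuous_intros)
    ultimately have "integral\<^sup>L K f = 0" by (simp add: LIMSEQ_const_iff)
    moreover have "integrable K f"
      by (rule K.integrable_const_bound[where B=1]) (auto simp: f_def)
    ultimately have "AE x in K. f x = 0"
      by (subst (asm) integral_nonneg_eq_0_iff_AE) (auto simp: f_def)
    then show ?thesis by (rule AE_mp) (auto simp: f_def min_def max_def split: if_splits)
  qed
  have ub: "\<bar>x\<bar> \<le> R \<Longrightarrow> poly u x \<in> {0..1}" for x
    using R by (auto simp: u_def field_simps abs_le_iff)
  have mom: "integral\<^sup>L K (\<lambda>x. poly u x ^ j) = L (u ^ j)" for j
  proof -
    \<comment> \<open>Clamping makes the power of \<open>u\<close> bounded, as weak convergence
      requires, without changing it on \<open>[-R, R]\<close>.\<close>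
    define f where "f = (\<lambda>x. (max 0 (min 1 (poly u x))) ^ j)"
    have fc: "isCont f x" for x unfolding f_def by (intro continuous_intros)
    have fm: "f \<in> borel_measurable borel"
      by (intro borel_measurable_continuous_onI continuous_at_imp_continuous_on) (auto simp: fc)
    have ft: "f (t N k) = (real k / real N) ^ j" if "k \<le> N" "N > 0" for k N
    proof -
      have "poly u (t N k) = real k / real N" using R by (simp add: u_def t_def field_simps)
      then show ?thesis using that by (simp add: f_def)
    qed
    have "(\<lambda>N. integral\<^sup>L (M N) f) \<longlonglongrightarrow> L (u ^ j)"
    proof -
      have bd: "\<bar>integral\<^sup>L (M N) f - L (u ^ j)\<bar> \<le> real j * (real j / real (Suc N - j))" if N: "N \<ge> j" for N
      proof -
        \<comment> \<open>Averaged against \<open>c\<close>, these quotients give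
          \<open>L (u ^ j)\<close> exactly, by \<open>cm\<close>; the integral of \<open>f\<close>
          averages the powers of \<open>k / Suc N\<close> instead, and the two differ
          little.\<close>
        let ?q = "\<lambda>k. real (k choose j) / real (Suc N choose j)"
        have "L (u ^ j) = (\<Sum>k\<le>Suc N. c (Suc N) k * ?q k)"
        proof -
          have "(\<Sum>k\<le>Suc N. c (Suc N) k * ?q k) = (\<Sum>k\<le>Suc N. real (k choose j) * c (Suc N) k) / real (Suc N choose j)"
            unfolding sum_divide_distrib by (intro sum.cong) auto
          also have "\<dots> = L (u ^ j)" unfolding cm[OF le_SucI[OF N]] using N by simp
          finally show ?thesis by simp
        qed
        moreover have "integral\<^sup>L (M N) f = (\<Sum>k\<le>Suc N. c (Suc N) k * (real k / real (Suc N)) ^ j)"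
          unfolding int[OF fm] by (intro sum.cong) (auto simp: ft)
        ultimately have "L (u ^ j) - integral\<^sup>L (M N) f = (\<Sum>k\<le>Suc N. c (Suc N) k * (?q k - (real k / real (Suc N)) ^ j))"
          by (simp only: sum_subtractf right_diff_distrib)
        then have "\<bar>integral\<^sup>L (M N) f - L (u ^ j)\<bar> = \<bar>\<Sum>k\<le>Suc N. c (Suc N) k * (?q k - (real k / real (Suc N)) ^ j)\<bar>"
          by (subst abs_minus_commute) (rule arg_cong)
        also have "\<dots> \<le> (\<Sum>k\<le>Suc N. c (Suc N) k * (real j * (real j / real (Suc N - j))))"
        proof (rule order_trans[OF sum_abs], rule sum_mono)
          fix k assume "k \<in> {..Suc N}"
          then show "\<bar>c (Suc N) k * (?q k - (real k / real (Suc N)) ^ j)\<bar> \<le> c (Suc N) k * (real j * (real j / real (Suc N - j)))"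
            unfolding abs_mult abs_of_nonneg[OF c0]
            by (intro mult_left_mono binomial_falling_quotient_bound c0) (use N in auto)
        qed
        also have "\<dots> = real j * (real j / real (Suc N - j))"
          unfolding sum_distrib_right[symmetric] c1 by simp
        finally show ?thesis .
      qed
      have "(\<lambda>N. real j * (real j / real (Suc N - j))) \<longlonglongrightarrow> 0"
      proof (rule LIMSEQ_offset[of _ j])
        have "(\<lambda>n. real j * real j * inverse (real (Suc n))) \<longlonglongrightarrow> real j * real j * 0"
          by (intro tendsto_mult tendsto_const LIMSEQ_inverse_real_of_nat)
        then show "(\<lambda>n. real j * (real j / real (Suc (n + j) - j))) \<longlonglongrightarrow> 0"
          by (simp add: divide_inverse Suc_diff_le mult.assoc)
      qed
      then have "(\<lambda>N. integral\<^sup>L (M N) f - L (u ^ j)) \<longlonglongrightarrow> 0"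
        by (rule Lim_null_comparison[rotated]) (auto intro!: eventually_sequentiallyI[of j] order_trans[OF bd])
      then show ?thesis by (simp add: LIM_zero_iff)
    qed
    then have "(\<lambda>n. integral\<^sup>L (M (r n)) f) \<longlonglongrightarrow> L (u ^ j)"
      using LIMSEQ_subseq_LIMSEQ[OF _ r] by (force simp: comp_def)
    moreover have "(\<lambda>n. integral\<^sup>L (M (r n)) f) \<longlonglongrightarrow> integral\<^sup>L K f"
      by (rule wc[of f 1]) (auto simp: fc, auto simp: f_def intro!: power_le_one)
    ultimately have "integral\<^sup>L K f = L (u ^ j)" using LIMSEQ_unique by blast
    moreover have "integral\<^sup>L K f = integral\<^sup>L K (\<lambda>x. poly u x ^ j)"
    proof (rule integral_cong_AE)
      show "AE x in K. f x = poly u x ^ j"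
        using AE by (rule AE_mp) (use ub in \<open>auto simp: f_def intro!: AE_I2\<close>)
    qed (use fm in auto)
    ultimately show ?thesis by simp
  qed
  have integr: "integrable K (poly p)" for p
  proof -
    have "bounded (poly p ` {-R..R})"
      by (intro compact_imp_bounded compact_continuous_image continuous_intros) auto
    then obtain B where B: "\<And>x. x \<in> {-R..R} \<Longrightarrow> norm (poly p x) \<le> B"
      unfolding bounded_iff by blast
    show ?thesis
    proof (rule K.integrable_const_bound[where B=B])
      show "AE x in K. norm (poly p x) \<le> B"
        using AE by (rule AE_mp) (auto intro!: AE_I2 B[unfolded real_norm_def] simp: abs_le_iff[of _ R])
    qed auto
  qed
  have comp: "integral\<^sup>L K (poly (u ^ j * pcompose q u)) = L (u ^ j * pcompose q u)" for j q
  proof (induction q arbitrary: j)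
    case 0
    show ?case by (simp add: L0)
  next
    case (pCons a q)
    have e: "u ^ j * pcompose (pCons a q) u = smult a (u ^ j) + u ^ Suc j * pcompose q u"
      by (simp add: pcompose_pCons algebra_simps)
    have "integral\<^sup>L K (poly (smult a (u ^ j) + u ^ Suc j * pcompose q u))
       = integral\<^sup>L K (\<lambda>x. a * poly (u ^ j) x + poly (u ^ Suc j * pcompose q u) x)"
      by (rule Bochner_Integration.integral_cong) auto
    also have "\<dots> = a * integral\<^sup>L K (poly (u ^ j)) + integral\<^sup>L K (poly (u ^ Suc j * pcompose q u))"
      by (subst Bochner_Integration.integral_add) (use integr in \<open>auto simp del: poly_mult poly_power\<close>)
    also have "integral\<^sup>L K (poly (u ^ j)) = L (u ^ j)"
      unfolding mom[symmetric] by (rule Bochner_Integration.integral_cong) auto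
    finally show ?case unfolding e by (simp add: pCons.IH add scale del: power_Suc poly_mult)
  qed
  have "integral\<^sup>L K (poly p) = L p" for p
  proof -
    \<comment> \<open>Every polynomial is a polynomial in \<open>u\<close>, because
      \<open>[:-R, 2*R:]\<close> inverts \<open>u\<close>.\<close>
    have "pcompose (pcompose p [:-R, 2*R:]) u = pcompose p (pcompose [:-R, 2*R:] u)"
      by (rule pcompose_assoc[symmetric])
    also have "pcompose [:-R, 2*R:] u = [:0, 1:]"
      using R by (simp add: u_def pcompose_pCons)
    finally have "pcompose (pcompose p [:-R, 2*R:]) u = p" by simp
    then show ?thesis using comp[of 0 "pcompose p [:-R, 2*R:]"] by simp
  qed
  then show ?thesis using K AE by blast
qed

section \<open>Square summable functions and symmetric operators\<close>

lemma ell2_abs_summable: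
  assumes "f \<in> ell2" "g \<in> ell2"
  shows "(\<lambda>x. norm (f x * cnj (g x))) summable_on UNIV"
proof (rule summable_on_comparison_test)
  show "(\<lambda>x. (cmod (f x))\<^sup>2 + (cmod (g x))\<^sup>2) summable_on UNIV"
    using assms unfolding ell2_def by (intro summable_on_add) auto
  fix x
  have "0 \<le> (cmod (f x) - cmod (g x))\<^sup>2" by simp
  then have "2 * (cmod (f x) * cmod (g x)) \<le> (cmod (f x))\<^sup>2 + (cmod (g x))\<^sup>2"
    by (simp add: power2_diff)
  moreover have "0 \<le> cmod (f x) * cmod (g x)" by simp
  ultimately show "norm (f x * cnj (g x)) \<le> (cmod (f x))\<^sup>2 + (cmod (g x))\<^sup>2"
    unfolding norm_mult complex_mod_cnj by linarith
qed auto

lemma ell2_summable: "f \<in> ell2 \<Longrightarrow> g \<in> ell2 \<Longrightarrow> (\<lambda>x. f x * cnj (g x)) summable_on UNIV"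
  by (rule Infinite_Sum.abs_summable_summable[OF ell2_abs_summable])

lemma ell2_scale [intro]: "f \<in> ell2 \<Longrightarrow> (\<lambda>x. c * f x) \<in> ell2"
  unfolding ell2_def by (simp add: norm_mult power_mult_distrib summable_on_cmult_right)

lemma ell2_add [intro]:
  assumes "f \<in> ell2" "g \<in> ell2"
  shows "(\<lambda>x. f x + g x) \<in> ell2"
  unfolding ell2_def
proof (rule CollectI, rule summable_on_comparison_test)
  show "(\<lambda>x. 2 * (cmod (f x))\<^sup>2 + 2 * (cmod (g x))\<^sup>2) summable_on UNIV"
    using assms unfolding ell2_def by (intro summable_on_add summable_on_cmult_right) auto
  fix x
  have "(cmod (f x + g x))\<^sup>2 \<le> (cmod (f x) + cmod (g x))\<^sup>2"
    by (intro power_mono norm_triangle_ineq) auto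
  also have "\<dots> \<le> 2 * (cmod (f x))\<^sup>2 + 2 * (cmod (g x))\<^sup>2"
    using zero_le_power2[of "cmod (f x) - cmod (g x)"] by (simp add: power2_diff power2_sum)
  finally show "(cmod (f x + g x))\<^sup>2 \<le> 2 * (cmod (f x))\<^sup>2 + 2 * (cmod (g x))\<^sup>2" .
qed auto

lemma ell2_zero [intro, simp]: "(\<lambda>x. 0) \<in> ell2"
  by (simp add: ell2_def)

lemma ell2_sum [intro]: "(\<And>i. i \<in> A \<Longrightarrow> f i \<in> ell2) \<Longrightarrow> (\<lambda>x. \<Sum>i\<in>A. f i x) \<in> ell2"
  by (induction A rule: infinite_finite_induct) auto

lemma ell2_comb [intro]: "f \<in> ell2 \<Longrightarrow> g \<in> ell2 \<Longrightarrow> (\<lambda>x. c * f x + g x) \<in> ell2"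
  by (intro ell2_add ell2_scale)

lemma ell2_finite_support:
  assumes "finite {x. f x \<noteq> 0}" shows "f \<in> ell2"
  unfolding ell2_def
proof (rule CollectI)
  have "(\<lambda>x. (cmod (f x))\<^sup>2) summable_on {x. f x \<noteq> 0}" using assms by (rule summable_on_finite)
  then show "(\<lambda>x. (cmod (f x))\<^sup>2) summable_on UNIV"
    by (subst summable_on_cong_neutral[where T="{x. f x \<noteq> 0}" and g="\<lambda>x. (cmod (f x))\<^sup>2"]) auto
qed

lemma ell2_inner_add_left: "f \<in> ell2 \<Longrightarrow> g \<in> ell2 \<Longrightarrow> h \<in> ell2 \<Longrightarrow>
    ell2_inner (\<lambda>x. f x + g x) h = ell2_inner f h + ell2_inner g h"
  unfolding ell2_inner_def by (simp add: distrib_right infsum_add ell2_summable)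

lemma ell2_inner_scale_left: "ell2_inner (\<lambda>x. c * f x) h = c * ell2_inner f h"
  unfolding ell2_inner_def by (simp add: mult.assoc infsum_cmult_right')

lemma ell2_inner_cnj: "ell2_inner g f = cnj (ell2_inner f g)"
  unfolding ell2_inner_def by (simp add: infsum_cnj[symmetric] mult.commute)

lemma ell2_inner_add_right: "f \<in> ell2 \<Longrightarrow> g \<in> ell2 \<Longrightarrow> h \<in> ell2 \<Longrightarrow>
    ell2_inner h (\<lambda>x. f x + g x) = ell2_inner h f + ell2_inner h g"
  using ell2_inner_add_left[of f g h] by (metis ell2_inner_cnj complex_cnj_add)

lemma ell2_inner_scale_right: "ell2_inner h (\<lambda>x. c * f x) = cnj c * ell2_inner h f"
  by (metis ell2_inner_cnj ell2_inner_scale_left complex_cnj_mult)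

lemma ell2_inner_sum_left: "(\<And>i. i \<in> A \<Longrightarrow> f i \<in> ell2) \<Longrightarrow> h \<in> ell2 \<Longrightarrow>
    ell2_inner (\<lambda>x. \<Sum>i\<in>A. f i x) h = (\<Sum>i\<in>A. ell2_inner (f i) h)"
proof (induction A rule: infinite_finite_induct)
  case (insert a A)
  then have "ell2_inner (\<lambda>x. f a x + (\<Sum>i\<in>A. f i x)) h = ell2_inner (f a) h + ell2_inner (\<lambda>x. \<Sum>i\<in>A. f i x) h"
    by (intro ell2_inner_add_left) auto
  then show ?case using insert by simp
qed (auto simp: ell2_inner_def)

lemma ell2_inner_sum_right: "(\<And>i. i \<in> A \<Longrightarrow> f i \<in> ell2) \<Longrightarrow> h \<in> ell2 \<Longrightarrow>
    ell2_inner h (\<lambda>x. \<Sum>i\<in>A. f i x) = (\<Sum>i\<in>A. ell2_inner h (f i))"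
  using ell2_inner_sum_left[of A f h] by (subst (1 2) ell2_inner_cnj) (simp only: cnj_sum)

lemma ell2_inner_self: "f \<in> ell2 \<Longrightarrow> ell2_inner f f = of_real (\<Sum>\<^sub>\<infinity>x. (cmod (f x))\<^sup>2)"
proof -
  assume "f \<in> ell2"
  then have "((\<lambda>x. (cmod (f x))\<^sup>2) has_sum (\<Sum>\<^sub>\<infinity>x. (cmod (f x))\<^sup>2)) UNIV"
    by (auto simp: ell2_def)
  then have "((\<lambda>x. complex_of_real ((cmod (f x))\<^sup>2)) has_sum of_real (\<Sum>\<^sub>\<infinity>x. (cmod (f x))\<^sup>2)) UNIV"
    by (rule has_sum_of_real)
  moreover have "complex_of_real ((cmod (f x))\<^sup>2) = f x * cnj (f x)" for x by (rule complex_norm_square)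
  ultimately show ?thesis unfolding ell2_inner_def by (simp add: infsumI)
qed

definition ell2_norm :: "('v \<Rightarrow> complex) \<Rightarrow> real" where "ell2_norm f = sqrt (\<Sum>\<^sub>\<infinity>x. (cmod (f x))\<^sup>2)"

lemma ell2_norm_square: "f \<in> ell2 \<Longrightarrow> ell2_inner f f = of_real ((ell2_norm f)\<^sup>2)"
  by (simp add: ell2_inner_self ell2_norm_def infsum_nonneg)

lemma ell2_norm_nonneg [simp]: "0 \<le> ell2_norm f"
  by (simp add: ell2_norm_def infsum_nonneg)

lemma ell2_cauchy_schwarz:
  assumes f: "f \<in> ell2" and g: "g \<in> ell2"
  shows "cmod (ell2_inner f g) \<le> ell2_norm f * ell2_norm g"
proof (cases "ell2_norm g = 0")
  case False
  define n where "n = ell2_norm g"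
  have n: "n > 0" using False by (simp add: n_def less_le)
  define c where "c = - (ell2_inner f g / of_real (n\<^sup>2))"
  define h where "h = (\<lambda>x. f x + c * g x)"
  have hl: "h \<in> ell2" unfolding h_def using f g by auto
  have cg: "(\<lambda>x. c * g x) \<in> ell2" using g by auto
  have "ell2_inner h h = ell2_inner f f + cnj c * ell2_inner f g + c * ell2_inner g f + c * (cnj c * ell2_inner g g)"
    unfolding h_def using f g cg hl[unfolded h_def]
    by (simp add: ell2_inner_add_left ell2_inner_add_right ell2_inner_scale_left ell2_inner_scale_right algebra_simps)
  also have "ell2_inner g g = of_real (n\<^sup>2)" using ell2_norm_square[OF g] by (simp add: n_def)
  also have "ell2_inner g f = cnj (ell2_inner f g)" by (rule ell2_inner_cnj)
  also have "ell2_inner f f + cnj c * ell2_inner f g + c * cnj (ell2_inner f g) + c * (cnj c * of_real (n\<^sup>2))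
     = ell2_inner f f - ell2_inner f g * cnj (ell2_inner f g) / of_real (n\<^sup>2)"
    using n by (simp add: c_def field_simps power2_eq_square)
  also have "\<dots> = of_real ((ell2_norm f)\<^sup>2 - (cmod (ell2_inner f g))\<^sup>2 / n\<^sup>2)"
    using ell2_norm_square[OF f] complex_norm_square[of "ell2_inner f g"] by simp
  finally have "complex_of_real ((ell2_norm h)\<^sup>2) = of_real ((ell2_norm f)\<^sup>2 - (cmod (ell2_inner f g))\<^sup>2 / n\<^sup>2)"
    using ell2_norm_square[OF hl] by simp
  then have "(ell2_norm h)\<^sup>2 = (ell2_norm f)\<^sup>2 - (cmod (ell2_inner f g))\<^sup>2 / n\<^sup>2" by (simp only: of_real_eq_iff)
  then have "(cmod (ell2_inner f g))\<^sup>2 / n\<^sup>2 \<le> (ell2_norm f)\<^sup>2" using zero_le_power2[of "ell2_norm h"] by linarith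
  then have "(cmod (ell2_inner f g))\<^sup>2 \<le> (ell2_norm f * n)\<^sup>2" using n by (simp add: field_simps)
  then show ?thesis using n by (simp add: n_def power2_le_iff_abs_le)
next
  case True
  then have z: "infsum (\<lambda>x. (cmod (g x))\<^sup>2) UNIV = 0" by (simp add: ell2_norm_def infsum_nonneg)
  have s: "(\<lambda>x. (cmod (g x))\<^sup>2) summable_on UNIV" using g by (simp add: ell2_def)
  have "g x = 0" for x
  proof -
    have "(cmod (g x))\<^sup>2 = 0"
      by (rule nonneg_infsum_le_0D[OF _ s]) (use z in auto)
    then show ?thesis by simp
  qed
  then have "ell2_inner f g = 0" by (simp add: ell2_inner_def)
  then show ?thesis by simp
qed

definition delta :: "'v \<Rightarrow> 'v \<Rightarrow> complex" where "delta v = (\<lambda>x. if x = v then 1 else 0)"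

lemma delta_ell2 [intro, simp]: "delta v \<in> ell2"
  by (rule ell2_finite_support) (simp add: delta_def)

lemma ell2_inner_finite:
  assumes "finite S" "\<And>x. x \<notin> S \<Longrightarrow> f x * cnj (g x) = 0"
  shows "ell2_inner f g = (\<Sum>x\<in>S. f x * cnj (g x))"
proof -
  have "ell2_inner f g = infsum (\<lambda>x. f x * cnj (g x)) S"
    unfolding ell2_inner_def by (rule infsum_cong_neutral) (use assms in auto)
  then show ?thesis using assms(1) by simp
qed

lemma ell2_inner_delta [simp]: "ell2_inner f (delta v) = f v"
  by (subst ell2_inner_finite[of "{v}"]) (auto simp: delta_def)

lemma ell2_norm_delta: "ell2_norm (delta v) = 1"
proof -
  have "ell2_inner (delta v) (delta v) = (1::complex)" unfolding ell2_inner_delta by (simp add: delta_def)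
  then have "(ell2_norm (delta v))\<^sup>2 = 1" using ell2_norm_square[OF delta_ell2, of v] by (metis of_real_eq_1_iff)
  then show ?thesis using power2_eq_imp_eq[of "ell2_norm (delta v)" 1] by simp
qed

lemma ell2_norm_point: "f \<in> ell2 \<Longrightarrow> cmod (f v) \<le> ell2_norm f"
  using ell2_cauchy_schwarz[of f "delta v"] by (simp add: ell2_norm_delta)

text \<open>This is \<open>p(T) f\<close>, kept as an explicit finite sum over iterates, so that the
  polynomial calculus needs no spectral theorem.\<close>

definition pop :: "(('v \<Rightarrow> complex) \<Rightarrow> 'v \<Rightarrow> complex) \<Rightarrow> real poly \<Rightarrow> ('v \<Rightarrow> complex) \<Rightarrow> 'v \<Rightarrow> complex" where
  "pop T p f = (\<lambda>x. \<Sum>i\<le>degree p. of_real (coeff p i) * (T ^^ i) f x)"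

text \<open>Reality of the quadratic form is assumed in place of symmetry, since it is what a
  spectral resolution delivers directly and it passes at once to subtrees; symmetry is recovered in
  \<open>T_sym\<close>.\<close>

locale symmetric_op =
  fixes T :: "('v \<Rightarrow> complex) \<Rightarrow> 'v \<Rightarrow> complex"
  assumes T_ell2 [intro]: "f \<in> ell2 \<Longrightarrow> T f \<in> ell2"
    and T_comb: "f \<in> ell2 \<Longrightarrow> g \<in> ell2 \<Longrightarrow> T (\<lambda>x. c * f x + g x) = (\<lambda>x. c * T f x + T g x)"
    and T_real: "f \<in> ell2 \<Longrightarrow> ell2_inner (T f) f \<in> \<real>"
begin

lemma T_zero: "T (\<lambda>x. 0) = (\<lambda>x. 0)"
  using T_comb[of "\<lambda>x. 0" "\<lambda>x. 0" "-1"] by simp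

lemma T_scale: "f \<in> ell2 \<Longrightarrow> T (\<lambda>x. c * f x) = (\<lambda>x. c * T f x)"
  using T_comb[of f "\<lambda>x. 0" c] by (simp add: T_zero)

lemma T_add: "f \<in> ell2 \<Longrightarrow> g \<in> ell2 \<Longrightarrow> T (\<lambda>x. f x + g x) = (\<lambda>x. T f x + T g x)"
  using T_comb[of f g 1] by simp

lemma T_sum: "(\<And>i. i \<in> A \<Longrightarrow> f i \<in> ell2) \<Longrightarrow> T (\<lambda>x. \<Sum>i\<in>A. f i x) = (\<lambda>x. \<Sum>i\<in>A. T (f i) x)"
proof (induction A rule: infinite_finite_induct)
  case (insert a A)
  then show ?case using T_add[of "f a" "\<lambda>x. \<Sum>i\<in>A. f i x"] by (simp add: ell2_sum)
qed (auto simp: T_zero)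

text \<open>Polarization: in the form at \<open>c f + g\<close> the mixed terms are real for every
  \<open>c\<close>, and \<open>c = 1\<close> and \<open>c = \<i>\<close> give the imaginary and the
  real part of the identity.\<close>

lemma T_sym:
  assumes f: "f \<in> ell2" and g: "g \<in> ell2"
  shows "ell2_inner (T f) g = ell2_inner f (T g)"
proof -
  let ?d = "\<lambda>f g. ell2_inner (T f) g - cnj (ell2_inner (T g) f)"
  have expand: "ell2_inner (T (\<lambda>x. c * f x + g x)) (\<lambda>x. c * f x + g x) =
      c * cnj c * ell2_inner (T f) f + c * ell2_inner (T f) g + cnj c * ell2_inner (T g) f + ell2_inner (T g) g" for c
    unfolding T_comb[OF f g] using f g T_ell2[OF f] T_ell2[OF g]
    by (simp add: ell2_inner_add_left ell2_inner_add_right ell2_inner_scale_left ell2_inner_scale_right ell2_scale ell2_comb)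
      (simp add: algebra_simps)
  have re: "c * ell2_inner (T f) g + cnj c * ell2_inner (T g) f \<in> \<real>" for c
  proof -
    have "ell2_inner (T (\<lambda>x. c * f x + g x)) (\<lambda>x. c * f x + g x) \<in> \<real>" using f g by (intro T_real) auto
    moreover have "c * cnj c * ell2_inner (T f) f \<in> \<real>"
      using T_real[OF f] by (metis Reals_mult Reals_of_real complex_norm_square)
    ultimately have "ell2_inner (T (\<lambda>x. c * f x + g x)) (\<lambda>x. c * f x + g x) - c * cnj c * ell2_inner (T f) f - ell2_inner (T g) g \<in> \<real>"
      using T_real[OF g] by (metis Reals_diff)
    then show ?thesis unfolding expand by simp
  qed
  have "Im (ell2_inner (T f) g + ell2_inner (T g) f) = 0" using re[of 1] by (simp add: complex_is_Real_iff)
  moreover have "Im (\<i> * ell2_inner (T f) g - \<i> * ell2_inner (T g) f) = 0" using re[of \<i>] by (simp add: complex_is_Real_iff)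
  ultimately have "ell2_inner (T f) g = cnj (ell2_inner (T g) f)" by (simp add: complex_eq_iff)
  then show ?thesis using ell2_inner_cnj[of f "T g"] by simp
qed

lemma pow_ell2 [intro]: "f \<in> ell2 \<Longrightarrow> (T ^^ i) f \<in> ell2"
  by (induction i) auto

lemma pow_sym: "f \<in> ell2 \<Longrightarrow> g \<in> ell2 \<Longrightarrow> ell2_inner ((T ^^ i) f) g = ell2_inner f ((T ^^ i) g)"
proof (induction i arbitrary: g)
  case (Suc i)
  have "ell2_inner ((T ^^ Suc i) f) g = ell2_inner ((T ^^ i) f) (T g)" using Suc.prems by (simp add: T_sym pow_ell2)
  also have "\<dots> = ell2_inner f ((T ^^ i) (T g))"
    using Suc.prems by (intro Suc.IH) auto
  finally show ?case by (simp add: funpow_swap1)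
qed simp

lemma pop_ell2 [intro]: "f \<in> ell2 \<Longrightarrow> pop T p f \<in> ell2"
  unfolding pop_def by (intro ell2_sum ell2_scale pow_ell2)

lemma pop_sum_bound: "degree p \<le> n \<Longrightarrow> pop T p f = (\<lambda>x. \<Sum>i\<le>n. of_real (coeff p i) * (T ^^ i) f x)"
  unfolding pop_def by (rule ext, rule sum.mono_neutral_left) (auto simp: coeff_eq_0)

lemma pop_inner: "f \<in> ell2 \<Longrightarrow> h \<in> ell2 \<Longrightarrow> ell2_inner (pop T p f) h = (\<Sum>i\<le>degree p. of_real (coeff p i) * ell2_inner ((T ^^ i) f) h)"
  unfolding pop_def by (subst ell2_inner_sum_left) (auto simp: ell2_inner_scale_left)

lemma pop_sym: "f \<in> ell2 \<Longrightarrow> h \<in> ell2 \<Longrightarrow> ell2_inner (pop T p f) h = ell2_inner f (pop T p h)"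
  unfolding pop_inner unfolding pop_def
  by (subst ell2_inner_sum_right) (auto simp: ell2_inner_scale_right pow_sym pow_ell2)

definition moment :: "('v \<Rightarrow> complex) \<Rightarrow> nat \<Rightarrow> real" where "moment f i = Re (ell2_inner ((T ^^ i) f) f)"

lemma pow_real: "f \<in> ell2 \<Longrightarrow> ell2_inner ((T ^^ i) f) f = of_real (moment f i)"
proof -
  assume f: "f \<in> ell2"
  have "ell2_inner ((T ^^ i) f) f = cnj (ell2_inner ((T ^^ i) f) f)"
    using pow_sym[OF f f, of i] ell2_inner_cnj by metis
  then show ?thesis by (simp add: moment_def complex_eq_iff)
qed

text \<open>The functional \<open>p \<mapsto> <p(T) f, f>\<close>, that is, integration against the
  spectral measure of \<open>f\<close> before such a measure is known to exist.\<close>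

definition mfun :: "('v \<Rightarrow> complex) \<Rightarrow> real poly \<Rightarrow> real" where "mfun f p = (\<Sum>i\<le>degree p. coeff p i * moment f i)"

lemma mfun_bound: "degree p \<le> n \<Longrightarrow> mfun f p = (\<Sum>i\<le>n. coeff p i * moment f i)"
  unfolding mfun_def by (rule sum.mono_neutral_left) (auto simp: coeff_eq_0)

lemma mfun_add: "mfun f (p + q) = mfun f p + mfun f q"
proof -
  let ?n = "max (degree p) (degree q)"
  have "degree (p + q) \<le> ?n" by (rule degree_add_le) auto
  then show ?thesis by (simp add: mfun_bound[of _ ?n] distrib_right sum.distrib)
qed

lemma mfun_smult: "mfun f (smult c p) = c * mfun f p"
  using mfun_bound[OF degree_smult_le, of f c p] by (simp add: mfun_def sum_distrib_left mult.assoc)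

lemma inner_pop: "f \<in> ell2 \<Longrightarrow> ell2_inner (pop T p f) f = of_real (mfun f p)"
  by (simp add: pop_inner pow_real mfun_def)

lemma T_pop: "f \<in> ell2 \<Longrightarrow> T (pop T p f) = (\<lambda>x. \<Sum>i\<le>degree p. of_real (coeff p i) * (T ^^ Suc i) f x)"
  unfolding pop_def by (subst T_sum) (auto simp: T_scale pow_ell2 ell2_scale)

lemma pop_pCons: "f \<in> ell2 \<Longrightarrow> pop T (pCons a p) f = (\<lambda>x. of_real a * f x + T (pop T p f) x)"
  by (subst pop_sum_bound[of _ "Suc (degree p)"], simp add: degree_pCons_le, unfold T_pop sum.atMost_Suc_shift) simp

lemma pop_T: "f \<in> ell2 \<Longrightarrow> pop T ([:0, 1:] * p) f = T (pop T p f)"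
  using pop_pCons[of f 0 p] by simp

text \<open>By symmetry one factor \<open>T\<close> at a time moves from the left vector to the
  right one, which is why \<open>q\<close> is generalized in the induction. With
  \<open>p = q\<close> squared norms become values of \<open>mfun\<close>.\<close>

lemma inner_pop_pop:
  assumes f: "f \<in> ell2"
  shows "ell2_inner (pop T p f) (pop T q f) = of_real (mfun f (p * q))"
proof (induction p arbitrary: q)
  case 0
  show ?case by (simp add: pop_def mfun_def ell2_inner_def)
next
  case (pCons a p)
  have e1: "pop T (pCons a p) f = (\<lambda>x. of_real a * f x + T (pop T p f) x)"
    by (rule pop_pCons[OF f])
  have e2: "T (pop T q f) = pop T ([:0, 1:] * q) f"
    by (rule pop_T[OF f, symmetric])
  have pf: "pop T p f \<in> ell2" "pop T q f \<in> ell2" using f by auto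
  have "ell2_inner (pop T (pCons a p) f) (pop T q f) = of_real a * ell2_inner f (pop T q f) + ell2_inner (T (pop T p f)) (pop T q f)"
    unfolding e1 using f pf by (simp add: ell2_inner_add_left ell2_inner_scale_left ell2_scale T_ell2)
  also have "ell2_inner f (pop T q f) = of_real (mfun f q)" using inner_pop[OF f] pop_sym[OF f f] by metis
  also have "ell2_inner (T (pop T p f)) (pop T q f) = ell2_inner (pop T p f) (pop T ([:0, 1:] * q) f)"
    unfolding T_sym[OF pf] e2 ..
  also have "\<dots> = of_real (mfun f (p * ([:0, 1:] * q)))" by (rule pCons.IH)
  also have "of_real a * of_real (mfun f q) + \<dots> = of_real (mfun f (pCons a p * q))"
    by (simp add: mfun_add mfun_smult)
  finally show ?case .
qed

end

section \<open>Spectral resolutions\<close>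

text \<open>Additivity on sets extends to integrals by the usual passage through simple functions.
  Three summands match the expansion of a squared norm of a sum: two squares and a mixed term that
  is itself a measure.\<close>

lemma nn_integral_measure_add3:
  assumes s: "sets M1 = sets M" "sets M2 = sets M" "sets M3 = sets M"
    and e: "\<And>A. A \<in> sets M \<Longrightarrow> emeasure M A = emeasure M1 A + emeasure M2 A + emeasure M3 A"
    and f: "f \<in> borel_measurable M"
  shows "(\<integral>\<^sup>+x. f x \<partial>M) = (\<integral>\<^sup>+x. f x \<partial>M1) + (\<integral>\<^sup>+x. f x \<partial>M2) + (\<integral>\<^sup>+x. f x \<partial>M3)"
proof -
  have mc: "measurable M1 L = measurable M L" "measurable M2 L = measurable M L" "measurable M3 L = measurable M L" for L :: "ennreal measure"
    by (rule measurable_cong_sets[OF s(1) refl], rule measurable_cong_sets[OF s(2) refl], rule measurable_cong_sets[OF s(3) refl])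
  show ?thesis using f
proof (induction rule: borel_measurable_induct)
  case (cong f g)
  have sp: "space M1 = space M" "space M2 = space M" "space M3 = space M"
    using s[THEN sets_eq_imp_space_eq] by auto
  have "(\<integral>\<^sup>+x. g x \<partial>K) = (\<integral>\<^sup>+x. f x \<partial>K)" if "space K = space M" for K
    using cong(3) that by (intro nn_integral_cong) auto
  then show ?case using cong(4) sp by simp
next
  case (set A)
  then show ?case using s e by simp
next
  case (mult u c)
  then have "u \<in> borel_measurable M1" "u \<in> borel_measurable M2" "u \<in> borel_measurable M3"
    by (simp_all only: mc)
  then show ?case using mult by (simp add: nn_integral_cmult distrib_left)
next
  case (add u v)
  then have "u \<in> borel_measurable M1" "u \<in> borel_measurable M2" "u \<in> borel_measurable M3"
     "v \<in> borel_measurable M1" "v \<in> borel_measurable M2" "v \<in> borel_measurable M3"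
    by (simp_all only: mc)
  then show ?case using add by (simp add: nn_integral_add ac_simps)
next
  case (seq U)
  have m: "U i \<in> borel_measurable M1" "U i \<in> borel_measurable M2" "U i \<in> borel_measurable M3" for i
    using seq(1)[of i] by (simp_all only: mc)
  have l: "(\<lambda>i. \<integral>\<^sup>+x. U i x \<partial>K) \<longlonglongrightarrow> (\<integral>\<^sup>+x. (SUP i. U i) x \<partial>K)" if "\<And>i. U i \<in> borel_measurable K" for K
  proof (rule nn_integral_LIMSEQ[OF seq(3) that])
    fix x
    have "incseq (\<lambda>i. U i x)" using seq(3) by (auto simp: incseq_def le_fun_def)
    from LIMSEQ_SUP[OF this] show "(\<lambda>i. U i x) \<longlonglongrightarrow> (SUP i. U i) x" by (simp add: image_comp)
  qed
  have "(\<lambda>i. (\<integral>\<^sup>+x. U i x \<partial>M1) + (\<integral>\<^sup>+x. U i x \<partial>M2) + (\<integral>\<^sup>+x. U i x \<partial>M3)) \<longlonglongrightarrow>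
     (\<integral>\<^sup>+x. (SUP i. U i) x \<partial>M1) + (\<integral>\<^sup>+x. (SUP i. U i) x \<partial>M2) + (\<integral>\<^sup>+x. (SUP i. U i) x \<partial>M3)"
    by (intro tendsto_add l m)
  then have "(\<lambda>i. \<integral>\<^sup>+x. U i x \<partial>M) \<longlonglongrightarrow>
     (\<integral>\<^sup>+x. (SUP i. U i) x \<partial>M1) + (\<integral>\<^sup>+x. (SUP i. U i) x \<partial>M2) + (\<integral>\<^sup>+x. (SUP i. U i) x \<partial>M3)"
    by (subst seq.IH)
  with l[OF seq(1)] show ?case using LIMSEQ_unique by blast
qed
qed

text \<open>A compact part of \<open>N\<close> carries almost all of \<open>\<sigma>\<close>, a
  small open neighbourhood of it has almost no \<open>K\<close>-mass, and a continuous cutoff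
  between the two is uniformly close to a polynomial on the bounded common support.\<close>

lemma polynomial_separates_null_set:
  fixes \<sigma> K :: "real measure"
  assumes fs: "finite_measure \<sigma>" "sets \<sigma> = sets borel" and fK: "finite_measure K" "sets K = sets borel"
    and supp: "AE x in \<sigma>. \<bar>x\<bar> \<le> R" "AE x in K. \<bar>x\<bar> \<le> R"
    and N: "N \<in> sets borel" "emeasure K N = 0" "emeasure \<sigma> (- N) = 0" and e: "e > 0"
  obtains p :: "real poly" where "(\<integral>x. (poly p x)\<^sup>2 \<partial>K) \<le> e" "(\<integral>x. (poly p x - 1)\<^sup>2 \<partial>\<sigma>) \<le> e"
proof -
  interpret s: finite_measure \<sigma> by (rule fs)
  interpret k: finite_measure K by (rule fK)
  have ms: "measurable \<sigma> L = measurable borel L" "measurable K L = measurable borel L" for L :: "real measure"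
    by (rule measurable_cong_sets[OF fs(2) refl], rule measurable_cong_sets[OF fK(2) refl])
  have sp: "space \<sigma> = UNIV" "space K = UNIV" using sets_eq_imp_space_eq[OF fs(2)] sets_eq_imp_space_eq[OF fK(2)] by simp_all
  define T where "T = measure \<sigma> UNIV + measure K UNIV + 1"
  \<comment> \<open>Each integral will be at most \<open>2 * \<eta>\<close> times a total mass plus
    \<open>2 * \<eta>\<close>, hence at most \<open>2 * \<eta> * T\<close>; the cap 1 allows
    \<open>\<eta>\<close> in place of its square.\<close>
  define \<eta> where "\<eta> = min 1 (e / (4 * T))"
  have T: "T \<ge> 1" by (simp add: T_def)
  have eta: "0 < \<eta>" "\<eta> \<le> 1" "4 * T * \<eta> \<le> e"
    using e T by (auto simp: \<eta>_def min_def field_simps)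
  have eta2: "\<eta>\<^sup>2 \<le> \<eta>" using eta by (simp add: power2_eq_square mult_left_le)
  have "emeasure \<sigma> N = (SUP C \<in> {C. C \<subseteq> N \<and> compact C}. emeasure \<sigma> C)"
    by (rule inner_regular[OF fs(2) _ N(1)]) (use s.emeasure_finite in auto)
  moreover have "emeasure \<sigma> N < emeasure \<sigma> N + ennreal \<eta>"
    using eta by (simp add: s.emeasure_eq_measure ennreal_less_iff flip: ennreal_plus)
  ultimately obtain C where C: "C \<subseteq> N" "compact C" "emeasure \<sigma> N < emeasure \<sigma> C + ennreal \<eta>"
  proof -
    assume eq: "emeasure \<sigma> N = (SUP C \<in> {C. C \<subseteq> N \<and> compact C}. emeasure \<sigma> C)"
    have "\<exists>C\<in>{C. C \<subseteq> N \<and> compact C}. emeasure \<sigma> N < emeasure \<sigma> C + ennreal \<eta>"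
    proof (rule ccontr)
      assume n: "\<not> ?thesis"
      have "emeasure \<sigma> C \<le> ennreal (measure \<sigma> N - \<eta>)" if "C \<in> {C. C \<subseteq> N \<and> compact C}" for C
      proof -
        have "emeasure \<sigma> C + ennreal \<eta> \<le> emeasure \<sigma> N" using n that by force
        then have "measure \<sigma> C + \<eta> \<le> measure \<sigma> N"
          using eta by (simp add: s.emeasure_eq_measure flip: ennreal_plus)
        then show ?thesis by (simp add: s.emeasure_eq_measure ennreal_leI)
      qed
      then have "emeasure \<sigma> N \<le> ennreal (measure \<sigma> N - \<eta>)" unfolding eq by (rule SUP_least)
      moreover have "emeasure \<sigma> {} + ennreal \<eta> \<le> emeasure \<sigma> N" using n by force
      ultimately show False using eta by (simp add: s.emeasure_eq_measure ennreal_le_iff2)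
    qed
    then show thesis using that by blast
  qed
  have Cb: "C \<in> sets borel" using borel_closed[OF compact_imp_closed[OF C(2)]] by simp
  have sC: "measure \<sigma> (- C) \<le> \<eta>"
  proof -
    have "measure \<sigma> (- C) \<le> measure \<sigma> (N - C) + measure \<sigma> (- N)"
    proof -
      have "- C = (N - C) \<union> (- N)" using C(1) by auto
      moreover have "measure \<sigma> ((N - C) \<union> (- N)) \<le> measure \<sigma> (N - C) + measure \<sigma> (- N)"
        by (rule measure_Un_le) (use Cb N(1) fs(2) in auto)
      ultimately show ?thesis by simp
    qed
    moreover have "measure \<sigma> (- N) = 0" using N(3) by (simp add: measure_def)
    moreover have "measure \<sigma> (N - C) = measure \<sigma> N - measure \<sigma> C"
      using Cb N(1) fs(2) C(1) by (intro s.finite_measure_Diff) auto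
    moreover have "measure \<sigma> N < measure \<sigma> C + \<eta>"
      using C(3) eta by (simp add: s.emeasure_eq_measure ennreal_less_iff flip: ennreal_plus)
    ultimately show ?thesis by simp
  qed
  have "emeasure K C = 0" using N(2) C(1) N(1) fK(2) by (metis emeasure_mono le_zero_eq)
  moreover have "emeasure K C = (INF U \<in> {U. C \<subseteq> U \<and> open U}. emeasure K U)"
    by (rule outer_regular[OF fK(2) _ Cb]) (use k.emeasure_finite in auto)
  ultimately have "(INF U \<in> {U. C \<subseteq> U \<and> open U}. emeasure K U) < ennreal \<eta>" using eta by simp
  then obtain U where U: "C \<subseteq> U" "open U" "emeasure K U < ennreal \<eta>" by (auto simp: INF_less_iff)
  have KU: "measure K U \<le> \<eta>" using U(3) eta by (simp add: k.emeasure_eq_measure ennreal_less_iff)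
  have "closed C" "closed (- U)" "C \<inter> - U = {}" using U C(2) compact_imp_closed by auto
  then obtain f :: "real \<Rightarrow> real" where f: "continuous_on UNIV f" "\<And>x. f x \<in> closed_segment 1 0"
      "\<And>x. x \<in> C \<Longrightarrow> f x = 1" "\<And>x. x \<in> - U \<Longrightarrow> f x = 0"
    using Urysohn[of C "- U" 1 "0::real"] by metis
  have f01: "0 \<le> f x" "f x \<le> 1" for x using f(2)[of x] by (auto simp: closed_segment_eq_real_ivl)
  obtain g where g: "real_polynomial_function g" "\<And>x. x \<in> {-R..R} \<Longrightarrow> \<bar>f x - g x\<bar> < \<eta>"
    using Stone_Weierstrass_real_polynomial_function[of "{-R..R}" f \<eta>] continuous_on_subset[OF f(1)] eta by auto
  obtain a n where g2: "g = (\<lambda>x. \<Sum>i\<le>n::nat. a i * x ^ i)"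
    using g(1) real_polynomial_function_iff_sum by metis
  define p where "p = (\<Sum>i\<le>n. monom (a i) i)"
  have pg: "poly p x = g x" for x by (simp add: p_def g2 poly_sum poly_monom)
  have pb: "\<bar>f x - poly p x\<bar> \<le> \<eta>" if "\<bar>x\<bar> \<le> R" for x using g(2)[of x] that by (auto simp: pg abs_le_iff)
  have fm: "f \<in> borel_measurable borel" by (rule borel_measurable_continuous_onI[OF f(1)])
  have sq2: "u\<^sup>2 \<le> 2 * \<eta>\<^sup>2 + 2 * v\<^sup>2" if "\<bar>v - u\<bar> \<le> \<eta>" for u v :: real
  proof -
    have "(v - u)\<^sup>2 \<le> \<eta>\<^sup>2" using that eta by (simp add: abs_le_square_iff[symmetric])
    moreover have "u\<^sup>2 \<le> 2 * (v - u)\<^sup>2 + 2 * v\<^sup>2" using zero_le_power2[of "u - 2 * v"] by (simp add: power2_eq_square algebra_simps)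
    ultimately show ?thesis by linarith
  qed
  have 1: "(\<integral>x. (poly p x)\<^sup>2 \<partial>K) \<le> (\<integral>x. 2 * \<eta> + 2 * indicator U x \<partial>K)"
  proof (rule integral_mono_AE')
    show "integrable K (\<lambda>x. 2 * \<eta> + 2 * indicator U x :: real)" using U(2) fK(2) by (intro Bochner_Integration.integrable_add integrable_mult_right k.integrable_const) (auto simp: k.emeasure_eq_measure)
    show "AE x in K. (poly p x)\<^sup>2 \<le> 2 * \<eta> + 2 * indicator U x"
      using supp(2)
    proof (rule AE_mp, intro AE_I2 impI)
      fix x assume "\<bar>x\<bar> \<le> R"
      from sq2[OF pb[OF this]] have "(poly p x)\<^sup>2 \<le> 2 * \<eta> + 2 * (f x)\<^sup>2" using eta2 by linarith
      also have "(f x)\<^sup>2 \<le> indicator U x" using f(4)[of x] f01[of x] by (auto split: split_indicator simp: power_le_one)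
      finally show "(poly p x)\<^sup>2 \<le> 2 * \<eta> + 2 * indicator U x" by simp
    qed
  qed (use eta in \<open>auto intro!: AE_I2\<close>)
  also have "\<dots> = 2 * \<eta> * measure K UNIV + 2 * measure K U"
    using U(2) fK(2) sp by (subst Bochner_Integration.integral_add) (auto simp: k.emeasure_eq_measure)
  also have "\<dots> \<le> 2 * \<eta> * measure K UNIV + 2 * \<eta>" using KU by simp
  also have "\<dots> = 2 * \<eta> * (measure K UNIV + 1)" by (simp add: algebra_simps)
  also have "\<dots> \<le> 2 * \<eta> * T" using eta by (intro mult_left_mono) (auto simp: T_def)
  also have "\<dots> \<le> e"
  proof -
    have "0 \<le> 4 * T * \<eta>" using eta T by simp
    moreover have "2 * \<eta> * T = 4 * T * \<eta> / 2" by simp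
    ultimately show ?thesis using eta(3) by linarith
  qed
  finally have r1: "(\<integral>x. (poly p x)\<^sup>2 \<partial>K) \<le> e" .
  have 2: "(\<integral>x. (poly p x - 1)\<^sup>2 \<partial>\<sigma>) \<le> (\<integral>x. 2 * \<eta> + 2 * indicator (- C) x \<partial>\<sigma>)"
  proof (rule integral_mono_AE')
    show "integrable \<sigma> (\<lambda>x. 2 * \<eta> + 2 * indicator (- C) x :: real)" using Cb fs(2) by (intro Bochner_Integration.integrable_add integrable_mult_right s.integrable_const) (auto simp: s.emeasure_eq_measure)
    show "AE x in \<sigma>. (poly p x - 1)\<^sup>2 \<le> 2 * \<eta> + 2 * indicator (- C) x"
      using supp(1)
    proof (rule AE_mp, intro AE_I2 impI)
      fix x assume "\<bar>x\<bar> \<le> R"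
      then have "\<bar>(f x - 1) - (poly p x - 1)\<bar> \<le> \<eta>" using pb by simp
      from sq2[OF this] have "(poly p x - 1)\<^sup>2 \<le> 2 * \<eta> + 2 * (f x - 1)\<^sup>2" using eta2 by linarith
      also have "(f x - 1)\<^sup>2 \<le> indicator (- C) x" using f(3)[of x] f01[of x]
        by (auto split: split_indicator simp: abs_square_le_1)
      finally show "(poly p x - 1)\<^sup>2 \<le> 2 * \<eta> + 2 * indicator (- C) x" by simp
    qed
  qed (use eta in \<open>auto intro!: AE_I2\<close>)
  also have "\<dots> = 2 * \<eta> * measure \<sigma> UNIV + 2 * measure \<sigma> (- C)"
    using Cb fs(2) sp by (subst Bochner_Integration.integral_add) (auto simp: s.emeasure_eq_measure)
  also have "\<dots> \<le> 2 * \<eta> * measure \<sigma> UNIV + 2 * \<eta>" using sC by simp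
  also have "\<dots> = 2 * \<eta> * (measure \<sigma> UNIV + 1)" by (simp add: algebra_simps)
  also have "\<dots> \<le> 2 * \<eta> * T" using eta by (intro mult_left_mono) (auto simp: T_def)
  also have "\<dots> \<le> e"
  proof -
    have "0 \<le> 4 * T * \<eta>" using eta T by simp
    moreover have "2 * \<eta> * T = 4 * T * \<eta> / 2" by simp
    ultimately show ?thesis using eta(3) by linarith
  qed
  finally have r2: "(\<integral>x. (poly p x - 1)\<^sup>2 \<partial>\<sigma>) \<le> e" .
  show ?thesis by (rule that[OF r1 r2])
qed

section \<open>Moment measures of bounded symmetric operators\<close>

context symmetric_op
begin

lemma pop_add: "pop T (p + q) f = (\<lambda>x. pop T p f x + pop T q f x)"
proof -
  let ?n = "max (degree p) (degree q)"
  have "degree (p + q) \<le> ?n" by (rule degree_add_le) auto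
  then show ?thesis by (simp add: pop_sum_bound[of _ ?n] distrib_right sum.distrib)
qed

lemma pop_const: "pop T [:c:] f = (\<lambda>x. of_real c * f x)"
  by (simp add: pop_def)

text \<open>Polarization again: the mixed terms at \<open>c f + delta v\<close> vanish for
  \<open>c = 1\<close> and \<open>c = \<i>\<close>, which kills each coordinate of
  \<open>T f\<close>.\<close>

lemma zero_form_zero_op:
  assumes z: "\<And>f. f \<in> ell2 \<Longrightarrow> ell2_inner (T f) f = 0" and f: "f \<in> ell2"
  shows "T f = (\<lambda>x. 0)"
proof
  fix v
  have p: "c * ell2_inner (T f) (delta v) + cnj c * ell2_inner (T (delta v)) f = 0" for c
  proof -
    have "0 = ell2_inner (T (\<lambda>x. c * f x + delta v x)) (\<lambda>x. c * f x + delta v x)"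
      using f by (intro z[symmetric]) auto
    also have "\<dots> = c * cnj c * ell2_inner (T f) f + c * ell2_inner (T f) (delta v) + cnj c * ell2_inner (T (delta v)) f + ell2_inner (T (delta v)) (delta v)"
      unfolding T_comb[OF f delta_ell2] using f T_ell2[OF f] T_ell2[OF delta_ell2, of v]
      by (simp add: ell2_inner_add_left ell2_inner_add_right ell2_inner_scale_left ell2_inner_scale_right ell2_scale ell2_comb del: ell2_inner_delta)
        (simp add: algebra_simps)
    finally show ?thesis using z[OF f] z[OF delta_ell2, of v] by (simp del: ell2_inner_delta)
  qed
  have "ell2_inner (T f) (delta v) = 0"
    using p[of 1] p[of \<i>] by (simp add: complex_eq_iff del: ell2_inner_delta)
  then show "T f v = 0" by simp
qed

text \<open>The functional \<open>mfun f\<close> meets the hypotheses of the moment problem: on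
  \<open>p^2\<close> it is the squared norm of \<open>p(T) f\<close>, and the factors
  \<open>R - x\<close> and \<open>R + x\<close> become \<open>R - T\<close> and
  \<open>R + T\<close>, nonnegative by the form bound. This supplies measures for operators that
  come without a resolution.\<close>

lemma op_moment_measure:
  assumes R: "R > 0" and bd: "\<And>f. f \<in> ell2 \<Longrightarrow> cmod (ell2_inner (T f) f) \<le> R * (ell2_norm f)\<^sup>2"
    and f: "f \<in> ell2" "ell2_norm f = 1"
  shows "\<exists>M. real_distribution M \<and> (AE x in M. \<bar>x\<bar> \<le> R) \<and> (\<forall>p. integral\<^sup>L M (poly p) = mfun f p)"
proof (rule moment_measure_exists[OF R])
  have m: "complex_of_real (mfun f (q * p)) = ell2_inner (pop T q f) (pop T p f)" for p q
    by (rule inner_pop_pop[OF f(1), symmetric])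
  show "mfun f 1 = 1"
  proof -
    have "complex_of_real (mfun f 1) = ell2_inner f f" using inner_pop[OF f(1), of 1] by (simp add: pop_def)
    then show ?thesis using ell2_norm_square[OF f(1)] f(2) by simp
  qed
  have sq: "mfun f (p * p) = (ell2_norm (pop T p f))\<^sup>2" for p
    using m[of p p] ell2_norm_square[OF pop_ell2[OF f(1), of p]] by (metis of_real_eq_iff)
  then show "0 \<le> mfun f (p * p)" for p by simp
  have t: "mfun f ([:R, c:] * (p * p)) = R * (ell2_norm (pop T p f))\<^sup>2 + c * Re (ell2_inner (T (pop T p f)) (pop T p f))" for p c
  proof -
    have e: "[:R, c:] * (p * p) = smult R (p * p) + smult c (([:0, 1:] * p) * p)" by simp
    have "complex_of_real (mfun f (([:0, 1:] * p) * p)) = ell2_inner (T (pop T p f)) (pop T p f)"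
      unfolding m pop_T[OF f(1)] ..
    then have "mfun f (([:0, 1:] * p) * p) = Re (ell2_inner (T (pop T p f)) (pop T p f))" by (metis Re_complex_of_real)
    then show ?thesis unfolding e mfun_add mfun_smult sq by simp
  qed
  have b: "\<bar>Re (ell2_inner (T (pop T p f)) (pop T p f))\<bar> \<le> R * (ell2_norm (pop T p f))\<^sup>2" for p
    using abs_Re_le_cmod bd[OF pop_ell2[OF f(1), of p]] order_trans by blast
  show "0 \<le> mfun f ([:R, -1:] * (p * p))" "0 \<le> mfun f ([:R, 1:] * (p * p))" for p
    using t[of "-1" p] t[of 1 p] b[of p] by (auto simp: abs_le_iff)
qed (auto simp: mfun_add mfun_smult)

end

text \<open>A resolution constrains only the values \<open><A f, f>\<close>, so linearity of
  \<open>A\<close> is a separate hypothesis.\<close>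

locale resolved_op =
  fixes A :: "('v \<Rightarrow> complex) \<Rightarrow> 'v \<Rightarrow> complex" and E
  assumes res: "spectral_resolution A E"
    and A_comb: "f \<in> ell2 \<Longrightarrow> g \<in> ell2 \<Longrightarrow> A (\<lambda>x. c * f x + g x) = (\<lambda>x. c * A f x + A g x)"
begin

abbreviation \<sigma> where "\<sigma> f \<equiv> spectral_measure E f"

lemma A_ell2: "f \<in> ell2 \<Longrightarrow> A f \<in> ell2"
  and A_form: "f \<in> ell2 \<Longrightarrow> ell2_inner (A f) f = of_real (\<integral>x. x \<partial>\<sigma> f)"
  using res unfolding spectral_resolution_def by auto

sublocale A: symmetric_op A
  by unfold_locales (simp_all add: A_ell2 A_comb A_form)

lemma E_proj: "B \<in> sets borel \<Longrightarrow> orth_projection (E B)"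
  using res unfolding spectral_resolution_def by blast

lemma E_ell2 [intro]: "B \<in> sets borel \<Longrightarrow> f \<in> ell2 \<Longrightarrow> E B f \<in> ell2"
  and E_idem: "B \<in> sets borel \<Longrightarrow> f \<in> ell2 \<Longrightarrow> E B (E B f) = E B f"
  and E_comb: "B \<in> sets borel \<Longrightarrow> f \<in> ell2 \<Longrightarrow> g \<in> ell2 \<Longrightarrow> E B (\<lambda>x. c * f x + g x) = (\<lambda>x. c * E B f x + E B g x)"
  and E_sym: "B \<in> sets borel \<Longrightarrow> f \<in> ell2 \<Longrightarrow> g \<in> ell2 \<Longrightarrow> ell2_inner (E B f) g = ell2_inner f (E B g)"
proof -
  assume B: "B \<in> sets borel"
  note p = E_proj[OF B, unfolded orth_projection_def]
  show "E B f \<in> ell2" "E B (E B f) = E B f" if "f \<in> ell2"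
    using p[THEN conjunct1, rule_format, OF that] by simp_all
  show "E B (\<lambda>x. c * f x + g x) = (\<lambda>x. c * E B f x + E B g x)" if "f \<in> ell2" "g \<in> ell2"
    using p[THEN conjunct2, THEN conjunct1, rule_format, OF that] .
  show "ell2_inner (E B f) g = ell2_inner f (E B g)" if "f \<in> ell2" "g \<in> ell2"
    using p[THEN conjunct2, THEN conjunct2, rule_format, OF that] .
qed

lemma E_UNIV: "f \<in> ell2 \<Longrightarrow> E UNIV f = f"
  using res unfolding spectral_resolution_def by blast

lemma E_form: "B \<in> sets borel \<Longrightarrow> f \<in> ell2 \<Longrightarrow> ell2_inner (E B f) f = of_real ((ell2_norm (E B f))\<^sup>2)"
  using E_sym[of B "E B f" f] ell2_norm_square[OF E_ell2[of B f]] E_idem[of B f] E_ell2[of B f] by simp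

lemma E_sums:
  assumes "range B \<subseteq> sets borel" "disjoint_family B" "f \<in> ell2"
  shows "(\<lambda>n::nat. (ell2_norm (E (B n) f))\<^sup>2) sums (ell2_norm (E (\<Union>n. B n) f))\<^sup>2"
proof -
  have "(\<lambda>n. ell2_inner (E (B n) f) f) sums ell2_inner (E (\<Union>n. B n) f) f"
    using res assms unfolding spectral_resolution_def by blast
  moreover have "ell2_inner (E (B n) f) f = of_real ((ell2_norm (E (B n) f))\<^sup>2)" for n
    using assms by (intro E_form) auto
  moreover have "ell2_inner (E (\<Union>n. B n) f) f = of_real ((ell2_norm (E (\<Union>n. B n) f))\<^sup>2)"
    using assms by (intro E_form) auto
  ultimately show ?thesis by (simp only: sums_of_real_iff)
qed

text \<open>The empty set is the disjoint union of countably many copies of itself, and a convergent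
  series of equal terms is zero.\<close>

lemma norm_E_empty: "f \<in> ell2 \<Longrightarrow> (ell2_norm (E {} f))\<^sup>2 = 0"
proof -
  assume "f \<in> ell2"
  then have "(\<lambda>n::nat. (ell2_norm (E {} f))\<^sup>2) sums (ell2_norm (E {} f))\<^sup>2"
    using E_sums[of "\<lambda>_. {}" f] by (simp add: disjoint_family_on_def)
  then have "summable (\<lambda>n::nat. (ell2_norm (E {} f))\<^sup>2)" by (rule sums_summable)
  then show ?thesis by (simp add: summable_const_iff)
qed

section \<open>Spectral measures and the algebra of the projections\<close>

lemma sets_spectral [simp]: "sets (\<sigma> f) = sets borel"
  unfolding spectral_measure_def using sets.sigma_sets_eq[of borel] by (subst sets_measure_of) auto

lemma space_spectral [simp]: "space (\<sigma> f) = UNIV"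
  using sets_eq_imp_space_eq[OF sets_spectral[of f]] by simp

lemma measurable_spectral [simp]: "measurable (\<sigma> f) L = measurable borel L"
  by (rule measurable_cong_sets) simp_all

lemma emeasure_spectral:
  assumes f: "f \<in> ell2" and B: "B \<in> sets borel"
  shows "emeasure (\<sigma> f) B = ennreal ((ell2_norm (E B f))\<^sup>2)"
proof -
  have e: "ennreal (Re (ell2_inner (E C f) f)) = ennreal ((ell2_norm (E C f))\<^sup>2)" if "C \<in> sets borel" for C
    unfolding E_form[OF that f] by simp
  have sig: "sets (\<sigma> f) = sets borel" by simp
  have "emeasure (\<sigma> f) B = ennreal (Re (ell2_inner (E B f) f))"
  proof (rule emeasure_measure_of[OF spectral_measure_def])
    show "positive (sets (\<sigma> f)) (\<lambda>B. ennreal (Re (ell2_inner (E B f) f)))"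
      unfolding positive_def using norm_E_empty[OF f] e[of "{}"] by simp
    show "countably_additive (sets (\<sigma> f)) (\<lambda>B. ennreal (Re (ell2_inner (E B f) f)))"
      unfolding countably_additive_def sig
    proof (intro allI impI)
      fix D :: "nat \<Rightarrow> real set"
      assume D: "range D \<subseteq> sets borel" "disjoint_family D" "\<Union> (range D) \<in> sets borel"
      have "(\<Sum>i. ennreal (Re (ell2_inner (E (D i) f) f))) = (\<Sum>i. ennreal ((ell2_norm (E (D i) f))\<^sup>2))"
        using D(1) by (intro suminf_cong e) auto
      also have "\<dots> = ennreal ((ell2_norm (E (\<Union>i. D i) f))\<^sup>2)"
        by (rule suminf_ennreal_eq[OF _ E_sums[OF D(1,2) f]]) simp
      also have "\<dots> = ennreal (Re (ell2_inner (E (\<Union> (range D)) f) f))" using e[OF D(3)] by simp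
      finally show "(\<Sum>i. ennreal (Re (ell2_inner (E (D i) f) f))) = ennreal (Re (ell2_inner (E (\<Union> (range D)) f) f))" .
    qed
  qed (use B in auto)
  then show ?thesis using e[OF B] by simp
qed

lemma finite_spectral: "f \<in> ell2 \<Longrightarrow> finite_measure (\<sigma> f)"
  by (rule finite_measureI) (simp add: emeasure_spectral)

lemma measure_spectral: "f \<in> ell2 \<Longrightarrow> B \<in> sets borel \<Longrightarrow> measure (\<sigma> f) B = (ell2_norm (E B f))\<^sup>2"
  by (simp add: measure_def emeasure_spectral)

lemma ell2_norm_zero_iff: "f \<in> ell2 \<Longrightarrow> ell2_norm f = 0 \<longleftrightarrow> f = (\<lambda>x. 0)"
proof
  assume f: "f \<in> ell2" "ell2_norm f = 0"
  then show "f = (\<lambda>x. 0)" using ell2_norm_point[OF f(1)] by (intro ext) auto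
qed (simp add: ell2_norm_def)

text \<open>The vector \<open>E B f\<close> already has its whole mass on \<open>B\<close>, so
  nothing is left for a set disjoint from \<open>B\<close>.\<close>

lemma E_disjoint:
  assumes B: "B \<in> sets borel" and C: "C \<in> sets borel" and d: "B \<inter> C = {}" and f: "f \<in> ell2"
  shows "E C (E B f) = (\<lambda>x. 0)"
proof -
  let ?g = "E B f"
  have g: "?g \<in> ell2" using B f by auto
  interpret finite_measure "\<sigma> ?g" by (rule finite_spectral[OF g])
  have "measure (\<sigma> ?g) B + measure (\<sigma> ?g) C \<le> measure (\<sigma> ?g) UNIV"
  proof -
    have "measure (\<sigma> ?g) B + measure (\<sigma> ?g) C = measure (\<sigma> ?g) (B \<union> C)"
      by (rule finite_measure_Union[symmetric]) (use B C d in auto)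
    also have "\<dots> \<le> measure (\<sigma> ?g) UNIV" by (rule finite_measure_mono) auto
    finally show ?thesis .
  qed
  then have "(ell2_norm (E C ?g))\<^sup>2 \<le> 0"
    using B C f by (simp add: measure_spectral[OF g] E_idem E_UNIV[OF g])
  then have "ell2_norm (E C ?g) = 0" by simp
  then show ?thesis using ell2_norm_zero_iff[OF E_ell2[OF C g]] by simp
qed

lemma E_add: "B \<in> sets borel \<Longrightarrow> f \<in> ell2 \<Longrightarrow> g \<in> ell2 \<Longrightarrow> E B (\<lambda>x. f x + g x) = (\<lambda>x. E B f x + E B g x)"
  using E_comb[of B f g 1] by simp

text \<open>Additivity is known for the quadratic forms only; the difference of the two sides is a
  linear operator with zero form, hence zero.\<close>

lemma E_Un:
  assumes B: "B \<in> sets borel" and C: "C \<in> sets borel" and d: "B \<inter> C = {}" and f: "f \<in> ell2"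
  shows "E (B \<union> C) f = (\<lambda>x. E B f x + E C f x)"
proof -
  have BC: "B \<union> C \<in> sets borel" using B C by auto
  define D where "D = (\<lambda>f x. E (B \<union> C) f x + (-1) * (E B f x + E C f x))"
  have add: "ell2_inner (E (B \<union> C) f) f = ell2_inner (E B f) f + ell2_inner (E C f) f" if f: "f \<in> ell2" for f
  proof -
    interpret finite_measure "\<sigma> f" by (rule finite_spectral[OF f])
    have "measure (\<sigma> f) (B \<union> C) = measure (\<sigma> f) B + measure (\<sigma> f) C"
      by (rule finite_measure_Union) (use B C d in auto)
    then show ?thesis using B C BC f by (simp add: measure_spectral E_form del: of_real_power flip: of_real_add)
  qed
  have De: "D f \<in> ell2" if "f \<in> ell2" for f unfolding D_def using that B C BC by (intro ell2_add ell2_scale E_ell2)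
  have Df: "ell2_inner (D f) f = 0" if f: "f \<in> ell2" for f
  proof -
    have "ell2_inner (D f) f = ell2_inner (E (B \<union> C) f) f + (-1) * (ell2_inner (E B f) f + ell2_inner (E C f) f)"
      unfolding D_def ell2_inner_add_left[OF E_ell2[OF BC f] ell2_scale[OF ell2_add[OF E_ell2[OF B f] E_ell2[OF C f]]] f]
        ell2_inner_scale_left ell2_inner_add_left[OF E_ell2[OF B f] E_ell2[OF C f] f] ..
    then show ?thesis using add[OF f] by simp
  qed
  interpret D: symmetric_op D
  proof
    show "D (\<lambda>x. c * f x + g x) = (\<lambda>x. c * D f x + D g x)" if "f \<in> ell2" "g \<in> ell2" for f g c
      unfolding D_def E_comb[OF B that] E_comb[OF C that] E_comb[OF BC that] by (simp add: algebra_simps)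
  qed (simp_all add: De Df)
  have "D f = (\<lambda>x. 0)" by (rule D.zero_form_zero_op[OF Df f])
  then have "D f x = 0" for x by simp
  then show ?thesis by (intro ext) (simp add: D_def algebra_simps add_eq_0_iff)
qed

text \<open>Split \<open>C\<close> along \<open>B\<close> for the left side and \<open>f\<close>
  along \<open>B\<close> for the right side; the pieces over disjoint sets annihilate each
  other.\<close>

lemma E_mult:
  assumes B: "B \<in> sets borel" and C: "C \<in> sets borel" and f: "f \<in> ell2"
  shows "E C (E B f) = E (C \<inter> B) f"
proof -
  have 1: "E C (E B f) = E (C \<inter> B) (E B f)"
  proof -
    have s: "C \<inter> B \<in> sets borel" "C - B \<in> sets borel" using B C by auto
    have "E (C \<inter> B \<union> (C - B)) (E B f) = (\<lambda>x. E (C \<inter> B) (E B f) x + E (C - B) (E B f) x)"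
      using B f by (intro E_Un s) auto
    moreover have "E (C - B) (E B f) = (\<lambda>x. 0)" by (rule E_disjoint[OF B s(2) _ f]) auto
    moreover have "C \<inter> B \<union> (C - B) = C" by auto
    ultimately show ?thesis by simp
  qed
  have 2: "E (C \<inter> B) f = E (C \<inter> B) (E B f)"
  proof -
    have s: "C \<inter> B \<in> sets borel" "- B \<in> sets borel" using B C by auto
    have "E (B \<union> - B) f = (\<lambda>x. E B f x + E (- B) f x)" by (rule E_Un[OF B s(2) _ f]) auto
    then have "f = (\<lambda>x. E B f x + E (- B) f x)" using E_UNIV[OF f] by simp
    then have "E (C \<inter> B) f = E (C \<inter> B) (\<lambda>x. E B f x + E (- B) f x)" by simp
    also have "\<dots> = (\<lambda>x. E (C \<inter> B) (E B f) x + E (C \<inter> B) (E (- B) f) x)"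
      using B s f by (intro E_add) auto
    also have "E (C \<inter> B) (E (- B) f) = (\<lambda>x. 0)" by (rule E_disjoint[OF s(2) s(1) _ f]) auto
    finally show ?thesis by simp
  qed
  show ?thesis using 1 2 by simp
qed

lemma spectral_eqI:
  assumes "f \<in> ell2" "g \<in> ell2" "\<And>C. C \<in> sets borel \<Longrightarrow> ell2_norm (E C f) = ell2_norm (E C g)"
  shows "\<sigma> f = \<sigma> g"
  by (rule measure_eqI) (simp_all add: emeasure_spectral assms)

lemma norm_add_square: "f \<in> ell2 \<Longrightarrow> g \<in> ell2 \<Longrightarrow>
    (ell2_norm (\<lambda>x. f x + g x))\<^sup>2 = (ell2_norm f)\<^sup>2 + (ell2_norm g)\<^sup>2 + 2 * Re (ell2_inner f g)"
proof -
  assume f: "f \<in> ell2" and g: "g \<in> ell2"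
  have "complex_of_real ((ell2_norm (\<lambda>x. f x + g x))\<^sup>2) = ell2_inner (\<lambda>x. f x + g x) (\<lambda>x. f x + g x)"
    by (rule ell2_norm_square[symmetric, OF ell2_add[OF f g]])
  also have "\<dots> = ell2_inner f f + ell2_inner g g + (ell2_inner f g + cnj (ell2_inner f g))"
    using f g ell2_inner_cnj[of g f] by (simp add: ell2_inner_add_left ell2_inner_add_right ell2_add)
  also have "\<dots> = of_real ((ell2_norm f)\<^sup>2 + (ell2_norm g)\<^sup>2 + 2 * Re (ell2_inner f g))"
    using ell2_norm_square[OF f] ell2_norm_square[OF g] by (simp add: complex_add_cnj)
  finally show ?thesis by (simp only: of_real_eq_iff)
qed

lemma norm_scale: "f \<in> ell2 \<Longrightarrow> ell2_norm (\<lambda>x. c * f x) = cmod c * ell2_norm f"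
proof -
  assume f: "f \<in> ell2"
  have "complex_of_real ((ell2_norm (\<lambda>x. c * f x))\<^sup>2) = c * (cnj c * ell2_inner f f)"
    using ell2_norm_square[OF ell2_scale[OF f, of c]] by (simp add: ell2_inner_scale_left ell2_inner_scale_right)
  also have "\<dots> = of_real ((cmod c * ell2_norm f)\<^sup>2)"
    using ell2_norm_square[OF f] complex_norm_square[of c] by (simp add: power_mult_distrib mult_ac)
  finally have "(ell2_norm (\<lambda>x. c * f x))\<^sup>2 = (cmod c * ell2_norm f)\<^sup>2" by (simp only: of_real_eq_iff)
  then show ?thesis by (rule power2_eq_imp_eq) auto
qed

text \<open>Let \<open>g = E B f\<close> and \<open>h = E (- B) (A g)\<close>. All
  \<open>E C g\<close> and \<open>E C h\<close> are orthogonal, so \<open>c g + h\<close> has the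
  same spectral measure for every unimodular \<open>c\<close>, and therefore the same value of the
  form of \<open>A\<close>. This forces the mixed term \<open><A g, h>\<close> to vanish, but it
  equals the squared norm of \<open>h\<close>.\<close>

lemma E_invariant:
  assumes B: "B \<in> sets borel" and f: "f \<in> ell2"
  shows "E (- B) (A (E B f)) = (\<lambda>x. 0)"
proof -
  have B': "- B \<in> sets borel" using B by auto
  define g where "g = E B f"
  define h where "h = E (- B) (A g)"
  have g: "g \<in> ell2" unfolding g_def using B f by auto
  have h: "h \<in> ell2" unfolding h_def using B' g by (intro E_ell2 A_ell2)
  have orth: "ell2_inner (E C g) (E C h) = 0" if C: "C \<in> sets borel" for C
  proof -
    have "ell2_inner (E C g) (E C h) = ell2_inner (E C g) h"
      using E_sym[OF C E_ell2[OF C g] h] E_idem[OF C g] by simp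
    also have "\<dots> = ell2_inner (E (- B) (E C g)) (A g)"
      unfolding h_def using E_sym[OF B' E_ell2[OF C g] A_ell2[OF g]] by simp
    also have "E (- B) (E C g) = E (- B \<inter> C) (E B f)" using E_mult[OF C B' g] by (simp add: g_def)
    also have "\<dots> = (\<lambda>x. 0)" using B B' C by (intro E_disjoint[OF B _ _ f]) auto
    finally show ?thesis by (simp add: ell2_inner_def)
  qed
  have same: "\<sigma> (\<lambda>x. c * g x + h x) = \<sigma> (\<lambda>x. g x + h x)" if c: "cmod c = 1" for c
  proof (rule spectral_eqI)
    fix C :: "real set" assume C: "C \<in> sets borel"
    have "(ell2_norm (E C (\<lambda>x. c * g x + h x)))\<^sup>2 = (ell2_norm (E C g))\<^sup>2 + (ell2_norm (E C h))\<^sup>2" if "cmod c = 1" for c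
      unfolding E_comb[OF C g h] using norm_add_square[OF ell2_scale[OF E_ell2[OF C g]] E_ell2[OF C h], of c]
        norm_scale[OF E_ell2[OF C g], of c] orth[OF C] that by (simp add: ell2_inner_scale_left)
    from this[OF c] this[of 1] have "(ell2_norm (E C (\<lambda>x. c * g x + h x)))\<^sup>2 = (ell2_norm (E C (\<lambda>x. g x + h x)))\<^sup>2" by simp
    then show "ell2_norm (E C (\<lambda>x. c * g x + h x)) = ell2_norm (E C (\<lambda>x. g x + h x))"
      by (rule power2_eq_imp_eq) auto
  qed (use g h in auto)
  have "ell2_inner (A (\<lambda>x. c * g x + h x)) (\<lambda>x. c * g x + h x) = ell2_inner (A (\<lambda>x. g x + h x)) (\<lambda>x. g x + h x)" if "cmod c = 1" for c
    using A_form[of "\<lambda>x. c * g x + h x"] A_form[of "\<lambda>x. g x + h x"] same[OF that] g h by (simp add: ell2_comb ell2_add)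
  moreover have "ell2_inner (A (\<lambda>x. c * g x + h x)) (\<lambda>x. c * g x + h x) =
     c * cnj c * ell2_inner (A g) g + c * ell2_inner (A g) h + cnj c * ell2_inner (A h) g + ell2_inner (A h) h" for c
    unfolding A_comb[OF g h] using g h A_ell2[OF g] A_ell2[OF h]
    by (simp add: ell2_inner_add_left ell2_inner_add_right ell2_inner_scale_left ell2_inner_scale_right ell2_scale ell2_comb)
      (simp add: algebra_simps)
  ultimately have q: "c * cnj c * ell2_inner (A g) g + c * ell2_inner (A g) h + cnj c * ell2_inner (A h) g + ell2_inner (A h) h = ell2_inner (A (\<lambda>x. g x + h x)) (\<lambda>x. g x + h x)"
    if "cmod c = 1" for c using that by metis
  have "ell2_inner (A g) h = 0"
    using q[of 1] q[of "-1"] q[of \<i>] q[of "-\<i>"] by (simp add: complex_eq_iff)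
  moreover have "E (- B) h = h" unfolding h_def by (rule E_idem[OF B' A_ell2[OF g]])
  then have "ell2_inner h h = ell2_inner (A g) h"
    using E_sym[OF B' A_ell2[OF g] h] unfolding h_def[symmetric] by simp
  ultimately have "ell2_norm h = 0" using ell2_norm_square[OF h] by simp
  then show ?thesis using ell2_norm_zero_iff[OF h] by (simp add: h_def g_def)
qed

lemma E_split:
  assumes B: "B \<in> sets borel" and f: "f \<in> ell2"
  shows "(\<lambda>x. E B f x + E (- B) f x) = f"
proof -
  have "E (B \<union> - B) f = (\<lambda>x. E B f x + E (- B) f x)" by (rule E_Un[OF B _ _ f]) (use B in auto)
  then show ?thesis using E_UNIV[OF f] by simp
qed

text \<open>The parts of \<open>f\<close> over \<open>B\<close> and over its complement are both
  invariant under \<open>A\<close>.\<close>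

lemma E_commute:
  assumes B: "B \<in> sets borel" and f: "f \<in> ell2"
  shows "E B (A f) = A (E B f)"
proof -
  have B': "- B \<in> sets borel" using B by auto
  have 1: "E B (A (E B f)) = A (E B f)"
    using E_split[OF B A_ell2[OF E_ell2[OF B f]]] unfolding E_invariant[OF B f] by simp
  have 2: "E B (A (E (- B) f)) = (\<lambda>x. 0)" using E_invariant[OF B' f] by simp
  have "A f = A (\<lambda>x. E B f x + E (- B) f x)" using E_split[OF B f] by simp
  also have "\<dots> = (\<lambda>x. A (E B f) x + A (E (- B) f) x)" by (rule A.T_add) (use B B' f in auto)
  finally have "E B (A f) = (\<lambda>x. E B (A (E B f)) x + E B (A (E (- B) f)) x)"
    using E_add[OF B A_ell2[OF E_ell2[OF B f]] A_ell2[OF E_ell2[OF B' f]]] by simp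
  then show ?thesis unfolding 1 2 by simp
qed

lemma support_bounded: "\<exists>R>0. \<forall>f\<in>ell2. AE x in \<sigma> f. \<bar>x\<bar> \<le> R"
proof -
  obtain R where R: "\<And>f. f \<in> ell2 \<Longrightarrow> E {-R..R} f = f"
    using res unfolding spectral_resolution_def by blast
  have "AE x in \<sigma> f. \<bar>x\<bar> \<le> max R 1" if f: "f \<in> ell2" for f
  proof -
    interpret finite_measure "\<sigma> f" by (rule finite_spectral[OF f])
    have "measure (\<sigma> f) (UNIV - {-R..R}) = measure (\<sigma> f) UNIV - measure (\<sigma> f) {-R..R}"
      by (rule finite_measure_Diff) auto
    also have "\<dots> = 0" by (simp add: measure_spectral f R E_UNIV)
    finally have "UNIV - {-R..R} \<in> null_sets (\<sigma> f)" by (simp add: null_sets_def emeasure_eq_measure)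
    then have "AE x in \<sigma> f. x \<notin> UNIV - {-R..R}" by (rule AE_not_in)
    then show ?thesis by (rule AE_mp) (auto intro!: AE_I2)
  qed
  then show ?thesis by (intro exI[of _ "max R 1"]) auto
qed

section \<open>Moments of the spectral measures\<close>

definition rad :: real where "rad = (SOME R. R > 0 \<and> (\<forall>f\<in>ell2. AE x in \<sigma> f. \<bar>x\<bar> \<le> R))"

lemma rad_pos: "rad > 0" and rad_supp: "f \<in> ell2 \<Longrightarrow> AE x in \<sigma> f. \<bar>x\<bar> \<le> rad"
proof -
  have "rad > 0 \<and> (\<forall>f\<in>ell2. AE x in \<sigma> f. \<bar>x\<bar> \<le> rad)"
    unfolding rad_def by (rule someI_ex) (use support_bounded in blast)
  then show "rad > 0" "f \<in> ell2 \<Longrightarrow> AE x in \<sigma> f. \<bar>x\<bar> \<le> rad" by auto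
qed

lemma spectral_integrable:
  fixes \<phi> :: "real \<Rightarrow> real"
  assumes f: "f \<in> ell2" and c: "continuous_on UNIV \<phi>"
  shows "integrable (\<sigma> f) \<phi>"
proof -
  have "bounded (\<phi> ` {-rad..rad})"
    by (intro compact_imp_bounded compact_continuous_image continuous_on_subset[OF c]) auto
  then obtain B where B: "\<And>x. x \<in> {-rad..rad} \<Longrightarrow> norm (\<phi> x) \<le> B" unfolding bounded_iff by blast
  show ?thesis
  proof (rule finite_measure.integrable_const_bound[OF finite_spectral[OF f], where B=B])
    show "AE x in \<sigma> f. norm (\<phi> x) \<le> B"
      using rad_supp[OF f] by (rule AE_mp) (auto intro!: AE_I2 B[unfolded real_norm_def] simp: abs_le_iff[of _ rad])
    show "\<phi> \<in> borel_measurable (\<sigma> f)" using borel_measurable_continuous_onI[OF c] by simp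
  qed
qed

lemma spectral_integral_one: "f \<in> ell2 \<Longrightarrow> (\<integral>x. c \<partial>\<sigma> f) = c * (ell2_norm f)\<^sup>2"
  by (simp add: measure_spectral E_UNIV)

lemma form_bound:
  assumes f: "f \<in> ell2" shows "cmod (ell2_inner (A f) f) \<le> rad * (ell2_norm f)\<^sup>2"
proof -
  have i: "integrable (\<sigma> f) (\<lambda>x. x)" by (intro spectral_integrable f continuous_intros)
  have "\<bar>\<integral>x. x \<partial>\<sigma> f\<bar> \<le> (\<integral>x. \<bar>x\<bar> \<partial>\<sigma> f)" by (rule integral_abs_bound)
  also have "\<dots> \<le> (\<integral>x. rad \<partial>\<sigma> f)"
    using rad_supp[OF f] i finite_measure.integrable_const[OF finite_spectral[OF f]] by (intro integral_mono_AE) auto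
  finally show ?thesis by (simp add: A_form[OF f] measure_spectral[OF f] E_UNIV[OF f] mult.commute)
qed

lemma spectral_restrict:
  assumes f: "f \<in> ell2" and C: "C \<in> sets borel"
  shows "\<sigma> (E C f) = density (\<sigma> f) (indicator C)"
proof (rule measure_eqI)
  fix D assume "D \<in> sets (\<sigma> (E C f))"
  then have D: "D \<in> sets borel" by simp
  have "emeasure (\<sigma> (E C f)) D = emeasure (\<sigma> f) (D \<inter> C)"
    using C D f by (simp add: emeasure_spectral E_ell2 E_mult)
  also have "\<dots> = emeasure (density (\<sigma> f) (indicator C)) D"
    using C D by (subst emeasure_density) (auto simp: Int_commute indicator_inter_arith[symmetric] ac_simps)
  finally show "emeasure (\<sigma> (E C f)) D = emeasure (density (\<sigma> f) (indicator C)) D" .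
qed simp

lemma integral_restrict:
  fixes \<phi> :: "real \<Rightarrow> real"
  assumes f: "f \<in> ell2" and C: "C \<in> sets borel" and c: "\<phi> \<in> borel_measurable borel"
  shows "integral\<^sup>L (\<sigma> (E C f)) \<phi> = (\<integral>x. indicator C x * \<phi> x \<partial>\<sigma> f)"
proof -
  have "density (\<sigma> f) (indicator C) = density (\<sigma> f) (\<lambda>x. ennreal (indicator C x))"
    by (rule arg_cong[of _ _ "density (\<sigma> f)"]) (auto simp: ennreal_indicator)
  then show ?thesis
    unfolding spectral_restrict[OF f C] using C c by (simp add: integral_density)
qed

text \<open>Only the first moment is given, so it is applied to \<open>f + h\<close> with
  \<open>h = (A + rad) f\<close>. Setwise, the spectral measure of \<open>f + h\<close> is that of
  \<open>f\<close> plus that of \<open>h\<close> plus \<open>2 (x + rad)\<close> times that of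
  \<open>f\<close>. Integrating \<open>x + rad\<close> and comparing with the algebraic expansion,
  whose mixed term is twice the squared norm of \<open>h\<close>, isolates the second moment. The
  shift by \<open>rad\<close> makes the mixed term a positive measure.\<close>

lemma second_moment:
  assumes f: "f \<in> ell2" shows "(ell2_norm (A f))\<^sup>2 = (\<integral>x. x\<^sup>2 \<partial>\<sigma> f)"
proof -
  let ?R = "rad"
  define T where "T = (\<lambda>g x. A g x + of_real ?R * g x)"
  define q where "q = (\<lambda>g. \<integral>x. (x + ?R) \<partial>\<sigma> g)"
  have Te: "T g \<in> ell2" if "g \<in> ell2" for g unfolding T_def using that by (intro ell2_add ell2_scale A_ell2)
  have q: "q g = Re (ell2_inner (A g) g) + ?R * (ell2_norm g)\<^sup>2" if g: "g \<in> ell2" for g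
  proof -
    have i: "integrable (\<sigma> g) (\<lambda>x. x)" "integrable (\<sigma> g) (\<lambda>x. ?R)"
      by (intro spectral_integrable g continuous_intros, rule finite_measure.integrable_const[OF finite_spectral[OF g]])
    show ?thesis unfolding q_def using spectral_integral_one[OF g, of ?R]
      by (simp add: Bochner_Integration.integral_add[OF i] A_form[OF g])
  qed
  have Tg: "Re (ell2_inner g (T g)) = q g" if g: "g \<in> ell2" for g
  proof -
    have "ell2_inner g (T g) = ell2_inner g (A g) + of_real ?R * ell2_inner g g"
      unfolding T_def using g by (simp add: ell2_inner_add_right ell2_inner_scale_right ell2_scale A_ell2)
    also have "ell2_inner g (A g) = ell2_inner (A g) g" using A.T_sym[OF g g] by simp
    finally show ?thesis by (simp add: q[OF g] ell2_norm_square[OF g])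
  qed
  define h where "h = T f"
  have h: "h \<in> ell2" unfolding h_def by (rule Te[OF f])
  have fh: "(\<lambda>x. f x + h x) \<in> ell2" using f h by auto
  have nn: "AE x in \<sigma> g. 0 \<le> x + ?R" if "g \<in> ell2" for g
    using rad_supp[OF that] by (rule AE_mp) (auto intro!: AE_I2)
  have ni: "(\<integral>\<^sup>+x. ennreal (x + ?R) \<partial>\<sigma> g) = ennreal (q g)" "0 \<le> q g" if g: "g \<in> ell2" for g
  proof -
    show "(\<integral>\<^sup>+x. ennreal (x + ?R) \<partial>\<sigma> g) = ennreal (q g)"
      unfolding q_def by (rule nn_integral_eq_integral[OF _ nn[OF g]]) (intro spectral_integrable g continuous_intros)
    show "0 \<le> q g" unfolding q_def by (rule integral_nonneg_AE[OF nn[OF g]])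
  qed
  define M3 where "M3 = density (\<sigma> f) (\<lambda>x. ennreal (2 * (x + ?R)))"
  have "(\<integral>\<^sup>+x. ennreal (x + ?R) \<partial>\<sigma> (\<lambda>x. f x + h x)) =
     (\<integral>\<^sup>+x. ennreal (x + ?R) \<partial>\<sigma> f) + (\<integral>\<^sup>+x. ennreal (x + ?R) \<partial>\<sigma> h) + (\<integral>\<^sup>+x. ennreal (x + ?R) \<partial>M3)"
  proof (rule nn_integral_measure_add3)
    fix C assume "C \<in> sets (\<sigma> (\<lambda>x. f x + h x))"
    then have C: "C \<in> sets borel" by simp
    let ?g = "E C f"
    have g: "?g \<in> ell2" using C f by auto
    have "E C h = (\<lambda>x. of_real ?R * E C f x + E C (A f) x)"
      unfolding h_def T_def using E_comb[OF C f A_ell2[OF f], of "of_real ?R"] by (simp add: add.commute)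
    then have "E C h = T ?g" unfolding T_def E_commute[OF C f] by (simp add: add.commute)
    then have "(ell2_norm (E C (\<lambda>x. f x + h x)))\<^sup>2 = (ell2_norm ?g)\<^sup>2 + (ell2_norm (E C h))\<^sup>2 + 2 * q ?g"
      using norm_add_square[OF g E_ell2[OF C h]] Tg[OF g] E_add[OF C f h] by simp
    moreover have "emeasure M3 C = ennreal (2 * q ?g)"
    proof -
      have "emeasure M3 C = (\<integral>\<^sup>+x. ennreal (2 * (x + ?R)) * indicator C x \<partial>\<sigma> f)"
        unfolding M3_def using C by (subst emeasure_density) auto
      also have "\<dots> = (\<integral>\<^sup>+x. ennreal (2 * (indicator C x * (x + ?R))) \<partial>\<sigma> f)"
        by (rule nn_integral_cong) (auto split: split_indicator)
      also have "\<dots> = ennreal (\<integral>x. 2 * (indicator C x * (x + ?R)) \<partial>\<sigma> f)"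
      proof (rule nn_integral_eq_integral)
        have "integrable (\<sigma> f) (\<lambda>x. x + ?R)" by (intro spectral_integrable f continuous_intros)
        then have "integrable (\<sigma> f) (\<lambda>x. indicator C x *\<^sub>R (x + ?R))" using C by (intro integrable_mult_indicator) auto
        then show "integrable (\<sigma> f) (\<lambda>x. 2 * (indicator C x * (x + ?R)))" by simp
        show "AE x in \<sigma> f. 0 \<le> 2 * (indicator C x * (x + ?R))"
          using nn[OF f] by (rule AE_mp) (auto intro!: AE_I2 split: split_indicator)
      qed
      also have "(\<integral>x. 2 * (indicator C x * (x + ?R)) \<partial>\<sigma> f) = 2 * q ?g"
        unfolding q_def using integral_restrict[OF f C, of "\<lambda>x. x + ?R"] by simp
      finally show ?thesis .
    qed
    ultimately show "emeasure (\<sigma> (\<lambda>x. f x + h x)) C = emeasure (\<sigma> f) C + emeasure (\<sigma> h) C + emeasure M3 C"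
      using ni(2)[OF g] by (simp add: emeasure_spectral fh C f h flip: ennreal_plus)
  qed (simp_all add: M3_def)
  moreover have "(\<integral>\<^sup>+x. ennreal (x + ?R) \<partial>M3) = ennreal (\<integral>x. 2 * (x + ?R)\<^sup>2 \<partial>\<sigma> f)"
  proof -
    have "(\<integral>\<^sup>+x. ennreal (x + ?R) \<partial>M3) = (\<integral>\<^sup>+x. ennreal (2 * (x + ?R)) * ennreal (x + ?R) \<partial>\<sigma> f)"
      unfolding M3_def by (subst nn_integral_density) auto
    also have "\<dots> = (\<integral>\<^sup>+x. ennreal (2 * (x + ?R)\<^sup>2) \<partial>\<sigma> f)"
    proof (rule nn_integral_cong_AE)
      show "AE x in \<sigma> f. ennreal (2 * (x + ?R)) * ennreal (x + ?R) = ennreal (2 * (x + ?R)\<^sup>2)"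
        using nn[OF f] by (rule AE_mp) (auto intro!: AE_I2 simp: power2_eq_square mult.assoc simp flip: ennreal_mult)
    qed
    also have "\<dots> = ennreal (\<integral>x. 2 * (x + ?R)\<^sup>2 \<partial>\<sigma> f)"
      by (rule nn_integral_eq_integral) (auto intro!: spectral_integrable f continuous_intros)
    finally show ?thesis .
  qed
  ultimately have "ennreal (q (\<lambda>x. f x + h x)) = ennreal (q f + q h + (\<integral>x. 2 * (x + ?R)\<^sup>2 \<partial>\<sigma> f))"
    using ni(2)[OF f] ni(2)[OF h] by (simp add: ni(1) fh f h ennreal_plus)
  then have main: "q (\<lambda>x. f x + h x) = q f + q h + (\<integral>x. 2 * (x + ?R)\<^sup>2 \<partial>\<sigma> f)"
    using ni(2)[OF f] ni(2)[OF h] ni(2)[OF fh] by (subst (asm) ennreal_inj) auto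
  have "q (\<lambda>x. f x + h x) = q f + q h + 2 * (ell2_norm h)\<^sup>2"
  proof -
    have "ell2_inner (A (\<lambda>x. f x + h x)) (\<lambda>x. f x + h x) = ell2_inner (A f) f + ell2_inner (A h) h + (ell2_inner (A f) h + ell2_inner (A h) f)"
      unfolding A.T_add[OF f h] using f h A_ell2[OF f] A_ell2[OF h]
      by (simp add: ell2_inner_add_left ell2_inner_add_right ell2_add)
    moreover have "ell2_inner (A h) f = cnj (ell2_inner (A f) h)"
      using A.T_sym[OF h f] ell2_inner_cnj[of h "A f"] by simp
    ultimately have "Re (ell2_inner (A (\<lambda>x. f x + h x)) (\<lambda>x. f x + h x)) = Re (ell2_inner (A f) f) + Re (ell2_inner (A h) h) + 2 * Re (ell2_inner (A f) h)"
      by simp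
    moreover have "ell2_inner h h = ell2_inner (A f) h + of_real ?R * ell2_inner f h"
      using h f A_ell2[OF f] by (subst (1) h_def) (simp add: T_def ell2_inner_add_left ell2_inner_scale_left ell2_scale)
    then have "Re (ell2_inner h h) = Re (ell2_inner (A f) h) + ?R * Re (ell2_inner f h)" by simp
    then have "(ell2_norm h)\<^sup>2 = Re (ell2_inner (A f) h) + ?R * Re (ell2_inner f h)"
      unfolding ell2_norm_square[OF h] by simp
    ultimately show ?thesis
      unfolding q[OF fh] q[OF f] q[OF h] norm_add_square[OF f h] by (simp add: algebra_simps)
  qed
  with main have hn: "(ell2_norm h)\<^sup>2 = (\<integral>x. (x + ?R)\<^sup>2 \<partial>\<sigma> f)" by simp
  have "(ell2_norm h)\<^sup>2 = (ell2_norm (A f))\<^sup>2 + (?R * ell2_norm f)\<^sup>2 + 2 * (?R * Re (ell2_inner (A f) f))"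
    unfolding h_def T_def norm_add_square[OF A_ell2[OF f] ell2_scale[OF f]] norm_scale[OF f]
    using rad_pos by (simp add: ell2_inner_scale_right)
  moreover have "(\<integral>x. (x + ?R)\<^sup>2 \<partial>\<sigma> f) = (\<integral>x. x\<^sup>2 \<partial>\<sigma> f) + (?R * ell2_norm f)\<^sup>2 + 2 * (?R * Re (ell2_inner (A f) f))"
  proof -
    have i: "integrable (\<sigma> f) (\<lambda>x. x\<^sup>2)" "integrable (\<sigma> f) (\<lambda>x. 2 * ?R * x)" "integrable (\<sigma> f) (\<lambda>x. ?R\<^sup>2)"
      by (intro spectral_integrable f continuous_intros)+
    have "(\<integral>x. (x + ?R)\<^sup>2 \<partial>\<sigma> f) = (\<integral>x. x\<^sup>2 + 2 * ?R * x + ?R\<^sup>2 \<partial>\<sigma> f)"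
      by (rule Bochner_Integration.integral_cong) (auto simp: power2_eq_square algebra_simps)
    also have "\<dots> = (\<integral>x. x\<^sup>2 \<partial>\<sigma> f) + (\<integral>x. 2 * ?R * x \<partial>\<sigma> f) + (\<integral>x. ?R\<^sup>2 \<partial>\<sigma> f)"
      using i by (simp only: Bochner_Integration.integral_add Bochner_Integration.integrable_add)
    finally show ?thesis using spectral_integral_one[OF f, of "?R\<^sup>2"] by (simp add: A_form[OF f] power_mult_distrib)
  qed
  ultimately show ?thesis using hn by simp
qed

text \<open>The second moment is applied to \<open>E C f\<close>, on which \<open>A\<close> acts as
  \<open>E C\<close> after \<open>A\<close>.\<close>

lemma spectral_A:
  assumes f: "f \<in> ell2" shows "\<sigma> (A f) = density (\<sigma> f) (\<lambda>x. ennreal (x\<^sup>2))"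
proof (rule measure_eqI)
  fix C assume "C \<in> sets (\<sigma> (A f))"
  then have C: "C \<in> sets borel" by simp
  have "emeasure (\<sigma> (A f)) C = ennreal (\<integral>x. indicator C x * x\<^sup>2 \<partial>\<sigma> f)"
    using second_moment[OF E_ell2[OF C f]] by (simp add: emeasure_spectral[OF A_ell2[OF f] C] E_commute[OF C f] integral_restrict[OF f C])
  also have "\<dots> = (\<integral>\<^sup>+x. ennreal (indicator C x * x\<^sup>2) \<partial>\<sigma> f)"
  proof (rule nn_integral_eq_integral[symmetric])
    have "integrable (\<sigma> f) (\<lambda>x. x\<^sup>2)" by (intro spectral_integrable f continuous_intros)
    then have "integrable (\<sigma> f) (\<lambda>x. indicator C x *\<^sub>R x\<^sup>2)" using C by (intro integrable_mult_indicator) auto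
    then show "integrable (\<sigma> f) (\<lambda>x. indicator C x * x\<^sup>2)" by simp
  qed (auto intro!: AE_I2)
  also have "\<dots> = emeasure (density (\<sigma> f) (\<lambda>x. ennreal (x\<^sup>2))) C"
    using C by (subst emeasure_density) (auto intro!: nn_integral_cong split: split_indicator)
  finally show "emeasure (\<sigma> (A f)) C = emeasure (density (\<sigma> f) (\<lambda>x. ennreal (x\<^sup>2))) C" .
qed simp

text \<open>Two powers at a time: one factor \<open>A\<close> goes to each side of the inner
  product, and the measure of \<open>A f\<close> absorbs the pair as \<open>x^2\<close>.\<close>

lemma spectral_moment: "f \<in> ell2 \<Longrightarrow> ell2_inner ((A ^^ k) f) f = of_real (\<integral>x. x ^ k \<partial>\<sigma> f)"
proof (induction k arbitrary: f rule: less_induct)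
  case (less k)
  consider "k = 0" | "k = 1" | j where "k = Suc (Suc j)" by (metis One_nat_def not0_implies_Suc)
  then show ?case
  proof cases
    case 1
    then show ?thesis using less.prems by (simp add: ell2_norm_square measure_spectral E_UNIV)
  next
    case 2
    then show ?thesis using less.prems by (simp add: A_form One_nat_def)
  next
    case 3
    have "(A ^^ k) f = A ((A ^^ j) (A f))" by (simp add: 3 funpow_swap1)
    then have "ell2_inner ((A ^^ k) f) f = ell2_inner ((A ^^ j) (A f)) (A f)"
      using A.T_sym[OF A.pow_ell2[OF A_ell2[OF less.prems]] less.prems] by simp
    also have "\<dots> = of_real (\<integral>x. x ^ j \<partial>\<sigma> (A f))" using 3 less.prems by (intro less.IH A_ell2) auto
    also have "(\<integral>x. x ^ j \<partial>\<sigma> (A f)) = (\<integral>x. x\<^sup>2 * x ^ j \<partial>\<sigma> f)"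
      unfolding spectral_A[OF less.prems] by (subst integral_density) auto
    also have "(\<lambda>x::real. x\<^sup>2 * x ^ j) = (\<lambda>x. x ^ k)" by (auto simp: 3 power2_eq_square)
    finally show ?thesis .
  qed
qed

lemma mfun_spectral:
  assumes f: "f \<in> ell2" shows "A.mfun f p = integral\<^sup>L (\<sigma> f) (poly p)"
proof -
  have "A.moment f i = (\<integral>x. x ^ i \<partial>\<sigma> f)" for i by (simp add: A.moment_def spectral_moment[OF f])
  moreover have "integrable (\<sigma> f) (\<lambda>x. coeff p i * x ^ i)" for i by (intro spectral_integrable f continuous_intros)
  ultimately show ?thesis
    by (simp add: A.mfun_def poly_altdef[abs_def] Bochner_Integration.integral_sum)
qed

text \<open>The spectral measure of \<open>\<psi>\<close> lives on \<open>N\<close>, where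
  \<open>K\<close> has no mass, so one polynomial can be near 1 for the former and near 0 for the
  latter; the distance from \<open>p(A) \<psi>\<close> to \<open>\<psi>\<close> is the
  \<open>L^2\<close> distance of \<open>p\<close> from 1.\<close>

lemma E_range_approximation:
  assumes N: "N \<in> sets borel" and \<psi>: "\<psi> \<in> ell2" "E N \<psi> = \<psi>"
    and K: "real_distribution K" "AE x in K. \<bar>x\<bar> \<le> S" "emeasure K N = 0" and e: "e > 0"
  obtains p where "(\<integral>x. (poly p x)\<^sup>2 \<partial>K) \<le> e" "(ell2_norm (\<lambda>x. pop A p \<psi> x - \<psi> x))\<^sup>2 \<le> e"
proof -
  interpret K: real_distribution K by (rule K(1))
  have "emeasure (\<sigma> \<psi>) (- N) = ennreal ((ell2_norm (E (- N) (E N \<psi>)))\<^sup>2)"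
    using N \<psi> by (subst emeasure_spectral) auto
  also have "E (- N) (E N \<psi>) = (\<lambda>x. 0)" using N \<psi> by (intro E_disjoint) auto
  finally have z: "emeasure (\<sigma> \<psi>) (- N) = 0" by (simp add: ell2_norm_def)
  have "AE x in \<sigma> \<psi>. \<bar>x\<bar> \<le> max rad S" using rad_supp[OF \<psi>(1)] by (rule AE_mp) (auto intro!: AE_I2)
  moreover have "AE x in K. \<bar>x\<bar> \<le> max rad S" using K(2) by (rule AE_mp) (auto intro!: AE_I2)
  ultimately obtain p where p: "(\<integral>x. (poly p x)\<^sup>2 \<partial>K) \<le> e" "(\<integral>x. (poly p x - 1)\<^sup>2 \<partial>\<sigma> \<psi>) \<le> e"
    using polynomial_separates_null_set[OF finite_spectral[OF \<psi>(1)] sets_spectral K.finite_measure_axioms K.events_eq_borel _ _ N K(3) z e] by blast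
  define r where "r = p + [:-1:]"
  have "pop A r \<psi> = (\<lambda>x. pop A p \<psi> x - \<psi> x)"
    unfolding r_def A.pop_add A.pop_const by simp
  moreover have "complex_of_real ((ell2_norm (pop A r \<psi>))\<^sup>2) = of_real (A.mfun \<psi> (r * r))"
    using A.inner_pop_pop[OF \<psi>(1), of r r] ell2_norm_square[OF A.pop_ell2[OF \<psi>(1), of r]] by simp
  then have "(ell2_norm (pop A r \<psi>))\<^sup>2 = integral\<^sup>L (\<sigma> \<psi>) (poly (r * r))"
    by (simp only: of_real_eq_iff mfun_spectral[OF \<psi>(1)])
  moreover have "poly (r * r) = (\<lambda>x. (poly p x - 1)\<^sup>2)" by (auto simp: r_def power2_eq_square)
  ultimately have "(ell2_norm (\<lambda>x. pop A p \<psi> x - \<psi> x))\<^sup>2 \<le> e" using p(2) by simp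
  then show ?thesis using that p(1) by blast
qed

end

section \<open>Poisson integrals and Cauchy transforms\<close>

text \<open>The Poisson integral without the factor \<open>1 / pi\<close>; in this normalization it
  is minus the imaginary part of the Cauchy transform at \<open>x + \<i> e\<close>.\<close>

definition pois :: "real measure \<Rightarrow> real \<Rightarrow> real \<Rightarrow> real" where
  "pois M x e = (\<integral>t. e / ((x - t)\<^sup>2 + e\<^sup>2) \<partial>M)"

definition ctrans :: "real measure \<Rightarrow> (real \<Rightarrow> real) \<Rightarrow> complex \<Rightarrow> complex" where
  "ctrans M f z = (\<integral>t. of_real (f t) / (z - of_real t) \<partial>M)"

lemma poisson_kernel_le:
  fixes s e :: real assumes "e > 0" shows "e / (s\<^sup>2 + e\<^sup>2) \<le> 1 / e"
proof -
  have "e * e \<le> s\<^sup>2 + e\<^sup>2" by (simp add: power2_eq_square)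
  then show ?thesis using assms by (simp add: divide_simps add_pos_nonneg add_nonneg_pos)
qed

lemma poisson_kernel_nonneg: "e > 0 \<Longrightarrow> 0 \<le> e / (s\<^sup>2 + e\<^sup>2)" for s e :: real
  by (simp add: add_nonneg_pos)

lemma poisson_kernel_ge:
  fixes s e :: real assumes "e > 0" "\<bar>s\<bar> \<le> e" shows "1 / (2 * e) \<le> e / (s\<^sup>2 + e\<^sup>2)"
proof -
  have "s\<^sup>2 \<le> e\<^sup>2" using assms by (simp add: abs_le_square_iff[symmetric])
  then have "s\<^sup>2 + e\<^sup>2 \<le> 2 * e * e" by (simp add: power2_eq_square)
  then show ?thesis using assms(1) by (simp add: divide_simps add_nonneg_pos)
qed

lemma pois_integrable:
  fixes M :: "real measure" and x e :: real
  assumes "finite_measure M" "sets M = sets borel" "e > 0"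
  shows "integrable M (\<lambda>t. e / ((x - t)\<^sup>2 + e\<^sup>2))"
proof (rule finite_measure.integrable_const_bound[OF assms(1), where B="1/e"])
  show "AE t in M. norm (e / ((x - t)\<^sup>2 + e\<^sup>2)) \<le> 1 / e"
    using poisson_kernel_le[OF assms(3)] poisson_kernel_nonneg[OF assms(3)] by (intro AE_I2) (simp only: real_norm_def abs_of_nonneg)
  have "(\<lambda>t. e / ((x - t)\<^sup>2 + e\<^sup>2)) \<in> borel_measurable borel" by measurable
  then show "(\<lambda>t. e / ((x - t)\<^sup>2 + e\<^sup>2)) \<in> borel_measurable M"
    using measurable_cong_sets[OF assms(2) refl] by blast
qed

lemma pois_nonneg: "e > 0 \<Longrightarrow> 0 \<le> pois M x e"
  unfolding pois_def by (intro integral_nonneg_AE AE_I2 poisson_kernel_nonneg)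

text \<open>The antiderivative is \<open>arctan ((x - t) / e)\<close>, and the range of
  \<open>arctan\<close> has length \<open>pi\<close>.\<close>

lemma poisson_kernel_interval:
  fixes a b t e :: real
  assumes "a < b" "e > 0"
  shows "(\<integral>\<^sup>+x. ennreal (e / ((x - t)\<^sup>2 + e\<^sup>2)) * indicator {a..b} x \<partial>lborel) \<le> ennreal pi"
proof -
  have D: "((\<lambda>x. arctan ((x - t) / e)) has_real_derivative e / ((x - t)\<^sup>2 + e\<^sup>2)) (at x within S)" for x S
  proof -
    have "((\<lambda>x. arctan ((x - t) / e)) has_real_derivative (inverse (1 + ((x - t) / e)\<^sup>2) * (1 / e))) (at x within S)"
      using assms by (auto intro!: derivative_eq_intros)
    also have "inverse (1 + ((x - t) / e)\<^sup>2) * (1 / e) = e / ((x - t)\<^sup>2 + e\<^sup>2)"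
    proof -
      have "1 + ((x - t) / e)\<^sup>2 = ((x - t)\<^sup>2 + e\<^sup>2) / e\<^sup>2" using assms by (simp add: field_simps)
      then show ?thesis using assms by (simp add: power2_eq_square)
    qed
    finally show ?thesis .
  qed
  have "(\<integral>\<^sup>+x. ennreal (e / ((x - t)\<^sup>2 + e\<^sup>2)) * indicator {a..b} x \<partial>lborel) = ennreal (arctan ((b - t) / e) - arctan ((a - t) / e))"
    by (rule nn_integral_FTC_Icc) (use D assms in \<open>auto simp: add_nonneg_pos\<close>)
  also have "\<dots> \<le> ennreal pi"
    using arctan_bounded[of "(b - t) / e"] arctan_bounded[of "(a - t) / e"] by (intro ennreal_leI) linarith
  finally show ?thesis .
qed

text \<open>Integrating the hypothesis over a neighbourhood \<open>U\<close> of a compact null set \<open>K\<close> bounds the measure of \<open>K\<close>: the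
  left side is at least the measure of \<open>K\<close>, while the right side is small with \<open>U\<close>.\<close>

lemma poisson_dominated_null_compact:
  fixes \<omega> \<eta> :: "real measure"
  assumes fw: "finite_measure \<omega>" and sw: "sets \<omega> = sets borel"
    and fe: "finite_measure \<eta>" and se: "sets \<eta> = sets borel" and ace: "absolutely_continuous lborel \<eta>"
    and e0: "e0 > 0" and C: "C \<ge> 0"
    and dom: "\<And>x e. a < x \<Longrightarrow> x < b \<Longrightarrow> 0 < e \<Longrightarrow> e < e0 \<Longrightarrow> pois \<omega> x e \<le> C * (pois \<eta> x e + 1)"
    and K: "compact K" "K \<subseteq> {a<..<b}" "K \<in> null_sets lborel"
  shows "measure \<omega> K = 0"
proof (cases "K = {}")
  case False
  interpret w: finite_measure \<omega> by (rule fw)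
  interpret h: finite_measure \<eta> by (rule fe)
  interpret pw: pair_sigma_finite lborel \<omega> ..
  interpret ph: pair_sigma_finite lborel \<eta> ..
  note [measurable_cong] = sw se
  have ab: "a < b" using K(2) False by auto
  define U where "U = (\<lambda>r. {x. infdist x K < r})"
  have Uo: "open (U r)" for r unfolding U_def by (intro open_Collect_less continuous_intros)
  have [measurable]: "U r \<in> sets borel" for r using Uo by simp
  have [measurable]: "K \<in> sets borel" by (rule borel_closed[OF compact_imp_closed[OF K(1)]])
  have UK: "(\<Inter>n. U (1 / real (Suc n))) = K"
  proof
    show "(\<Inter>n. U (1 / real (Suc n))) \<subseteq> K"
    proof
      fix x assume "x \<in> (\<Inter>n. U (1 / real (Suc n)))"
      then have l: "infdist x K < inverse (real (Suc n))" for n by (auto simp: U_def inverse_eq_divide)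
      have "infdist x K \<le> 0"
        by (rule LIMSEQ_le_const[OF LIMSEQ_inverse_real_of_nat]) (use l in \<open>auto intro: less_imp_le\<close>)
      then have "infdist x K = 0" using infdist_nonneg[of x K] by simp
      then show "x \<in> K" using in_closed_iff_infdist_zero[OF compact_imp_closed[OF K(1)] False] by simp
    qed
    show "K \<subseteq> (\<Inter>n. U (1 / real (Suc n)))" by (auto simp: U_def)
  qed
  have Umono: "U r \<subseteq> U s" if "r \<le> s" for r s using that by (auto simp: U_def)
  have dec: "decseq (\<lambda>n. U (1 / real (Suc n)))"
    unfolding decseq_def by (intro allI impI Umono frac_le) auto
  have "K \<in> null_sets \<eta>" using ace K(3) unfolding absolutely_continuous_def by blast
  then have "measure \<eta> K = 0" by (simp add: measure_def null_setsD1)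
  then have lim_h: "(\<lambda>n. measure \<eta> (U (1 / real (Suc n)))) \<longlonglongrightarrow> 0"
  proof -
    have "range (\<lambda>n. U (1 / real (Suc n))) \<subseteq> sets \<eta>" unfolding se by auto
    from h.finite_Lim_measure_decseq[OF this dec] show ?thesis
      unfolding UK by (simp only: \<open>measure \<eta> K = 0\<close>)
  qed
  obtain n0 where n0: "U (1 / real (Suc n0)) \<subseteq> {a<..<b}"
  proof -
    obtain d where d: "d > 0" "(\<Union>x\<in>K. ball x d) \<subseteq> {a<..<b}"
      using compact_subset_open_imp_ball_epsilon_subset[OF K(1) _ K(2)] by auto
    obtain n where n: "inverse (real (Suc n)) < d" using reals_Archimedean[OF d(1)] by auto
    have "U (1 / real (Suc n)) \<subseteq> (\<Union>x\<in>K. ball x d)"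
    proof
      fix x assume "x \<in> U (1 / real (Suc n))"
      then have "infdist x K < d" using n by (simp add: U_def inverse_eq_divide)
      then obtain y where "y \<in> K" "dist x y < d"
        using infdist_attains_inf[OF compact_imp_closed[OF K(1)] False, of x] by metis
      then show "x \<in> (\<Union>x\<in>K. ball x d)" by (auto simp: dist_commute)
    qed
    then show ?thesis using d(2) that by blast
  qed
  have Usub: "U (1 / real (Suc n)) \<subseteq> {a<..<b}" if "n \<ge> n0" for n
    using n0 decseqD[OF dec that] by blast
  have "(\<lambda>n. emeasure lborel (U (1 / real (Suc (n + n0))))) \<longlonglongrightarrow> emeasure lborel (\<Inter>n. U (1 / real (Suc (n + n0))))"
  proof (rule Lim_emeasure_decseq)
    show "decseq (\<lambda>n. U (1 / real (Suc (n + n0))))" unfolding decseq_def by (intro allI impI Umono frac_le) auto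
    show "emeasure lborel (U (1 / real (Suc (n + n0)))) \<noteq> \<infinity>" for n
    proof -
      have "emeasure lborel (U (1 / real (Suc (n + n0)))) \<le> emeasure lborel {a<..<b}"
        by (rule emeasure_mono) (use Usub[of "n + n0"] in auto)
      also have "\<dots> < \<infinity>" using ab by simp
      finally show ?thesis by simp
    qed
  qed auto
  moreover have "(\<Inter>n. U (1 / real (Suc (n + n0)))) = K"
  proof -
    have "(\<Inter>n. U (1 / real (Suc (n + n0)))) \<subseteq> (\<Inter>n. U (1 / real (Suc n)))"

    proof (rule INF_mono)
      fix m
      show "\<exists>n\<in>UNIV. U (1 / real (Suc (n + n0))) \<subseteq> U (1 / real (Suc m))"
        by (intro bexI[of _ m] Umono frac_le) auto
    qed
    then show ?thesis unfolding UK by (auto simp: U_def)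
  qed
  moreover have "emeasure lborel K = 0" using K(3) by auto
  ultimately have lim_l: "(\<lambda>n. emeasure lborel (U (1 / real (Suc (n + n0))))) \<longlonglongrightarrow> 0" by simp
  have main: "measure \<omega> K \<le> C * (pi + 1) * \<zeta>" if \<zeta>: "\<zeta> > 0" for \<zeta>
  proof -
    have "eventually (\<lambda>n. emeasure lborel (U (1 / real (Suc (n + n0)))) < ennreal \<zeta>) sequentially"
      using order_tendstoD(2)[OF lim_l] \<zeta> by simp
    moreover have "eventually (\<lambda>n. measure \<eta> (U (1 / real (Suc (n + n0)))) < \<zeta>) sequentially"
      using order_tendstoD(2)[OF LIMSEQ_ignore_initial_segment[OF lim_h, of n0] \<zeta>] by simp
    ultimately have "eventually (\<lambda>n. emeasure lborel (U (1 / real (Suc (n + n0)))) < ennreal \<zeta> \<and>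
        measure \<eta> (U (1 / real (Suc (n + n0)))) < \<zeta>) sequentially" by eventually_elim auto
    then obtain n where n: "emeasure lborel (U (1 / real (Suc (n + n0)))) < ennreal \<zeta>"
        "measure \<eta> (U (1 / real (Suc (n + n0)))) < \<zeta>"
      using eventually_happens[of _ sequentially] by auto
    \<comment> \<open>Half the radius of the chosen neighbourhood: points outside
      \<open>U (2 * r)\<close> are at distance at least \<open>r\<close> from
      \<open>U r\<close>.\<close>
    define r where "r = 1 / real (Suc (n + n0)) / 2"
    have r: "r > 0" by (simp add: r_def)
    have "2 * (y / 2) = y" for y :: real by simp
    from this[of "1 / real (Suc (n + n0))"] have "2 * r = 1 / real (Suc (n + n0))" unfolding r_def .
    then have r2: "U (1 / real (Suc (n + n0))) = U (2 * r)" by (simp only:)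
    have Ur: "U r \<subseteq> U (2 * r)" using r by (auto simp: U_def)
    have Uab: "U (2 * r) \<subseteq> {a<..<b}" using Usub[of "n + n0"] r2 by simp
    have key: "measure \<omega> K \<le> C * (pi * \<zeta> + (b - a) * measure \<eta> UNIV / r\<^sup>2 * e + \<zeta>)" if e: "0 < e" "e < e0" "e < r" for e
    proof -
      have k0: "0 \<le> e / (s\<^sup>2 + e\<^sup>2)" for s by (rule poisson_kernel_nonneg[OF e(1)])
      have pE: "ennreal (pois M x e) = (\<integral>\<^sup>+t. ennreal (e / ((x - t)\<^sup>2 + e\<^sup>2)) \<partial>M)"
        if "finite_measure M" "sets M = sets borel" for M x
        unfolding pois_def by (rule nn_integral_eq_integral[symmetric, OF pois_integrable[OF that e(1)]]) (use k0 in auto)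
      have "emeasure \<omega> K = (\<integral>\<^sup>+t. indicator K t \<partial>\<omega>)" by simp
      also have "\<dots> \<le> (\<integral>\<^sup>+t. (\<integral>\<^sup>+x. ennreal (e / ((x - t)\<^sup>2 + e\<^sup>2)) * indicator (U r) x \<partial>lborel) \<partial>\<omega>)"
      proof (rule nn_integral_mono)
        fix t
        show "indicator K t \<le> (\<integral>\<^sup>+x. ennreal (e / ((x - t)\<^sup>2 + e\<^sup>2)) * indicator (U r) x \<partial>lborel)"
        proof (cases "t \<in> K")
          case True
          have sub: "x \<in> U r" if "x \<in> {t-e..t+e}" for x
            using that e(3) infdist_le[OF True, of x] by (auto simp: U_def dist_real_def)
          \<comment> \<open>The kernel is at least \<open>1 / (2 * e)\<close> on an interval of
            length \<open>2 * e\<close> around \<open>t\<close>, and \<open>e < r\<close> keeps this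
            interval inside \<open>U r\<close>.\<close>
          have "(1::ennreal) = (\<integral>\<^sup>+x. ennreal (1 / (2 * e)) * indicator {t-e..t+e} x \<partial>lborel)"
            using e(1) by (subst nn_integral_cmult_indicator) (auto simp flip: ennreal_mult ennreal_1)
          also have "\<dots> \<le> (\<integral>\<^sup>+x. ennreal (e / ((x - t)\<^sup>2 + e\<^sup>2)) * indicator (U r) x \<partial>lborel)"
          proof (rule nn_integral_mono)
            fix x
            show "ennreal (1 / (2 * e)) * indicator {t-e..t+e} x \<le> ennreal (e / ((x - t)\<^sup>2 + e\<^sup>2)) * indicator (U r) x"
            proof (cases "x \<in> {t-e..t+e}")
              case xin: True
              have "1 / (2 * e) \<le> e / ((x - t)\<^sup>2 + e\<^sup>2)" by (rule poisson_kernel_ge) (use xin e(1) in auto)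
              then show ?thesis using sub[OF xin] xin by (simp add: ennreal_leI)
            qed simp
          qed
          finally show ?thesis using True by simp
        qed simp
      qed
      also have "\<dots> = (\<integral>\<^sup>+x. (\<integral>\<^sup>+t. ennreal (e / ((x - t)\<^sup>2 + e\<^sup>2)) * indicator (U r) x \<partial>\<omega>) \<partial>lborel)"
        by (rule pw.Fubini') measurable
      also have "\<dots> = (\<integral>\<^sup>+x. ennreal (pois \<omega> x e) * indicator (U r) x \<partial>lborel)"
        unfolding pE[OF fw sw] by (intro nn_integral_cong nn_integral_multc) measurable
      also have "\<dots> \<le> (\<integral>\<^sup>+x. ennreal C * ((\<integral>\<^sup>+t. ennreal (e / ((x - t)\<^sup>2 + e\<^sup>2)) \<partial>\<eta>) * indicator (U r) x + indicator (U r) x) \<partial>lborel)"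
      proof (rule nn_integral_mono)
        fix x
        show "ennreal (pois \<omega> x e) * indicator (U r) x \<le> ennreal C * ((\<integral>\<^sup>+t. ennreal (e / ((x - t)\<^sup>2 + e\<^sup>2)) \<partial>\<eta>) * indicator (U r) x + indicator (U r) x)"
        proof (cases "x \<in> U r")
          case True
          then have "ennreal (pois \<omega> x e) \<le> ennreal (C * (pois \<eta> x e + 1))"
            using dom[of x e] e Ur Uab by (intro ennreal_leI) auto
          also have "\<dots> = ennreal C * (ennreal (pois \<eta> x e) + 1)"
            using C pois_nonneg[OF e(1), of \<eta> x] by (simp add: ennreal_mult ennreal_plus flip: ennreal_1)
          finally show ?thesis using True unfolding pE[OF fe se] by simp
        qed simp
      qed
      also have "\<dots> = ennreal C * ((\<integral>\<^sup>+x. (\<integral>\<^sup>+t. ennreal (e / ((x - t)\<^sup>2 + e\<^sup>2)) \<partial>\<eta>) * indicator (U r) x \<partial>lborel) + emeasure lborel (U r))"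
        by (subst nn_integral_cmult) (auto simp: nn_integral_add)
      also have "(\<integral>\<^sup>+x. (\<integral>\<^sup>+t. ennreal (e / ((x - t)\<^sup>2 + e\<^sup>2)) \<partial>\<eta>) * indicator (U r) x \<partial>lborel)
           = (\<integral>\<^sup>+x. (\<integral>\<^sup>+t. ennreal (e / ((x - t)\<^sup>2 + e\<^sup>2)) * indicator (U r) x \<partial>\<eta>) \<partial>lborel)"
        by (intro nn_integral_cong nn_integral_multc[symmetric]) measurable
      also have "\<dots> = (\<integral>\<^sup>+t. (\<integral>\<^sup>+x. ennreal (e / ((x - t)\<^sup>2 + e\<^sup>2)) * indicator (U r) x \<partial>lborel) \<partial>\<eta>)"
        by (rule ph.Fubini'[symmetric]) measurable
      \<comment> \<open>Near points contribute at most \<open>pi\<close>, on a set of small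
        \<open>\<eta>\<close>-measure; for far points the kernel is at most \<open>e / r^2\<close>,
        so their contribution is proportional to \<open>e\<close>.\<close>
      also have "\<dots> \<le> (\<integral>\<^sup>+t. ennreal pi * indicator (U (2 * r)) t + ennreal ((b - a) / r\<^sup>2 * e) \<partial>\<eta>)"
      proof (rule nn_integral_mono)
        fix t
        show "(\<integral>\<^sup>+x. ennreal (e / ((x - t)\<^sup>2 + e\<^sup>2)) * indicator (U r) x \<partial>lborel) \<le> ennreal pi * indicator (U (2 * r)) t + ennreal ((b - a) / r\<^sup>2 * e)"
        proof (cases "t \<in> U (2 * r)")
          case True
          have "(\<integral>\<^sup>+x. ennreal (e / ((x - t)\<^sup>2 + e\<^sup>2)) * indicator (U r) x \<partial>lborel) \<le>
            (\<integral>\<^sup>+x. ennreal (e / ((x - t)\<^sup>2 + e\<^sup>2)) * indicator {a..b} x \<partial>lborel)"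
            by (intro nn_integral_mono mult_left_mono) (use Ur Uab in \<open>auto split: split_indicator\<close>)
          also have "\<dots> \<le> ennreal pi" by (rule poisson_kernel_interval[OF ab e(1)])
          finally show ?thesis using True by (auto intro: order_trans)
        next
          case False
          have far: "e / ((x - t)\<^sup>2 + e\<^sup>2) \<le> e / r\<^sup>2" if "x \<in> U r" for x
          proof -
            have "r \<le> \<bar>x - t\<bar>"
              using that False infdist_triangle[of t K x] by (auto simp: U_def dist_real_def)
            then have "r\<^sup>2 \<le> (x - t)\<^sup>2" using r by (simp add: abs_le_square_iff[symmetric])
            then show ?thesis using r e(1) by (intro frac_le) (auto simp: add_increasing2)
          qed
          have "(\<integral>\<^sup>+x. ennreal (e / ((x - t)\<^sup>2 + e\<^sup>2)) * indicator (U r) x \<partial>lborel) \<le>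
            (\<integral>\<^sup>+x. ennreal (e / r\<^sup>2) * indicator {a..b} x \<partial>lborel)"
            by (intro nn_integral_mono) (use Ur Uab far in \<open>auto split: split_indicator intro!: ennreal_leI\<close>)
          also have "\<dots> = ennreal ((b - a) / r\<^sup>2 * e)"
            using e(1) ab by (subst nn_integral_cmult_indicator) (auto simp: mult.commute simp flip: ennreal_mult)
          finally show ?thesis by (auto intro: order_trans)
        qed
      qed
      also have "\<dots> = ennreal pi * emeasure \<eta> (U (2 * r)) + ennreal ((b - a) / r\<^sup>2 * e) * emeasure \<eta> (space \<eta>)"
        by (subst nn_integral_add) (auto simp: nn_integral_cmult_indicator se)
      also have "\<dots> \<le> ennreal (pi * \<zeta> + (b - a) * measure \<eta> UNIV / r\<^sup>2 * e)"
      proof -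
        have "space \<eta> = UNIV" using sets_eq_imp_space_eq[OF se] by simp
        then have "ennreal pi * emeasure \<eta> (U (2 * r)) + ennreal ((b - a) / r\<^sup>2 * e) * emeasure \<eta> (space \<eta>)
          = ennreal (pi * measure \<eta> (U (2 * r)) + (b - a) / r\<^sup>2 * e * measure \<eta> UNIV)"
          using ab e(1) by (simp add: h.emeasure_eq_measure flip: ennreal_mult'' ennreal_plus)
        also have "\<dots> \<le> ennreal (pi * \<zeta> + (b - a) * measure \<eta> UNIV / r\<^sup>2 * e)"
          using n(2) unfolding r2 by (intro ennreal_leI add_mono mult_left_mono) (auto simp: mult_ac)
        finally show ?thesis .
      qed
      finally have "emeasure \<omega> K \<le> ennreal C * (ennreal (pi * \<zeta> + (b - a) * measure \<eta> UNIV / r\<^sup>2 * e) + emeasure lborel (U r))"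
        by (simp add: mult_left_mono add_right_mono)
      also have "\<dots> \<le> ennreal C * (ennreal (pi * \<zeta> + (b - a) * measure \<eta> UNIV / r\<^sup>2 * e) + ennreal \<zeta>)"
      proof -
        have "emeasure lborel (U r) \<le> emeasure lborel (U (2 * r))" by (rule emeasure_mono[OF Ur]) simp
        then have "emeasure lborel (U r) \<le> ennreal \<zeta>" using n(1) unfolding r2 by simp
        then show ?thesis by (intro mult_left_mono add_left_mono) auto
      qed
      also have "\<dots> = ennreal (C * (pi * \<zeta> + (b - a) * measure \<eta> UNIV / r\<^sup>2 * e + \<zeta>))"
        using C \<zeta> ab e(1) by (simp add: ennreal_mult ennreal_plus)
      finally show ?thesis
        using C \<zeta> ab e(1) by (subst (asm) w.emeasure_eq_measure) (simp add: ennreal_le_iff)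
    qed
    \<comment> \<open>For fixed \<open>\<zeta>\<close> the limit \<open>e\<close> to 0 removes the
      far part; afterwards \<open>\<zeta>\<close> tends to 0.\<close>
    have "((\<lambda>e. C * (pi * \<zeta> + (b - a) * measure \<eta> UNIV / r\<^sup>2 * e + \<zeta>)) \<longlongrightarrow> C * (pi * \<zeta> + (b - a) * measure \<eta> UNIV / r\<^sup>2 * 0 + \<zeta>)) (at_right 0)"
      by (intro tendsto_intros)
    moreover have "eventually (\<lambda>e. measure \<omega> K \<le> C * (pi * \<zeta> + (b - a) * measure \<eta> UNIV / r\<^sup>2 * e + \<zeta>)) (at_right 0)"
      unfolding eventually_at_right_field using key e0 r by (intro exI[of _ "min e0 r"]) auto
    ultimately have "measure \<omega> K \<le> C * (pi * \<zeta> + (b - a) * measure \<eta> UNIV / r\<^sup>2 * 0 + \<zeta>)"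
      using tendsto_lowerbound by (metis trivial_limit_at_right_real)
    then show ?thesis by (simp add: algebra_simps)
  qed
  have "((\<lambda>\<zeta>. C * (pi + 1) * \<zeta>) \<longlongrightarrow> C * (pi + 1) * 0) (at_right 0)" by (intro tendsto_intros)
  moreover have "eventually (\<lambda>\<zeta>. measure \<omega> K \<le> C * (pi + 1) * \<zeta>) (at_right 0)"
    unfolding eventually_at_right_field using main by (intro exI[of _ 1]) auto
  ultimately have "measure \<omega> K \<le> C * (pi + 1) * 0"
    using tendsto_lowerbound by (metis trivial_limit_at_right_real)
  then show ?thesis using measure_nonneg[of \<omega> K] by simp
qed simp

text \<open>Inner regularity leaves only the compact subsets of the null set to be treated.\<close>

lemma poisson_dominated_null:
  fixes \<omega> \<eta> :: "real measure"
  assumes fw: "finite_measure \<omega>" and sw: "sets \<omega> = sets borel"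
    and fe: "finite_measure \<eta>" and se: "sets \<eta> = sets borel" and ace: "absolutely_continuous lborel \<eta>"
    and e0: "e0 > 0" and C: "C \<ge> 0"
    and dom: "\<And>x e. a < x \<Longrightarrow> x < b \<Longrightarrow> 0 < e \<Longrightarrow> e < e0 \<Longrightarrow> pois \<omega> x e \<le> C * (pois \<eta> x e + 1)"
    and N: "N \<in> null_sets lborel"
  shows "emeasure \<omega> (N \<inter> {a<..<b}) = 0"
proof -
  have B: "N \<inter> {a<..<b} \<in> sets borel" using N by auto
  have fin: "emeasure \<omega> (space \<omega>) \<noteq> \<infinity>" using finite_measure.emeasure_finite[OF fw] by simp
  have "emeasure \<omega> (N \<inter> {a<..<b}) = (SUP K \<in> {K. K \<subseteq> N \<inter> {a<..<b} \<and> compact K}. emeasure \<omega> K)"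
    by (rule inner_regular[OF sw fin B])
  also have "\<dots> = (SUP K \<in> {K. K \<subseteq> N \<inter> {a<..<b} \<and> compact K}. 0)"
  proof (rule SUP_cong[OF refl])
    fix K assume "K \<in> {K. K \<subseteq> N \<inter> {a<..<b} \<and> compact K}"
    then have K: "compact K" "K \<subseteq> {a<..<b}" "K \<subseteq> N" by auto
    have "K \<in> sets lborel" using borel_closed[OF compact_imp_closed[OF K(1)]] by simp
    then have "K \<in> null_sets lborel" using null_sets_subset[OF N _ K(3)] by simp
    from poisson_dominated_null_compact[OF fw sw fe se ace e0 C dom K(1,2) this]
    show "emeasure \<omega> K = 0" by (simp add: finite_measure.emeasure_eq_measure[OF fw])
  qed
  also have "\<dots> = 0" by (intro antisym SUP_least) auto
  finally show ?thesis .
qed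

text \<open>The carrier \<open>S\<close> is a parameter so that the same estimates serve in the
  upper half-plane, near real points off the support, and near infinity.\<close>

locale cauchy_density = finite_measure M for M :: "real measure" +
  fixes f :: "real \<Rightarrow> real" and B :: real and S :: "real set"
  assumes M_sets: "sets M = sets borel" and f_meas: "f \<in> borel_measurable borel"
    and AE_S: "AE t in M. t \<in> S \<and> \<bar>f t\<bar> \<le> B" and B0: "B \<ge> 0"
begin

lemma integrand_measurable [measurable]: "(\<lambda>t. of_real (f t) / ((z::complex) - of_real t)) \<in> borel_measurable M"
proof -
  note [measurable] = f_meas
  have "(\<lambda>t. of_real (f t) / (z - of_real t)) \<in> borel_measurable borel" by measurable
  then show ?thesis using measurable_cong_sets[OF M_sets refl] by blast
qed

lemma norm_integral_le:
  fixes g :: "real \<Rightarrow> complex"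
  assumes "integrable M g" "AE t in M. cmod (g t) \<le> C"
  shows "cmod (integral\<^sup>L M g) \<le> C * measure M (space M)"
proof -
  have "cmod (integral\<^sup>L M g) \<le> (\<integral>t. cmod (g t) \<partial>M)" by simp
  also have "\<dots> \<le> (\<integral>t. C \<partial>M)" using assms by (intro integral_mono_AE) auto
  finally show ?thesis by (simp add: mult.commute)
qed

lemma integrand_bound:
  assumes "\<delta> > 0" "\<And>t. t \<in> S \<Longrightarrow> \<delta> \<le> cmod (z - of_real t)"
  shows "AE t in M. cmod (of_real (f t) / (z - of_real t)) \<le> B / \<delta>"
  using AE_S
proof (rule AE_mp, intro AE_I2 impI)
  fix t assume "t \<in> S \<and> \<bar>f t\<bar> \<le> B"
  then show "cmod (of_real (f t) / (z - of_real t)) \<le> B / \<delta>"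
    unfolding norm_divide using assms B0 by (intro frac_le) auto
qed

lemma integrand_integrable:
  assumes "\<delta> > 0" "\<And>t. t \<in> S \<Longrightarrow> \<delta> \<le> cmod (z - of_real t)"
  shows "integrable M (\<lambda>t. of_real (f t) / (z - of_real t))"
  by (rule integrable_const_bound[OF integrand_bound[OF assms]]) auto

lemma norm_ctrans_le:
  assumes "\<delta> > 0" "\<And>t. t \<in> S \<Longrightarrow> \<delta> \<le> cmod (z - of_real t)"
  shows "cmod (ctrans M f z) \<le> B / \<delta> * measure M (space M)"
  unfolding ctrans_def by (rule norm_integral_le[OF integrand_integrable[OF assms] integrand_bound[OF assms]])

lemma ctrans_lipschitz:
  assumes "\<delta> > 0" "\<And>t. t \<in> S \<Longrightarrow> \<delta> \<le> cmod (z - of_real t)" "\<And>t. t \<in> S \<Longrightarrow> \<delta> \<le> cmod (w - of_real t)"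
  shows "cmod (ctrans M f z - ctrans M f w) \<le> B / \<delta>\<^sup>2 * measure M (space M) * cmod (z - w)"
proof -
  have "ctrans M f z - ctrans M f w = (\<integral>t. of_real (f t) / (z - of_real t) - of_real (f t) / (w - of_real t) \<partial>M)"
    unfolding ctrans_def using assms by (subst Bochner_Integration.integral_diff) (auto intro: integrand_integrable)
  also have "cmod \<dots> \<le> B / \<delta>\<^sup>2 * cmod (z - w) * measure M (space M)"
  proof (rule norm_integral_le)
    show "integrable M (\<lambda>t. of_real (f t) / (z - of_real t) - of_real (f t) / (w - of_real t))"
      by (intro Bochner_Integration.integrable_diff integrand_integrable[OF assms(1)] assms(2,3))
    show "AE t in M. cmod (of_real (f t) / (z - of_real t) - of_real (f t) / (w - of_real t)) \<le> B / \<delta>\<^sup>2 * cmod (z - w)"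
      using AE_S
    proof (rule AE_mp, intro AE_I2 impI)
      fix t assume t: "t \<in> S \<and> \<bar>f t\<bar> \<le> B"
      have nz: "z - of_real t \<noteq> 0" "w - of_real t \<noteq> 0" using assms(1) assms(2)[of t] assms(3)[of t] t by auto
      have "of_real (f t) / (z - of_real t) - of_real (f t) / (w - of_real t) = of_real (f t) * (w - z) / ((z - of_real t) * (w - of_real t))"
        using nz by (simp add: field_simps)
      also have "cmod \<dots> \<le> B * cmod (z - w) / (\<delta> * \<delta>)"
        unfolding norm_divide norm_mult using t assms B0
        by (intro frac_le mult_mono) (auto simp: norm_minus_commute)
      finally show "cmod (of_real (f t) / (z - of_real t) - of_real (f t) / (w - of_real t)) \<le> B / \<delta>\<^sup>2 * cmod (z - w)"
        by (simp add: power2_eq_square)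
    qed
  qed
  finally show ?thesis by (simp add: mult_ac)
qed

lemma ctrans_continuous:
  assumes "\<delta> > 0" "\<And>t. t \<in> S \<Longrightarrow> \<delta> \<le> cmod (z - of_real t)"
  shows "isCont (ctrans M f) z"
proof -
  let ?C = "B / (\<delta>/2)\<^sup>2 * measure M (space M)"
  have "((\<lambda>w. ctrans M f w - ctrans M f z) \<longlongrightarrow> 0) (at z)"
  proof (rule Lim_null_comparison[where g="\<lambda>w. ?C * cmod (w - z)"])
    show "eventually (\<lambda>w. cmod (ctrans M f w - ctrans M f z) \<le> ?C * cmod (w - z)) (at z)"
      unfolding eventually_at
    proof (intro exI[of _ "\<delta>/2"] conjI ballI impI)
      fix w assume "w \<noteq> z \<and> dist w z < \<delta> / 2"
      then have d: "cmod (w - z) < \<delta>/2" by (simp add: dist_norm)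
      have "\<delta>/2 \<le> cmod (w - of_real t)" if "t \<in> S" for t
        using norm_triangle_ineq4[of "w - of_real t" "w - z"] d assms(2)[OF that] by simp
      moreover have "\<delta>/2 \<le> cmod (z - of_real t)" if "t \<in> S" for t using assms(1) assms(2)[OF that] by simp
      ultimately show "cmod (ctrans M f w - ctrans M f z) \<le> ?C * cmod (w - z)"
        using assms(1) by (intro ctrans_lipschitz) auto
    qed (use assms in auto)
    have "((\<lambda>w. ?C * cmod (w - z)) \<longlongrightarrow> ?C * cmod (z - z)) (at z)" by (intro tendsto_intros)
    then show "((\<lambda>w. ?C * cmod (w - z)) \<longlongrightarrow> 0) (at z)" by simp
  qed
  then show ?thesis by (simp add: isCont_def LIM_zero_iff)
qed

lemma upper_half_sep: "Im z > 0 \<Longrightarrow> Im z \<le> cmod (z - of_real t)"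
  using abs_Im_le_cmod[of "z - of_real t"] by simp

text \<open>The derivative is the integral of the differentiated kernel; the difference quotient
  deviates from it by at most a multiple of \<open>|w - z| / \<delta>^3\<close>.\<close>

lemma ctrans_holomorphic: "ctrans M f holomorphic_on {z. Im z > 0}"
proof (rule holomorphic_onI)
  fix z assume "z \<in> {z. Im z > 0}"
  then have z: "Im z > 0" by simp
  \<comment> \<open>On the disc of this radius around \<open>z\<close> every point keeps a distance
    at least \<open>\<delta>\<close> from the real line.\<close>
  define \<delta> where "\<delta> = Im z / 2"
  have d0: "\<delta> > 0" using z by (simp add: \<delta>_def)
  have sz: "\<delta> \<le> cmod (z - of_real t)" for t using upper_half_sep[OF z, of t] z by (simp add: \<delta>_def)
  have sw: "\<delta> \<le> cmod (w - of_real t)" if "cmod (w - z) < \<delta>" for w t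
    using norm_triangle_ineq4[of "w - of_real t" "w - z"] that upper_half_sep[OF z, of t] by (simp add: \<delta>_def)
  define D where "D = (\<integral>t. - of_real (f t) / (z - of_real t)\<^sup>2 \<partial>M)"
  have mD: "(\<lambda>t. - of_real (f t) / (z - of_real t)\<^sup>2) \<in> borel_measurable M"
  proof -
    note [measurable] = f_meas
    have "(\<lambda>t. - of_real (f t) / (z - of_real t)\<^sup>2) \<in> borel_measurable borel" by measurable
    then show ?thesis using measurable_cong_sets[OF M_sets refl] by blast
  qed
  have iD: "integrable M (\<lambda>t. - of_real (f t) / (z - of_real t)\<^sup>2)"
  proof (rule integrable_const_bound[where B="B / \<delta>\<^sup>2", OF _ mD])
    show "AE t in M. cmod (- of_real (f t) / (z - of_real t)\<^sup>2) \<le> B / \<delta>\<^sup>2"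
      using AE_S
    proof (rule AE_mp, intro AE_I2 impI)
      fix t assume "t \<in> S \<and> \<bar>f t\<bar> \<le> B"
      then show "cmod (- of_real (f t) / (z - of_real t)\<^sup>2) \<le> B / \<delta>\<^sup>2"
        unfolding norm_divide norm_power using d0 sz B0 by (intro frac_le power_mono) auto
    qed
  qed
  have "(ctrans M f has_field_derivative D) (at z)"
    unfolding DERIV_def has_field_derivative_iff
  proof (rule Lim_transform)
  show "((\<lambda>w. D) \<longlongrightarrow> D) (at z)" by simp
    let ?C = "B / \<delta> ^ 3 * measure M (space M)"
    show "((\<lambda>w. (ctrans M f w - ctrans M f z) / (w - z) - D) \<longlongrightarrow> 0) (at z)"
    proof (rule Lim_null_comparison[where g="\<lambda>w. ?C * cmod (w - z)"])
      have "((\<lambda>w. ?C * cmod (w - z)) \<longlongrightarrow> ?C * cmod (z - z)) (at z)" by (intro tendsto_intros)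
      then show "((\<lambda>w. ?C * cmod (w - z)) \<longlongrightarrow> 0) (at z)" by simp
      show "eventually (\<lambda>w. cmod ((ctrans M f w - ctrans M f z) / (w - z) - D) \<le> ?C * cmod (w - z)) (at z)"
        unfolding eventually_at
      proof (intro exI[of _ \<delta>] conjI ballI impI)
        fix w assume w: "w \<noteq> z \<and> dist w z < \<delta>"
        then have d: "cmod (w - z) < \<delta>" by (simp add: dist_norm)
        let ?i = "\<lambda>t. (of_real (f t) / (w - of_real t) - of_real (f t) / (z - of_real t)) / (w - z) - (- of_real (f t) / (z - of_real t)\<^sup>2)"
        have iw: "integrable M (\<lambda>t. of_real (f t) / (w - of_real t))"
          by (rule integrand_integrable[OF d0]) (rule sw[OF d])
        have iz: "integrable M (\<lambda>t. of_real (f t) / (z - of_real t))"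
          by (rule integrand_integrable[OF d0]) (rule sz)
        have "(ctrans M f w - ctrans M f z) / (w - z) - D = (\<integral>t. ?i t \<partial>M)"
          unfolding ctrans_def D_def using iw iz iD by simp
        also have "cmod \<dots> \<le> B / \<delta> ^ 3 * cmod (w - z) * measure M (space M)"
        proof (rule norm_integral_le)
          show "integrable M ?i" using iw iz iD by auto
          show "AE t in M. cmod (?i t) \<le> B / \<delta> ^ 3 * cmod (w - z)"
            using AE_S
          proof (rule AE_mp, intro AE_I2 impI)
            fix t assume t: "t \<in> S \<and> \<bar>f t\<bar> \<le> B"
            have nz: "z - of_real t \<noteq> 0" "w - of_real t \<noteq> 0" using d0 sz[of t] sw[OF d, of t] by auto
            have id: "(c / p - c / q) / (p - q) - (- c / q\<^sup>2) = c * (p - q) / (p * q\<^sup>2)"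
              if "p \<noteq> 0" "q \<noteq> 0" "p \<noteq> q" for c p q :: complex
              using that by (simp add: field_simps power2_eq_square)
            have "?i t = of_real (f t) * (w - z) / ((w - of_real t) * (z - of_real t)\<^sup>2)"
              using id[OF nz(2,1), of "of_real (f t)"] w by simp
            also have "cmod \<dots> \<le> B * cmod (w - z) / (\<delta> * \<delta>\<^sup>2)"
              unfolding norm_divide norm_mult norm_power using t sz[of t] sw[OF d, of t] d0 B0
              by (intro frac_le mult_mono power_mono) auto
            finally show "cmod (?i t) \<le> B / \<delta> ^ 3 * cmod (w - z)"
              by (simp add: power2_eq_square power3_eq_cube mult.assoc)
          qed
        qed
        finally show "cmod ((ctrans M f w - ctrans M f z) / (w - z) - D) \<le> ?C * cmod (w - z)" by (simp add: mult_ac)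
      qed (rule d0)
    qed
  qed
  then show "ctrans M f field_differentiable at z within {z. Im z > 0}"
    using field_differentiable_at_within field_differentiable_def by blast
qed

text \<open>Geometric expansion of \<open>1 / (z - t)\<close>: the remainder after \<open>N\<close>
  terms carries the factor \<open>(t / z)^N\<close>, uniformly small because
  \<open>|t| \<le> R < |z|\<close>.\<close>

lemma ctrans_sums:
  assumes R: "\<And>t. t \<in> S \<Longrightarrow> \<bar>t\<bar> \<le> R" "0 \<le> R" "R < cmod z"
  shows "(\<lambda>j. of_real (\<integral>t. f t * t ^ j \<partial>M) / z ^ Suc j) sums ctrans M f z"
proof -
  have z0: "z \<noteq> 0" using R by auto
  define \<delta> where "\<delta> = cmod z - R"
  have d0: "\<delta> > 0" using R by (simp add: \<delta>_def)
  have sz: "\<delta> \<le> cmod (z - of_real t)" if "t \<in> S" for t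
    using norm_triangle_ineq2[of z "of_real t"] R(1)[OF that] by (simp add: \<delta>_def)
  have iz: "integrable M (\<lambda>t. of_real (f t) / (z - of_real t))"
    by (rule integrand_integrable[OF d0]) (rule sz)
  have mj: "(\<lambda>t. f t * t ^ j) \<in> borel_measurable M" for j
  proof -
    note [measurable] = f_meas
    have "(\<lambda>t. f t * t ^ j) \<in> borel_measurable borel" by measurable
    then show ?thesis using measurable_cong_sets[OF M_sets refl] by blast
  qed
  have mc: "(\<lambda>t. complex_of_real (f t * t ^ j)) \<in> borel_measurable M" for j
    by (intro measurable_compose[OF mj]) measurable
  have ij: "integrable M (\<lambda>t. f t * t ^ j)" for j
  proof (rule integrable_const_bound[where B="B * R ^ j", OF _ mj])
    show "AE t in M. norm (f t * t ^ j) \<le> B * R ^ j"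
      using AE_S by (rule AE_mp) (auto intro!: AE_I2 mult_mono power_mono simp: abs_mult power_abs R B0)
  qed
  have part: "ctrans M f z - (\<Sum>j<N. of_real (\<integral>t. f t * t ^ j \<partial>M) / z ^ Suc j)
      = (\<integral>t. of_real (f t) / (z - of_real t) * (of_real t / z) ^ N \<partial>M)" for N
  proof -
    have s: "(\<Sum>j<N. of_real (\<integral>t. f t * t ^ j \<partial>M) / z ^ Suc j) = (\<integral>t. (\<Sum>j<N. of_real (f t * t ^ j) / z ^ Suc j) \<partial>M)"
      using ij by (subst Bochner_Integration.integral_sum) (auto simp del: of_real_mult power_Suc)
    have "ctrans M f z - (\<integral>t. (\<Sum>j<N. of_real (f t * t ^ j) / z ^ Suc j) \<partial>M)
       = (\<integral>t. of_real (f t) / (z - of_real t) - (\<Sum>j<N. of_real (f t * t ^ j) / z ^ Suc j) \<partial>M)"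
      unfolding ctrans_def using ij iz
      by (subst Bochner_Integration.integral_diff) (auto simp del: of_real_mult power_Suc intro!: Bochner_Integration.integrable_sum integrable_divide_zero integrable_of_real)
    also have "\<dots> = (\<integral>t. of_real (f t) / (z - of_real t) * (of_real t / z) ^ N \<partial>M)"
    proof (rule integral_cong_AE)
      show "AE t in M. of_real (f t) / (z - of_real t) - (\<Sum>j<N. of_real (f t * t ^ j) / z ^ Suc j) = of_real (f t) / (z - of_real t) * (of_real t / z) ^ N"
        using AE_S
      proof (rule AE_mp, intro AE_I2 impI)
        fix t assume t: "t \<in> S \<and> \<bar>f t\<bar> \<le> B"
        have nz: "z - of_real t \<noteq> 0" using d0 sz[of t] t by auto
        define q where "q = of_real t / z"
        have q1: "(1 - q) = (z - of_real t) / z" using z0 by (simp add: q_def field_simps)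
        have "(\<Sum>j<N. of_real (f t * t ^ j) / z ^ Suc j) = of_real (f t) / z * (\<Sum>j<N. q ^ j)"
          by (simp add: sum_distrib_left q_def power_divide)
        also have "(\<Sum>j<N. q ^ j) = (1 - q ^ N) * z / (z - of_real t)"
        proof -
          have "(1 - q) * (\<Sum>j<N. q ^ j) = 1 - q ^ N" using one_diff_power_eq[of q N] by simp
          then show ?thesis using nz z0 unfolding q1 by (simp add: field_simps)
        qed
        also have "of_real (f t) / z * ((1 - q ^ N) * z / (z - of_real t)) = of_real (f t) * (1 - q ^ N) / (z - of_real t)"
          using z0 by simp
        finally have e: "(\<Sum>j<N. of_real (f t * t ^ j) / z ^ Suc j) = of_real (f t) * (1 - q ^ N) / (z - of_real t)" .
        show "of_real (f t) / (z - of_real t) - (\<Sum>j<N. of_real (f t * t ^ j) / z ^ Suc j) = of_real (f t) / (z - of_real t) * (of_real t / z) ^ N"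
          unfolding e q_def[symmetric] by (simp add: right_diff_distrib diff_divide_distrib)
      qed
      have [measurable]: "(\<lambda>t::real. t) \<in> borel_measurable M" by (simp add: measurable_cong_sets[OF M_sets refl])
      show "(\<lambda>t. of_real (f t) / (z - of_real t) - (\<Sum>j<N. of_real (f t * t ^ j) / z ^ Suc j)) \<in> borel_measurable M"
        by (intro borel_measurable_diff integrand_measurable borel_measurable_sum borel_measurable_divide mc borel_measurable_const)
      show "(\<lambda>t. of_real (f t) / (z - of_real t) * (of_real t / z) ^ N) \<in> borel_measurable M"
        by measurable
    qed
    finally show ?thesis using s by simp
  qed
  let ?q = "R / cmod z"
  have q: "0 \<le> ?q" "?q < 1" using R z0 by (auto simp: divide_less_eq)
  have bd: "cmod (ctrans M f z - (\<Sum>j<N. of_real (\<integral>t. f t * t ^ j \<partial>M) / z ^ Suc j)) \<le> B / \<delta> * measure M (space M) * ?q ^ N" for N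
  proof -
    have [measurable]: "(\<lambda>t::real. t) \<in> borel_measurable M" by (simp add: measurable_cong_sets[OF M_sets refl])
    have ae: "AE t in M. cmod (of_real (f t) / (z - of_real t) * (of_real t / z) ^ N) \<le> B / \<delta> * ?q ^ N"
      using AE_S
    proof (rule AE_mp, intro AE_I2 impI)
      fix t assume t: "t \<in> S \<and> \<bar>f t\<bar> \<le> B"
      show "cmod (of_real (f t) / (z - of_real t) * (of_real t / z) ^ N) \<le> B / \<delta> * ?q ^ N"
        unfolding norm_mult norm_divide norm_power using t sz[of t] d0 B0 R
        by (intro mult_mono frac_le power_mono divide_right_mono) auto
    qed
    have "integrable M (\<lambda>t. of_real (f t) / (z - of_real t) * (of_real t / z) ^ N)"
      by (rule integrable_const_bound[OF ae]) measurable
    from norm_integral_le[OF this ae] show ?thesis unfolding part by (simp add: mult_ac)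
  qed
  have "(\<lambda>N. ?q ^ N) \<longlonglongrightarrow> 0" by (rule LIMSEQ_realpow_zero[OF q])
  then have "(\<lambda>N. B / \<delta> * measure M (space M) * ?q ^ N) \<longlonglongrightarrow> B / \<delta> * measure M (space M) * 0"
    by (intro tendsto_mult tendsto_const)
  then have "(\<lambda>N. ctrans M f z - (\<Sum>j<N. of_real (\<integral>t. f t * t ^ j \<partial>M) / z ^ Suc j)) \<longlonglongrightarrow> 0"
    by (intro Lim_null_comparison[OF always_eventually[OF allI[OF bd]]]) simp
  then show ?thesis unfolding sums_def by (rule Lim_transform2[OF tendsto_const])
qed

text \<open>Absolute convergence is what a Cauchy product of two such series requires.\<close>

lemma ctrans_abs_summable:
  assumes R: "\<And>t. t \<in> S \<Longrightarrow> \<bar>t\<bar> \<le> R" "0 \<le> R" "R < cmod z"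
  shows "summable (\<lambda>j. cmod (of_real (\<integral>t. f t * t ^ j \<partial>M) / z ^ Suc j))"
proof (rule summable_comparison_test')
  let ?q = "R / cmod z" and ?m = "measure M (space M)"
  have z: "cmod z > 0" using R by linarith
  show "summable (\<lambda>j. B * ?m / cmod z * ?q ^ j)"
    using R z by (intro summable_mult summable_geometric) (simp add: divide_less_eq)
  fix j :: nat assume "0 \<le> j"
  have "cmod (of_real (\<integral>t. f t * t ^ j \<partial>M)) \<le> B * R ^ j * ?m"
  proof -
    have ae: "AE t in M. cmod (of_real (f t * t ^ j)) \<le> B * R ^ j"
      using AE_S by (rule AE_mp) (auto intro!: AE_I2 mult_mono power_mono simp: norm_mult norm_power abs_mult power_abs R B0)
    have "(\<lambda>t. of_real (f t * t ^ j) :: complex) \<in> borel_measurable M"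
    proof -
      note [measurable] = f_meas
      have "(\<lambda>t. of_real (f t * t ^ j) :: complex) \<in> borel_measurable borel" by measurable
      then show ?thesis using measurable_cong_sets[OF M_sets refl] by blast
    qed
    from norm_integral_le[OF integrable_const_bound[OF ae this] ae]
    show ?thesis by (simp only: integral_complex_of_real)
  qed
  then have "cmod (of_real (\<integral>t. f t * t ^ j \<partial>M) / z ^ Suc j) \<le> (B * R ^ j * ?m) / cmod z ^ Suc j"
    unfolding norm_divide norm_power using z by (intro divide_right_mono) auto
  also have "\<dots> = B * ?m / cmod z * ?q ^ j" by (simp add: power_divide)
  finally show "norm (cmod (of_real (\<integral>t. f t * t ^ j \<partial>M) / z ^ Suc j)) \<le> B * ?m / cmod z * ?q ^ j" by simp
qed

end

section \<open>Sign changes for Angelesco systems\<close>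

declare One_nat_def [simp del]

definition msize :: "nat^2 \<Rightarrow> nat" where "msize n = n $ 1 + n $ 2"

lemma msize_sum: "msize n = (\<Sum>k\<in>UNIV. n $ k)"
  by (simp add: msize_def sum_2)

lemma msize_add_axis [simp]: "msize (n + axis k 1) = Suc (msize n)"
  using exhaust_2[of k] by (auto simp: msize_def axis_def)

lemma msize_diff_axis: "n $ k \<noteq> 0 \<Longrightarrow> msize (n - axis k 1) = msize n - 1"
  using exhaust_2[of k] by (auto simp: msize_def axis_def)

lemma diff_axis_add_axis: "(n :: nat^2) $ k \<noteq> 0 \<Longrightarrow> n - axis k 1 + axis k 1 = n"
  by (auto simp: vec_eq_iff axis_def)

lemma less_add_axis: "m < (n :: nat^2) $ i + axis k 1 $ i \<longleftrightarrow> m < n $ i \<or> (i = k \<and> m = n $ k)"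
  by (auto simp: axis_def)

lemma multi_index_induct [case_names zero step]:
  fixes n :: "nat^2"
  assumes "P 0" "\<And>n k. P n \<Longrightarrow> P (n + axis k 1)"
  shows "P n"
proof (induction "msize n" arbitrary: n)
  case 0
  then have "n = 0" by (simp add: msize_def vec_eq_iff forall_2)
  then show ?case using assms(1) by simp
next
  case (Suc m)
  then obtain k where k: "n $ k \<noteq> 0" by (fastforce simp: msize_def)
  have "P (n - axis k 1)" using Suc msize_diff_axis[OF k] by simp
  then show ?case using assms(2)[of "n - axis k 1" k] diff_axis_add_axis[OF k] by simp
qed

lemma poly_no_root_sign:
  fixes p :: "real poly"
  assumes "\<And>x. x \<in> {a..b} \<Longrightarrow> poly p x \<noteq> 0"
  obtains s where "s = 1 \<or> s = (-1::real)" "\<And>x. x \<in> {a..b} \<Longrightarrow> s * poly p x > 0"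
proof (cases "\<exists>x\<in>{a..b}. poly p x > 0")
  case True
  then obtain x where x: "x \<in> {a..b}" "poly p x > 0" by auto
  have "poly p y > 0" if y: "y \<in> {a..b}" for y
  proof (rule ccontr)
    assume "\<not> poly p y > 0"
    then have n: "poly p y < 0" using assms[OF y] by simp
    then consider "y < x" | "x < y" using x by fastforce
    then show False
    proof cases
      case 1
      from poly_IVT_pos[OF 1 n x(2)] show False using x y assms by force
    next
      case 2
      from poly_IVT_neg[OF 2 x(2) n] show False using x y assms by force
    qed
  qed
  then show ?thesis using that[of 1] by simp
next
  case False
  then have "- 1 * poly p y > 0" if "y \<in> {a..b}" for y using assms[OF that] that by (force simp: not_less)
  then show ?thesis using that[of "-1"] by blast
qed

text \<open>Linear factors at the roots in \<open>S\<close> are removed one at a time, with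
  multiplicity. When \<open>S\<close> is an interval, \<open>V\<close> carries all sign changes
  there and \<open>W\<close> none.\<close>

lemma poly_split_roots:
  fixes p :: "real poly"
  assumes "p \<noteq> 0"
  obtains V W where "p = V * W" "lead_coeff V = 1" "\<And>x. poly V x = 0 \<Longrightarrow> x \<in> S" "\<And>x. x \<in> S \<Longrightarrow> poly W x \<noteq> 0"
    "degree p = degree V + degree W"
  using assms
proof (induction "degree p" arbitrary: p thesis rule: less_induct)
  case less
  show ?case
  proof (cases "\<exists>x\<in>S. poly p x = 0")
    case False
    then show ?thesis by (intro less.prems(1)[of 1 p]) auto
  next
    case True
    then obtain x where x: "x \<in> S" "poly p x = 0" by auto
    then obtain q where q: "p = [:-x, 1:] * q" by (auto simp: poly_eq_0_iff_dvd)
    have q0: "q \<noteq> 0" using q less.prems(2) by auto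
    have dq: "degree p = Suc (degree q)" unfolding q using q0 by (subst degree_mult_eq) auto
    obtain V W where VW: "q = V * W" "lead_coeff V = 1" "\<And>x. poly V x = 0 \<Longrightarrow> x \<in> S" "\<And>x. x \<in> S \<Longrightarrow> poly W x \<noteq> 0"
      "degree q = degree V + degree W"
      using less.hyps[of q] dq q0 by auto
    have "V \<noteq> 0" using VW(2) by auto
    then have dV: "degree ([:-x, 1:] * V) = Suc (degree V)" by (subst degree_mult_eq) auto
    show ?thesis
    proof (rule less.prems(1)[of "[:-x, 1:] * V" W])
      show "p = [:-x, 1:] * V * W" by (simp only: q VW(1) mult.assoc)
      show "lead_coeff ([:-x, 1:] * V) = 1" using VW(2) by (simp add: lead_coeff_mult del: mult_pCons_left)
      show "y \<in> S" if "poly ([:-x, 1:] * V) y = 0" for y using that x(1) VW(3) by auto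
    qed (use VW dV dq in auto)
  qed
qed

lemma poly_roots_left_pos:
  fixes V :: "real poly"
  assumes "lead_coeff V = 1" "\<And>x. poly V x = 0 \<Longrightarrow> x \<le> b" "y > b"
  shows "poly V y > 0"
proof (rule ccontr)
  assume "\<not> poly V y > 0"
  then have n: "poly V y < 0" using assms(2)[of y] assms(3) by (cases "poly V y = 0") auto
  have "V \<noteq> 0" using assms(1) by auto
  obtain z where z: "\<And>x. x \<ge> z \<Longrightarrow> poly V x \<ge> lead_coeff V"
    using poly_pinfty_gt_lc[of V] assms(1) by auto
  define z' where "z' = max z y + 1"
  have "poly V z' \<ge> 1" using z[of z'] unfolding assms(1) by (simp add: z'_def)
  then have "y < z'" "poly V z' > 0" by (auto simp: z'_def)
  from poly_IVT_pos[OF this(1) n this(2)] show False using assms(2,3) by force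
qed

text \<open>The reflection of the line moves the roots to the left, and the factor
  \<open>(-1) ^ degree V\<close> restores a monic polynomial.\<close>

lemma poly_roots_right_sign:
  fixes V :: "real poly"
  assumes "lead_coeff V = 1" "\<And>x. poly V x = 0 \<Longrightarrow> a \<le> x" "y < a"
  shows "(-1) ^ degree V * poly V y > 0"
proof -
  define U where "U = smult ((-1) ^ degree V) (pcompose V [:0, -1:])"
  have "degree U = degree V" by (simp add: U_def degree_pcompose)
  moreover have "lead_coeff (pcompose V [:0, -1:]) = (-1) ^ degree V"
    using assms(1) by (subst lead_coeff_comp) auto
  ultimately have "lead_coeff U = 1"
    by (simp add: U_def degree_pcompose flip: power_add)
  moreover have "x \<le> -a" if "poly U x = 0" for x
    using that assms(2)[of "-x"] by (auto simp: U_def poly_pcompose)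
  ultimately have "poly U (-y) > 0" using assms(3) by (intro poly_roots_left_pos) auto
  then show ?thesis by (simp add: U_def poly_pcompose)
qed

text \<open>Here \<open>lower\<close> is the integrated form of the bound \<open>\<mu>\<^sub>k' \<ge> c\<close> on \<open>\<Delta>\<^sub>k = [\<alpha>\<^sub>k, \<beta>\<^sub>k]\<close>.\<close>

locale angelesco_system =
  fixes \<mu> :: "2 \<Rightarrow> real measure" and \<alpha> \<beta> :: "2 \<Rightarrow> real" and c :: real
  assumes fin_meas: "finite_measure (\<mu> k)" and sets_eq [measurable_cong]: "sets (\<mu> k) = sets borel"
    and supp: "AE x in \<mu> k. x \<in> {\<alpha> k..\<beta> k}"
    and ac: "absolutely_continuous lborel (\<mu> k)"
    and c_pos: "c > 0" and interval: "\<alpha> k < \<beta> k"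
    and lower: "\<alpha> k \<le> a \<Longrightarrow> a \<le> b \<Longrightarrow> b \<le> \<beta> k \<Longrightarrow> c * (b - a) \<le> measure (\<mu> k) {a..b}"
    and disjoint: "{\<alpha> 1..\<beta> 1} \<inter> {\<alpha> 2..\<beta> 2} = {}"
begin

sublocale fin: finite_measure "\<mu> k" for k by (rule fin_meas)

lemma space_eq [simp]: "space (\<mu> k) = UNIV"
  using sets_eq_imp_space_eq[OF sets_eq[of k]] by simp

lemma measurable_mu [simp]: "measurable (\<mu> k) M = measurable borel M"
  by (rule measurable_cong_sets) (simp_all add: sets_eq)

abbreviation I :: "2 \<Rightarrow> real set" where "I k \<equiv> {\<alpha> k..\<beta> k}"

lemma I_disjoint: "j \<noteq> k \<Longrightarrow> I j \<inter> I k = {}"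
  using exhaust_2[of j] exhaust_2[of k] disjoint by auto

lemma integrable_bounded:
  fixes f :: "real \<Rightarrow> 'b::{banach,second_countable_topology}"
  assumes "f \<in> borel_measurable borel" "\<And>x. x \<in> I k \<Longrightarrow> norm (f x) \<le> B"
  shows "integrable (\<mu> k) f"
proof (rule fin.integrable_const_bound[where B=B])
  show "AE x in \<mu> k. norm (f x) \<le> B" using supp[of k] by (rule AE_mp) (auto intro!: AE_I2 assms(2))
qed (use assms in simp)

lemma integrable_continuous:
  fixes f :: "real \<Rightarrow> 'b::{banach,second_countable_topology}"
  assumes "f \<in> borel_measurable borel" "continuous_on (I k) f"
  shows "integrable (\<mu> k) f"
proof -
  have "bounded (f ` I k)" by (intro compact_imp_bounded compact_continuous_image assms) auto
  then obtain B where "\<forall>x\<in>I k. norm (f x) \<le> B" unfolding bounded_iff by auto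
  then show ?thesis using assms by (intro integrable_bounded[where B=B]) auto
qed

lemma integrable_poly [simp]: "integrable (\<mu> k) (poly p)"
  by (intro integrable_continuous continuous_intros borel_measurable_poly)

lemma integral_cong_I:
  fixes f g :: "real \<Rightarrow> 'b::{banach,second_countable_topology}"
  assumes "f \<in> borel_measurable borel" "g \<in> borel_measurable borel" "\<And>x. x \<in> I k \<Longrightarrow> f x = g x"
  shows "integral\<^sup>L (\<mu> k) f = integral\<^sup>L (\<mu> k) g"
proof (rule integral_cong_AE)
  show "AE x in \<mu> k. f x = g x" using supp[of k] by (rule AE_mp) (auto intro!: AE_I2 assms(3))
qed (use assms in simp_all)

lemma finite_null: "finite S \<Longrightarrow> AE x in \<mu> k. x \<notin> S"
proof -
  assume "finite S"
  then have "S \<in> null_sets lborel" by (intro countable_imp_null_set_lborel countable_finite)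
  then have "S \<in> null_sets (\<mu> k)" using ac by (auto simp: absolutely_continuous_def)
  then show ?thesis by (rule AE_not_in)
qed

lemma emeasure_I_pos: "measure (\<mu> k) (I k) > 0"
  using lower[of k "\<alpha> k" "\<beta> k"] interval[of k] c_pos by (auto intro: less_le_trans[rotated])

text \<open>A finite zero set is null by absolute continuity, so a vanishing integral would leave
  \<open>\<mu> k\<close> without mass.\<close>

lemma integral_pos:
  assumes [measurable]: "f \<in> borel_measurable borel" and int: "integrable (\<mu> k) f"
    and nn: "\<And>x. x \<in> I k \<Longrightarrow> f x \<ge> (0::real)"
    and fin: "finite {x \<in> I k. f x = 0}"
  shows "integral\<^sup>L (\<mu> k) f > 0"
proof -
  have AE0: "AE x in \<mu> k. 0 \<le> f x" using supp[of k] by (rule AE_mp) (auto intro!: AE_I2 nn)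
  have "integral\<^sup>L (\<mu> k) f \<noteq> 0"
  proof
    assume "integral\<^sup>L (\<mu> k) f = 0"
    then have "AE x in \<mu> k. f x = 0" using integral_nonneg_eq_0_iff_AE[OF int AE0] by simp
    with supp[of k] finite_null[OF fin, of k] have "AE x in \<mu> k. False" by eventually_elim auto
    then have "emeasure (\<mu> k) UNIV = 0" by (subst (asm) AE_iff_measurable[of UNIV]) (auto simp: sets_eq)
    then have "measure (\<mu> k) (space (\<mu> k)) = 0" by (simp add: measure_def)
    then show False using emeasure_I_pos[of k] fin.bounded_measure[of k "I k"] by simp
  qed
  moreover have "integral\<^sup>L (\<mu> k) f \<ge> 0" by (rule integral_nonneg_AE[OF AE0])
  ultimately show ?thesis by simp
qed

lemma integral_poly_pos:
  assumes "p \<noteq> 0" "\<And>x. x \<in> I k \<Longrightarrow> poly p x \<ge> 0"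
  shows "integral\<^sup>L (\<mu> k) (poly p) > 0"
  using assms by (intro integral_pos) (auto intro: finite_subset[OF _ poly_roots_finite[of p]])

text \<open>The separating point \<open>x0\<close> of the two intervals gives the extra linear factor that is available
  when both components are present.\<close>

lemma sign_polynomial:
  fixes B :: "2 \<Rightarrow> real poly" and g :: "2 \<Rightarrow> real \<Rightarrow> real" and s :: "2 \<Rightarrow> real"
  assumes nz: "\<exists>k. B k \<noteq> 0"
    and gm: "\<And>k. g k \<in> borel_measurable borel" and gc: "\<And>k. continuous_on (I k) (g k)"
    and s: "\<And>k. s k = 1 \<or> s k = -1" and gs: "\<And>k x. x \<in> I k \<Longrightarrow> s k * g k x > 0"
  obtains U where "degree U < (\<Sum>k\<in>UNIV. if B k = 0 then 0 else degree (B k) + 1)"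
    "(\<Sum>k\<in>UNIV. \<integral>x. poly (B k) x * (g k x * poly U x) \<partial>\<mu> k) > 0"
proof -
  note thesisI = that
  define split where "split = (\<lambda>k V W. B k = V * W \<and> lead_coeff V = 1 \<and> (\<forall>x. poly V x = 0 \<longrightarrow> x \<in> I k) \<and>
     (\<forall>x. x \<in> I k \<longrightarrow> poly W x \<noteq> 0) \<and> degree (B k) = degree V + degree W)"
  have "\<exists>V W. B k \<noteq> 0 \<longrightarrow> split k V W" for k
  proof (cases "B k = 0")
    case False
    from poly_split_roots[OF this, where S="I k"] show ?thesis unfolding split_def by metis
  qed auto
  then obtain V W where VW: "\<And>k. B k \<noteq> 0 \<Longrightarrow> split k (V k) (W k)" by metis
  have "\<exists>t. B k \<noteq> 0 \<longrightarrow> (t = 1 \<or> t = (-1::real)) \<and> (\<forall>x\<in>I k. t * poly (W k) x > 0)" for k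
  proof (cases "B k = 0")
    case False
    then show ?thesis using VW[OF False] poly_no_root_sign[of "\<alpha> k" "\<beta> k" "W k"] unfolding split_def by metis
  qed auto
  then obtain t where t: "\<And>k. B k \<noteq> 0 \<Longrightarrow> t k = 1 \<or> t k = (-1::real)"
     "\<And>k x. B k \<noteq> 0 \<Longrightarrow> x \<in> I k \<Longrightarrow> t k * poly (W k) x > 0" by metis
  have pp: "0 \<le> v\<^sup>2 * a * b * c" if "0 < a" "0 < b" "0 < c" for v a b c :: real using that by simp
  \<comment> \<open>Test polynomials have the form \<open>r * V k * Z\<close>. On \<open>I k\<close>
    the factor \<open>V k\<close> completes \<open>B k\<close> to a square times a factor of
    constant sign, so \<open>Z\<close> only has to keep one sign there; on \<open>I j\<close> the
    choice of \<open>Z\<close> must make the integrand nonnegative. \<open>Z\<close> may have degree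
    up to one more than \<open>B j\<close>, but must be constant if \<open>B j = 0\<close>.\<close>
  have key: thesis if k: "B k \<noteq> 0" and j: "j \<noteq> k" and r: "r = 1 \<or> r = (-1::real)"
    and Z: "degree Z < (if B j = 0 then 0 else degree (B j) + 1) + 1"
    and Z1: "\<And>x. x \<in> I k \<Longrightarrow> r * (s k * t k) * poly Z x > 0"
    and Z2: "\<And>x. x \<in> I j \<Longrightarrow> r * s j * (poly Z x * poly (V k) x * poly (B j) x) \<ge> 0"
    for k j Z r
  proof -
    have UN: "UNIV = {k, j}" using j exhaust_2[of j] exhaust_2[of k] by (auto simp: UNIV_2)
    define U where "U = smult r (V k * Z)"
    have sp: "split k (V k) (W k)" by (rule VW[OF k])
    have dU: "degree U \<le> degree (V k) + degree Z"
      unfolding U_def by (rule order_trans[OF degree_smult_le degree_mult_le])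
    have Bi: "integrable (\<mu> i) (\<lambda>x. poly (B i) x * (g i x * poly U x))" for i
      by (intro integrable_continuous continuous_intros borel_measurable_times gm gc borel_measurable_poly)
    have nnj: "0 \<le> poly (B j) x * (g j x * poly U x)" if x: "x \<in> I j" for x
    proof -
      have e: "poly (B j) x * (g j x * poly U x) = (s j * g j x) * (r * s j * (poly Z x * poly (V k) x * poly (B j) x))"
        using s[of j] by (auto simp: U_def algebra_simps)
      show ?thesis unfolding e by (rule mult_nonneg_nonneg[OF less_imp_le[OF gs[OF x]] Z2[OF x]])
    qed
    have nnk: "poly (B k) x * (g k x * poly U x) = (poly (V k) x)\<^sup>2 * (s k * g k x) * (t k * poly (W k) x) * (r * (s k * t k) * poly Z x)" for x
      using s[of k] t(1)[OF k] sp by (auto simp: U_def split_def algebra_simps power2_eq_square)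
    have "0 < (\<integral>x. poly (B k) x * (g k x * poly U x) \<partial>\<mu> k)"
    proof (rule integral_pos[OF _ Bi])
      show "(\<lambda>x. poly (B k) x * (g k x * poly U x)) \<in> borel_measurable borel"
        by (intro borel_measurable_times gm borel_measurable_poly)
      show "0 \<le> poly (B k) x * (g k x * poly U x)" if x: "x \<in> I k" for x
        unfolding nnk by (intro pp Z1[OF x] gs[OF x] t(2)[OF k x])
      have "{x \<in> I k. poly (B k) x * (g k x * poly U x) = 0} \<subseteq> {x. poly (V k) x = 0}"
      proof safe
        fix x assume x: "x \<in> I k" "poly (B k) x * (g k x * poly U x) = 0"
        show "poly (V k) x = 0"
          using x(2) Z1[OF x(1)] gs[OF x(1)] t(2)[OF k x(1)] unfolding nnk by auto
      qed
      moreover have "V k \<noteq> 0" using sp by (auto simp: split_def)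
      ultimately show "finite {x \<in> I k. poly (B k) x * (g k x * poly U x) = 0}"
        using poly_roots_finite finite_subset by blast
    qed
    moreover have "0 \<le> (\<integral>x. poly (B j) x * (g j x * poly U x) \<partial>\<mu> j)"
    proof (rule integral_nonneg_AE)
      show "AE x in \<mu> j. 0 \<le> poly (B j) x * (g j x * poly U x)"
        using supp[of j] by (rule AE_mp) (auto intro!: AE_I2 nnj)
    qed
    moreover have "degree (V k) \<le> degree (B k)" using sp unfolding split_def by linarith
    ultimately show thesis
      using thesisI[of U] dU Z k j unfolding UN by simp
  qed
  obtain k where k: "B k \<noteq> 0" using nz by auto
  obtain j where j: "j \<noteq> k" by (metis zero_neq_one)
  show thesis
  proof (cases "B j = 0")
    case True
    show thesis
      by (rule key[OF k j, where r="s k * t k" and Z=1]) (use True s[of k] t(1)[OF k] in auto)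
  next
    case False
    define lo where "lo = (\<beta> k < \<alpha> j)"
    have sep: "\<beta> k < \<alpha> j \<or> \<beta> j < \<alpha> k"
    proof (rule ccontr)
      assume "\<not> ?thesis"
      then have "max (\<alpha> k) (\<alpha> j) \<in> I j \<inter> I k" using interval[of k] interval[of j] by auto
      then show False using I_disjoint[OF j] by auto
    qed
    define x0 where "x0 = (if lo then (\<beta> k + \<alpha> j) / 2 else (\<beta> j + \<alpha> k) / 2)"
    have Vk: "\<exists>r. (r = 1 \<or> r = (-1::real)) \<and> (\<forall>x\<in>I j. r * poly (V k) x > 0)"
    proof -
      have "poly (V k) x \<noteq> 0" if "x \<in> I j" for x using VW[OF k] I_disjoint[OF j] that by (auto simp: split_def)
      then show ?thesis using poly_no_root_sign[of "\<alpha> j" "\<beta> j" "V k"] by metis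
    qed
    then obtain v where v: "v = 1 \<or> v = (-1::real)" "\<And>x. x \<in> I j \<Longrightarrow> v * poly (V k) x > 0" by blast
    have Vj: "\<exists>r. (r = 1 \<or> r = (-1::real)) \<and> (\<forall>x\<in>I k. r * poly (V j) x > 0)"
    proof -
      have "poly (V j) x \<noteq> 0" if "x \<in> I k" for x using VW[OF False] I_disjoint[OF j] that by (auto simp: split_def)
      then show ?thesis using poly_no_root_sign[of "\<alpha> k" "\<beta> k" "V j"] by metis
    qed
    then obtain v' where v': "v' = 1 \<or> v' = (-1::real)" "\<And>x. x \<in> I k \<Longrightarrow> v' * poly (V j) x > 0" by blast
    have spj: "split j (V j) (W j)" by (rule VW[OF False])
    have Bj: "poly (B j) x = poly (V j) x * poly (W j) x" for x using spj by (simp add: split_def)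
    have dj: "degree (V j) \<le> degree (B j)" using spj unfolding split_def by linarith
    \<comment> \<open>\<open>rk\<close> and \<open>rj\<close> are the signs that the candidate
      \<open>V k * V j\<close> needs on \<open>I k\<close> and on \<open>I j\<close>; if they
      disagree, the factor \<open>x - x0\<close> reverses exactly one of them.\<close>
    define rk where "rk = s k * t k * v'"
    define rj where "rj = s j * t j * v"
    have rr: "rk = 1 \<or> rk = -1" "rj = 1 \<or> rj = -1"
      using s[of k] s[of j] t(1)[OF k] t(1)[OF False] v(1) v'(1) by (auto simp: rk_def rj_def)
    have posk: "rk * (s k * t k) * poly (V j) x > 0" if "x \<in> I k" for x
      using v'(2)[OF that] s[of k] t(1)[OF k] v'(1) by (auto simp: rk_def)
    have posj: "rj * s j * (poly (V j) x * poly (V k) x * poly (B j) x) \<ge> 0" if "x \<in> I j" for x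
    proof -
      have e: "rj * s j * (poly (V j) x * poly (V k) x * poly (B j) x) = (poly (V j) x)\<^sup>2 * (v * poly (V k) x) * (t j * poly (W j) x)"
        using s[of j] by (auto simp: rj_def Bj power2_eq_square)
      show ?thesis unfolding e
        by (rule mult_nonneg_nonneg[OF mult_nonneg_nonneg[OF zero_le_power2 less_imp_le[OF v(2)[OF that]]] less_imp_le[OF t(2)[OF False that]]])
    qed
    show thesis
    proof (cases "rk = rj")
      case True
      show thesis
      proof (rule key[OF k j, where r=rk and Z="V j"])
        show "degree (V j) < (if B j = 0 then 0 else degree (B j) + 1) + 1" using False dj by simp
      qed (use posk posj True rr in auto)
    next
      case ne: False
      then have e: "rj = - rk" using rr by auto
      define d where "d = (if lo then -1 else (1::real))"
      have dk: "d * (x - x0) > 0" if "x \<in> I k" for x using that sep by (auto simp: d_def x0_def lo_def field_simps)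
      have dj': "d * (x - x0) < 0" if "x \<in> I j" for x using that sep interval[of k] interval[of j]
        by (auto simp: d_def x0_def lo_def field_simps)
      have dd: "d = 1 \<or> d = -1" by (auto simp: d_def)
      show thesis
      proof (rule key[OF k j, where r=rk and Z="smult d ([:-x0, 1:] * V j)"])
        show "rk = 1 \<or> rk = -1" by (rule rr)
        have "degree (smult d ([:-x0, 1:] * V j)) \<le> degree [:-x0, 1:] + degree (V j)"
          by (rule order_trans[OF degree_smult_le degree_mult_le])
        then show "degree (smult d ([:-x0, 1:] * V j)) < (if B j = 0 then 0 else degree (B j) + 1) + 1"
          using False dj by simp
        show "rk * (s k * t k) * poly (smult d ([:-x0, 1:] * V j)) x > 0" if x: "x \<in> I k" for x
        proof -
          have e: "rk * (s k * t k) * poly (smult d ([:-x0, 1:] * V j)) x = (d * (x - x0)) * (rk * (s k * t k) * poly (V j) x)"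
            by (simp add: algebra_simps)
          show ?thesis unfolding e by (rule mult_pos_pos[OF dk[OF x] posk[OF x]])
        qed
        show "rk * s j * (poly (smult d ([:-x0, 1:] * V j)) x * poly (V k) x * poly (B j) x) \<ge> 0" if x: "x \<in> I j" for x
        proof -
          have "rk * s j * (poly (smult d ([:-x0, 1:] * V j)) x * poly (V k) x * poly (B j) x)
            = (- (d * (x - x0))) * (rj * s j * (poly (V j) x * poly (V k) x * poly (B j) x))"
            by (simp add: algebra_simps e)
          then show ?thesis using mult_nonneg_nonneg[OF _ posj[OF x], of "- (d * (x - x0))"] dj'[OF x] by linarith
        qed
      qed
    qed
  qed
qed

end

section \<open>Normality and the recurrence coefficients\<close>

context angelesco_system
begin

definition J :: "2 \<Rightarrow> real poly \<Rightarrow> real" where "J k p = integral\<^sup>L (\<mu> k) (poly p)"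

lemma J_add [simp]: "J k (p + q) = J k p + J k q"
proof -
  have "poly (p + q) = (\<lambda>x. poly p x + poly q x)" by auto
  then show ?thesis by (simp add: J_def)
qed

lemma J_smult [simp]: "J k (smult a p) = a * J k p"
proof -
  have "poly (smult a p) = (\<lambda>x. a * poly p x)" by auto
  then show ?thesis by (simp add: J_def)
qed

lemma J_0 [simp]: "J k 0 = 0" using J_smult[of k 0 0] by simp

lemma J_minus [simp]: "J k (- p) = - J k p" using J_smult[of k "-1" p] by simp

lemma J_diff [simp]: "J k (p - q) = J k p - J k q" using J_add[of k p "- q"] by simp

lemma J_sum: "J k (sum f A) = (\<Sum>x\<in>A. J k (f x))"
  by (induction A rule: infinite_finite_induct) auto

text \<open>The type I linear form with coefficients \<open>A 1\<close> and \<open>A 2\<close>, as a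
  functional on test polynomials.\<close>

definition lform :: "(2 \<Rightarrow> real poly) \<Rightarrow> real poly \<Rightarrow> real" where
  "lform A p = (\<Sum>k\<in>UNIV. J k (A k * p))"

lemma lform_add [simp]: "lform A (p + q) = lform A p + lform A q"
  by (simp add: lform_def algebra_simps sum.distrib)

lemma lform_smult [simp]: "lform A (smult a p) = a * lform A p"
  by (simp add: lform_def sum_distrib_left)

lemma lform_0 [simp]: "lform A 0 = 0" by (simp add: lform_def)

lemma lform_sum: "lform A (sum f S) = (\<Sum>x\<in>S. lform A (f x))"
  by (induction S rule: infinite_finite_induct) auto

text \<open>The second alternative admits \<open>p = 0\<close> with \<open>N = 0\<close>, where no
  strict bound on the degree can hold.\<close>

lemma poly_monom_sum:
  fixes p :: "real poly"
  assumes "degree p < N \<or> (\<forall>i\<ge>N. coeff p i = 0)"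
  shows "p = (\<Sum>j<N. smult (coeff p j) (monom 1 j))"
  using assms by (intro poly_eqI) (auto simp: coeff_sum coeff_eq_0 if_distrib cong: if_cong)

lemma lform_expand:
  assumes "degree p < N \<or> (\<forall>i\<ge>N. coeff p i = 0)"
  shows "lform A p = (\<Sum>j<N. coeff p j * lform A (monom 1 j))"
  by (subst poly_monom_sum[OF assms]) (simp add: lform_sum)

text \<open>The degree condition is put on coefficients so that \<open>n $ k = 0\<close> forces
  \<open>A k = 0\<close>.\<close>

definition typeI_class :: "nat^2 \<Rightarrow> (2 \<Rightarrow> real poly) \<Rightarrow> bool" where
  "typeI_class n A \<longleftrightarrow> (\<forall>k i. n $ k \<le> i \<longrightarrow> coeff (A k) i = 0)"

lemma typeI_class_degree: "typeI_class n A \<Longrightarrow> (if A k = 0 then 0 else degree (A k) + 1) \<le> n $ k"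
  unfolding typeI_class_def by (metis Suc_eq_plus1 leading_coeff_0_iff not_less_eq_eq zero_le)

text \<open>A nonzero form would pair positively with some polynomial of degree below
  \<open>msize n\<close>, by \<open>sign_polynomial\<close> with constant weights, although it
  annihilates all of them.\<close>

lemma normalityI:
  assumes A: "typeI_class n A" and orth: "\<And>j. j < msize n \<Longrightarrow> lform A (monom 1 j) = 0"
  shows "A = (\<lambda>_. 0)"
proof (rule ccontr)
  assume "A \<noteq> (\<lambda>_. 0)"
  then have "\<exists>k. A k \<noteq> 0" by auto
  from sign_polynomial[OF this, of "\<lambda>_ _. 1" "\<lambda>_. 1"]
  obtain U where U: "degree U < (\<Sum>k\<in>UNIV. if A k = 0 then 0 else degree (A k) + 1)"
    and pos: "(\<Sum>k\<in>UNIV. \<integral>x. poly (A k) x * (1 * poly U x) \<partial>\<mu> k) > 0" by auto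
  have "degree U < msize n"
    by (rule less_le_trans[OF U]) (auto simp: msize_sum intro!: sum_mono typeI_class_degree[OF A])
  then have "lform A U = 0" by (subst lform_expand[of U "msize n"]) (auto intro!: sum.neutral orth)
  moreover have "poly (A k * U) = (\<lambda>x. poly (A k) x * (1 * poly U x))" for k by auto
  ultimately show False using pos by (simp add: lform_def J_def)
qed

text \<open>Surjectivity grows along the index. The form \<open>Z\<close> is the power
  \<open>x^(n_k)\<close> in slot \<open>k\<close>, corrected to annihilate the first
  \<open>msize n\<close> powers; it is nonzero, so by normality its next moment is nonzero and can
  be used to adjust the new value.\<close>

lemma surjI: "\<exists>A. typeI_class n A \<and> (\<forall>j<msize n. lform A (monom 1 j) = d j)"
proof (induction n arbitrary: d rule: multi_index_induct)
  case zero
  show ?case by (rule exI[of _ "\<lambda>_. 0"]) (simp add: typeI_class_def msize_def)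
next
  case (step n k)
  define E where "E = (\<lambda>i. if i = k then monom 1 (n $ k) else (0::real poly))"
  obtain q where q: "typeI_class n q" "\<And>j. j < msize n \<Longrightarrow> lform q (monom 1 j) = lform E (monom 1 j)"
    using step[of "\<lambda>j. lform E (monom 1 j)"] by blast
  obtain p where p: "typeI_class n p" "\<And>j. j < msize n \<Longrightarrow> lform p (monom 1 j) = d j"
    using step[of d] by blast
  define Z where "Z = (\<lambda>i. E i - q i)"
  have lZ: "lform Z r = lform E r - lform q r" for r
    by (simp add: lform_def Z_def left_diff_distrib sum_subtractf)
  have cE: "coeff (E i) j = 0" if "(n + axis k 1) $ i \<le> j" for i j
    using that by (auto simp: E_def axis_def)
  have sub: "typeI_class (n + axis k 1) r" if "typeI_class n r" for r
    using that unfolding typeI_class_def by (auto simp: axis_def split: if_splits)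
  have Zc: "typeI_class (n + axis k 1) Z"
    using sub[OF q(1)] cE unfolding typeI_class_def Z_def by simp
  have "coeff (Z k) (n $ k) = 1" using q(1) by (simp add: Z_def E_def typeI_class_def)
  then have "Z \<noteq> (\<lambda>_. 0)" by (metis coeff_0 zero_neq_one)
  then have nz: "lform Z (monom 1 (msize n)) \<noteq> 0"
    using normalityI[OF Zc] q(2) unfolding lZ msize_add_axis less_Suc_eq by force
  define t where "t = (d (msize n) - lform p (monom 1 (msize n))) / lform Z (monom 1 (msize n))"
  define A where "A = (\<lambda>i. p i + smult t (Z i))"
  have lA: "lform A r = lform p r + t * lform Z r" for r
    by (simp add: lform_def A_def distrib_right sum.distrib sum_distrib_left)
  have "typeI_class (n + axis k 1) A"
    using sub[OF p(1)] Zc unfolding typeI_class_def A_def by simp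
  moreover have "lform A (monom 1 j) = d j" if "j < msize (n + axis k 1)" for j
    using that nz p(2) q(2) by (auto simp: lA lZ less_Suc_eq t_def)
  ultimately show ?case by blast
qed

text \<open>The type I polynomials in their usual normalization; \<open>n = 0\<close> gives the zero
  form.\<close>

definition Q :: "nat^2 \<Rightarrow> 2 \<Rightarrow> real poly" where
  "Q n = (SOME A. typeI_class n A \<and> (\<forall>j<msize n. lform A (monom 1 j) = (if Suc j = msize n then 1 else 0)))"

lemma Q_class: "typeI_class n (Q n)"
  and Q_moment: "j < msize n \<Longrightarrow> lform (Q n) (monom 1 j) = (if Suc j = msize n then 1 else 0)"
proof -
  have "typeI_class n (Q n) \<and> (\<forall>j<msize n. lform (Q n) (monom 1 j) = (if Suc j = msize n then 1 else 0))"
    unfolding Q_def by (rule someI_ex[OF surjI])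
  then show "typeI_class n (Q n)" "j < msize n \<Longrightarrow> lform (Q n) (monom 1 j) = (if Suc j = msize n then 1 else 0)"
    by auto
qed

text \<open>The normalization makes the form read off a single coefficient, the one of degree
  \<open>msize n - 1\<close>; most later pairings reduce to this.\<close>

lemma lform_Q:
  assumes "degree p < msize n \<or> (\<forall>i\<ge>msize n. coeff p i = 0)"
  shows "lform (Q n) p = (if msize n = 0 then 0 else coeff p (msize n - 1))"
proof -
  have "lform (Q n) p = (\<Sum>j<msize n. coeff p j * (if Suc j = msize n then 1 else 0))"
    by (subst lform_expand[OF assms]) (auto intro!: sum.cong simp: Q_moment)
  also have "\<dots> = (\<Sum>j<msize n. if j = msize n - 1 then coeff p j else 0)"
    by (intro sum.cong) auto
  finally show ?thesis by simp
qed

lemma J_expand: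
  assumes "\<And>i. N \<le> i \<Longrightarrow> coeff q i = 0"
  shows "J k (p * q) = (\<Sum>j<N. coeff q j * J k (p * monom 1 j))"
proof -
  have "q = (\<Sum>j<N. smult (coeff q j) (monom 1 j))" using assms by (intro poly_monom_sum) auto
  then have "p * q = (\<Sum>j<N. smult (coeff q j) (p * monom 1 j))"
    by (metis (no_types, lifting) mult_smult_right sum.cong sum_distrib_left)
  then show ?thesis by (simp add: J_sum)
qed

text \<open>Duality with type I: a form whose moments are the coefficients of \<open>p\<close> takes
  at \<open>p\<close> the value of their sum of squares, while orthogonality makes it zero.\<close>

lemma normalityII:
  assumes deg: "\<And>i. msize n \<le> i \<Longrightarrow> coeff p i = 0"
    and orth: "\<And>k m. m < n $ k \<Longrightarrow> J k (p * monom 1 m) = 0"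
  shows "p = 0"
proof -
  obtain A where A: "typeI_class n A" "\<And>j. j < msize n \<Longrightarrow> lform A (monom 1 j) = coeff p j"
    using surjI[of n "coeff p"] by blast
  have "lform A p = (\<Sum>j<msize n. coeff p j * coeff p j)"
    by (subst lform_expand[of p "msize n"]) (auto simp: deg A(2))
  moreover have "J k (A k * p) = 0" for k
    using A(1) orth by (subst mult.commute, subst J_expand[of "n $ k"]) (auto simp: typeI_class_def)
  ultimately have "(\<Sum>j<msize n. coeff p j * coeff p j) = 0" by (simp add: lform_def)
  then have "coeff p j = 0" if "j < msize n" for j using that by (subst (asm) sum_nonneg_eq_0_iff) auto
  then show ?thesis using deg by (intro poly_eqI) (metis coeff_0 not_less)
qed

text \<open>The same growth along the index as in \<open>surjI\<close>: \<open>Z\<close>, monic of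
  degree \<open>msize n\<close>, satisfies the old conditions homogeneously and so cannot satisfy
  the new one.\<close>

lemma surjII: "\<exists>p. (\<forall>i\<ge>msize n. coeff p i = 0) \<and> (\<forall>k. \<forall>m<n $ k. J k (p * monom 1 m) = d k m)"
proof (induction n arbitrary: d rule: multi_index_induct)
  case zero
  show ?case by (rule exI[of _ 0]) auto
next
  case (step n k)
  let ?x = "monom (1::real) (msize n)"
  obtain q where q: "\<And>i. i \<ge> msize n \<Longrightarrow> coeff q i = 0" "\<And>k m. m < n $ k \<Longrightarrow> J k (q * monom 1 m) = J k (?x * monom 1 m)"
    using step[of "\<lambda>k m. J k (?x * monom 1 m)"] by blast
  obtain p where p: "\<And>i. i \<ge> msize n \<Longrightarrow> coeff p i = 0" "\<And>k m. m < n $ k \<Longrightarrow> J k (p * monom 1 m) = d k m"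
    using step[of d] by blast
  define Z where "Z = ?x - q"
  have Z0: "J i (Z * monom 1 m) = 0" if "m < n $ i" for i m
    using q(2)[OF that] by (simp add: Z_def left_diff_distrib)
  have Zd: "coeff Z i = 0" if "i \<ge> msize (n + axis k 1)" for i using that q(1) by (simp add: Z_def)
  have "coeff Z (msize n) = 1" using q(1) by (simp add: Z_def)
  then have Zn: "Z \<noteq> 0" by auto
  have nz: "J k (Z * monom 1 (n $ k)) \<noteq> 0"
  proof
    assume "J k (Z * monom 1 (n $ k)) = 0"
    then have "J i (Z * monom 1 m) = 0" if "m < (n + axis k 1) $ i" for i m
      using that Z0 by (auto simp: less_add_axis)
    from normalityII[OF Zd this] Zn show False by blast
  qed
  define t where "t = (d k (n $ k) - J k (p * monom 1 (n $ k))) / J k (Z * monom 1 (n $ k))"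
  have "J i ((p + smult t Z) * monom 1 m) = d i m" if "m < (n + axis k 1) $ i" for i m
    using that nz Z0 p(2) by (auto simp: less_add_axis t_def distrib_right)
  moreover have "coeff (p + smult t Z) i = 0" if "i \<ge> msize (n + axis k 1)" for i
    using that p(1) Zd by simp
  ultimately show ?case by blast
qed

section \<open>Type II polynomials and their recurrence\<close>

lemma is_mop_iff: "is_mop \<mu> n p \<longleftrightarrow> lead_coeff p = 1 \<and> degree p = msize n \<and> (\<forall>k. \<forall>m<n $ k. J k (p * monom 1 m) = 0)"
proof -
  have "poly (p * monom 1 m) = (\<lambda>x. poly p x * x ^ m)" for m by (auto simp: poly_monom)
  then show ?thesis by (simp add: is_mop_def msize_def J_def)
qed

lemma ex1_mop: "\<exists>!p. is_mop \<mu> n p"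
proof -
  let ?x = "monom (1::real) (msize n)"
  obtain q where q: "\<And>i. i \<ge> msize n \<Longrightarrow> coeff q i = 0" "\<And>k m. m < n $ k \<Longrightarrow> J k (q * monom 1 m) = J k (?x * monom 1 m)"
    using surjII[of n "\<lambda>k m. J k (?x * monom 1 m)"] by blast
  have c1: "coeff (?x - q) (msize n) = 1" using q(1) by simp
  have "degree (?x - q) \<le> msize n" using q(1) by (intro degree_le) auto
  with c1 have "degree (?x - q) = msize n" by (intro antisym le_degree) auto
  with c1 have "is_mop \<mu> n (?x - q)" unfolding is_mop_iff using q(2) by (auto simp: left_diff_distrib)
  moreover have "p = p'" if "is_mop \<mu> n p" "is_mop \<mu> n p'" for p p'
  proof -
    have "p - p' = 0"
    proof (rule normalityII[of n])
      show "coeff (p - p') i = 0" if "msize n \<le> i" for i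
        using \<open>is_mop \<mu> n p\<close> \<open>is_mop \<mu> n p'\<close> that
        by (cases "i = msize n") (auto simp: is_mop_iff coeff_eq_0)
    qed (use that in \<open>auto simp: is_mop_iff left_diff_distrib\<close>)
    then show ?thesis by simp
  qed
  ultimately show ?thesis by blast
qed

abbreviation P :: "nat^2 \<Rightarrow> real poly" where "P n \<equiv> mop \<mu> n"

lemma P_mop: "is_mop \<mu> n (P n)"
  unfolding mop_def by (rule theI'[OF ex1_mop])

lemma P_degree [simp]: "degree (P n) = msize n" and P_coeff [simp]: "coeff (P n) (msize n) = 1"
  and P_orth: "m < n $ k \<Longrightarrow> J k (P n * monom 1 m) = 0"
  using P_mop[of n] by (auto simp: is_mop_iff)

lemma P_nonzero [simp]: "P n \<noteq> 0" by (metis P_coeff coeff_0 zero_neq_one)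

lemma P_diff_coeff:
  assumes "n $ j \<noteq> 0" "msize n \<le> l"
  shows "coeff (P (n - axis j 1)) l = 0"
proof -
  have "msize n > 0" using msize_add_axis[of "n - axis j 1" j] diff_axis_add_axis[OF assms(1)] by simp
  then show ?thesis using assms by (intro coeff_eq_0) (simp add: msize_diff_axis)
qed

text \<open>The first integral of \<open>P n\<close> against a power that orthogonality does not
  make zero; it takes the place of the squared norm of a classical orthogonal polynomial.\<close>

definition h :: "nat^2 \<Rightarrow> 2 \<Rightarrow> real" where "h n k = J k (P n * monom 1 (n $ k))"

lemma J_P:
  assumes "\<And>i. n $ k < i \<Longrightarrow> coeff q i = 0"
  shows "J k (P n * q) = coeff q (n $ k) * h n k"
  using assms by (subst J_expand[of "Suc (n $ k)"]) (auto simp: P_orth h_def)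

lemma h_nonzero: "h n k \<noteq> 0"
proof
  assume "h n k = 0"
  then have "J i (P n * monom 1 m) = 0" if "m < (n + axis k 1) $ i" for i m
    using that P_orth by (auto simp: less_add_axis h_def)
  then have "P n = 0" by (intro normalityII[of "n + axis k 1"]) (auto simp: coeff_eq_0)
  then show False by simp
qed

definition a :: "nat^2 \<Rightarrow> 2 \<Rightarrow> real" where "a n j = (if n $ j = 0 then 0 else h n j / h (n - axis j 1) j)"

definition b :: "nat^2 \<Rightarrow> 2 \<Rightarrow> real" where "b n i = coeff ([:0, 1:] * P n - P (n + axis i 1)) (msize n)"

lemma J_P_lower:
  assumes "m < n $ k" "n $ j \<noteq> 0"
  shows "J k (P (n - axis j 1) * monom 1 m) = (if j = k \<and> Suc m = n $ k then h (n - axis k 1) k else 0)"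
proof (cases "j = k \<and> Suc m = n $ k")
  case True
  then have "m = (n - axis k 1) $ k" by (auto simp: axis_def)
  then show ?thesis using True by (simp add: h_def)
next
  case False
  then have "m < (n - axis j 1) $ k" using assms by (auto simp: axis_def)
  then show ?thesis using False by (auto simp: P_orth)
qed

lemma x_monom: "[:0, 1:] * p * monom 1 m = p * monom (1::real) (Suc m)"
  by (simp add: monom_Suc mult.commute)

text \<open>The defect \<open>D\<close> has degree below \<open>msize n\<close>, since
  \<open>b\<close> was chosen to remove the power \<open>msize n\<close>. It also meets all
  orthogonality conditions of index \<open>n\<close>, where the ratio \<open>a\<close> takes care of
  the last power \<open>x^(n_k - 1)\<close>; normality makes it zero.\<close>

lemma recurrence_a_b: "recurrence_coeffs \<mu> a b"
  unfolding recurrence_coeffs_def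
proof (intro conjI allI impI)
  fix n :: "nat^2" and i :: 2
  define S where "S = (\<Sum>j\<in>UNIV. if n $ j = 0 then 0 else smult (a n j) (P (n - axis j 1)))"
  have cS: "coeff S l = 0" if "msize n \<le> l" for l
    unfolding S_def using that
    by (auto simp: coeff_sum P_diff_coeff intro!: sum.neutral)
  define D where "D = [:0, 1:] * P n - P (n + axis i 1) - smult (b n i) (P n) - S"
  have "D = 0"
  proof (rule normalityII[of n])
    fix l assume l: "msize n \<le> l"
    consider "l = msize n" | "l = Suc (msize n)" | "l > Suc (msize n)" using l by linarith
    then show "coeff D l = 0"
    proof cases
      case 1
      then show ?thesis using cS[of l] by (simp add: D_def b_def)
    next
      case 2
      have "coeff (P (n + axis i 1)) (Suc (msize n)) = 1" using P_coeff[of "n + axis i 1"] by simp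
      then show ?thesis using cS[of l] 2 by (simp add: D_def coeff_eq_0)
    next
      case 3
      then show ?thesis using cS[of l] by (cases l) (auto simp: D_def coeff_eq_0)
    qed
  next
    fix k m assume m: "m < n $ k"
    have m': "m < (n + axis i 1) $ k" using m by (simp add: axis_def)
    have "J k (S * monom 1 m) = (\<Sum>j\<in>UNIV. if n $ j = 0 then 0 else a n j * J k (P (n - axis j 1) * monom 1 m))"
      unfolding S_def sum_distrib_right J_sum by (intro sum.cong) auto
    also have "\<dots> = (\<Sum>j\<in>UNIV. if j = k then (if Suc m = n $ k then h n k else 0) else 0)"
      using m h_nonzero by (intro sum.cong) (auto simp: J_P_lower a_def)
    finally have JS: "J k (S * monom 1 m) = (if Suc m = n $ k then h n k else 0)" by simp
    have "J k (P n * monom 1 (Suc m)) = (if Suc m = n $ k then h n k else 0)"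
      using m by (auto simp: h_def P_orth)
    then show "J k (D * monom 1 m) = 0"
      unfolding D_def left_diff_distrib x_monom J_diff JS mult_smult_left J_smult P_orth[OF m] P_orth[OF m'] by simp
  qed
  then show "[:0, 1:] * P n = P (n + axis i 1) + smult (b n i) (P n) + S"
    unfolding D_def by (simp add: algebra_simps)
qed (simp add: a_def)

text \<open>The coefficient of degree \<open>msize n\<close> isolates \<open>b'\<close>, and pairing
  with \<open>x^(n_k - 1)\<close> isolates the neighbour \<open>n - e_k\<close>; for
  \<open>n $ k = 0\<close> the convention \<open>a' n k = 0\<close> decides.\<close>

lemma recurrence_unique:
  assumes "recurrence_coeffs \<mu> a' b'"
  shows "a' = a" "b' = b"
proof -
  have eq: "[:0, 1:] * P n = P (n + axis i 1) + smult (b' n i) (P n) +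
        (\<Sum>j\<in>UNIV. if n $ j = 0 then 0 else smult (a' n j) (P (n - axis j 1)))" for n i
    using assms by (simp add: recurrence_coeffs_def)
  have "b' n i = b n i" for n i
  proof -
    have "coeff ([:0, 1:] * P n) (msize n) = coeff (P (n + axis i 1)) (msize n) + b' n i +
        (\<Sum>j\<in>UNIV. coeff (if n $ j = 0 then 0 else smult (a' n j) (P (n - axis j 1))) (msize n))"
      unfolding eq[of n i] by (simp add: coeff_sum)
    also have "(\<Sum>j\<in>UNIV. coeff (if n $ j = 0 then 0 else smult (a' n j) (P (n - axis j 1))) (msize n)) = 0"
      by (intro sum.neutral) (auto simp: P_diff_coeff)
    finally show ?thesis unfolding b_def coeff_diff by simp
  qed
  then show "b' = b" by auto
  have "a' n k = a n k" for n k
  proof (cases "n $ k = 0")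
    case True
    then show ?thesis using assms by (simp add: recurrence_coeffs_def a_def)
  next
    case False
    define m where "m = n $ k - 1"
    have m: "m < n $ k" "Suc m = n $ k" using False by (auto simp: m_def)
    have m': "m < (n + axis k 1) $ k" using m by (simp add: axis_def)
    have "h n k = J k ([:0, 1:] * P n * monom 1 m)" unfolding x_monom h_def m(2) ..
    also have "\<dots> = (\<Sum>j\<in>UNIV. if n $ j = 0 then 0 else a' n j * J k (P (n - axis j 1) * monom 1 m))"
      unfolding eq[of n k] distrib_right J_add sum_distrib_right J_sum mult_smult_left J_smult P_orth[OF m(1)] P_orth[OF m']
      by (simp add: if_distrib[of "\<lambda>p. p * _"] if_distrib[of "J k"] cong: if_cong)
    also have "\<dots> = (\<Sum>j\<in>UNIV. if j = k then a' n k * h (n - axis k 1) k else 0)"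
      using m False by (intro sum.cong) (auto simp: J_P_lower)
    finally show ?thesis using False h_nonzero[of "n - axis k 1" k] by (simp add: a_def)
  qed
  then show "a' = a" by auto
qed

lemma rec_eq: "rec_a \<mu> = a" "rec_b \<mu> = b"
proof -
  have "(THE ab. recurrence_coeffs \<mu> (fst ab) (snd ab)) = (a, b)"
  proof (rule the_equality)
    show "ab = (a, b)" if "recurrence_coeffs \<mu> (fst ab) (snd ab)" for ab
      using recurrence_unique[OF that] by (simp add: prod_eq_iff)
  qed (simp add: recurrence_a_b)
  then show "rec_a \<mu> = a" "rec_b \<mu> = b" by (simp_all add: rec_a_def rec_b_def)
qed

lemma J_square_nonzero:
  assumes "V \<noteq> 0" "\<And>x. x \<in> I k \<Longrightarrow> poly W x \<noteq> 0"
  shows "J k (V * W * V) \<noteq> 0"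
proof -
  obtain s where s: "s = 1 \<or> s = (-1::real)" "\<And>x. x \<in> I k \<Longrightarrow> s * poly W x > 0"
    using poly_no_root_sign[of "\<alpha> k" "\<beta> k" W] assms(2) by metis
  have "W \<noteq> 0" using assms(2)[of "\<alpha> k"] interval[of k] by auto
  have "integral\<^sup>L (\<mu> k) (poly (smult s (V * W * V))) > 0"
  proof (rule integral_poly_pos)
    show "smult s (V * W * V) \<noteq> 0" using assms(1) \<open>W \<noteq> 0\<close> s(1) by auto
    fix x assume x: "x \<in> I k"
    have e: "poly (smult s (V * W * V)) x = (poly V x)\<^sup>2 * (s * poly W x)" by (simp add: power2_eq_square)
    show "0 \<le> poly (smult s (V * W * V)) x"
      unfolding e by (rule mult_nonneg_nonneg[OF zero_le_power2 less_imp_le[OF s(2)[OF x]]])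
  qed
  then show ?thesis using J_smult[of k s "V * W * V"] by (auto simp: J_def)
qed

text \<open>If fewer than \<open>n $ k\<close> roots lay in \<open>I k\<close>, the product
  \<open>V\<close> of their factors would be an admissible test polynomial, yet
  \<open>P n * V\<close> is a square times a factor without sign change there. Both intervals
  together then use up the whole degree.\<close>

lemma P_split:
  obtains V where "P n = V 1 * V 2" "\<And>k. lead_coeff (V k) = 1" "\<And>k. degree (V k) = n $ k"
    "\<And>k x. poly (V k) x = 0 \<Longrightarrow> x \<in> I k"
proof -
  obtain V1 W1 where 1: "P n = V1 * W1" "lead_coeff V1 = 1" "\<And>x. poly V1 x = 0 \<Longrightarrow> x \<in> I 1"
    "\<And>x. x \<in> I 1 \<Longrightarrow> poly W1 x \<noteq> 0" "degree (P n) = degree V1 + degree W1"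
    using poly_split_roots[of "P n" "I 1"] by auto
  have "W1 \<noteq> 0" using 1(1) P_nonzero[of n] by auto
  then obtain V2 W2 where 2: "W1 = V2 * W2" "lead_coeff V2 = 1" "\<And>x. poly V2 x = 0 \<Longrightarrow> x \<in> I 2"
    "\<And>x. x \<in> I 2 \<Longrightarrow> poly W2 x \<noteq> 0" "degree W1 = degree V2 + degree W2"
    using poly_split_roots[of W1 "I 2"] by metis
  have orth: "\<not> degree V < n $ k" if "P n = V * W" "V \<noteq> 0" "\<And>x. x \<in> I k \<Longrightarrow> poly W x \<noteq> 0" for V W k
  proof
    assume "degree V < n $ k"
    then have "J k (P n * V) = 0" by (subst J_P) (auto simp: coeff_eq_0)
    then show False using J_square_nonzero[OF that(2,3)] that(1) by simp
  qed
  have V0: "V1 \<noteq> 0" "V2 \<noteq> 0" using 1(2) 2(2) by auto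
  have d1: "n $ 1 \<le> degree V1" using orth[of V1 W1 1, OF 1(1) V0(1) 1(4)] by (simp only: not_less)
  have "P n = V2 * (V1 * W2)" unfolding 1(1) 2(1) by (simp add: mult_ac)
  moreover have "poly (V1 * W2) x \<noteq> 0" if "x \<in> I 2" for x
    using 2(4)[OF that] 1(3)[of x] I_disjoint[of 1 2] that by auto
  ultimately have d2: "n $ 2 \<le> degree V2" using orth[of V2 "V1 * W2" 2] V0(2) by auto
  have d: "degree V1 = n $ 1" "degree V2 = n $ 2" "degree W2 = 0"
    using d1 d2 1(5) 2(5) by (auto simp: msize_def)
  have "lead_coeff (P n) = lead_coeff W2"
    unfolding 1(1) 2(1) lead_coeff_mult 1(2) 2(2) by simp
  then have "lead_coeff W2 = 1" by simp
  then have "W2 = 1" using d(3) by (metis degree_0_id one_pCons)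
  then have "P n = (if (1::2) = 1 then V1 else V2) * (if (2::2) = 1 then V1 else V2)"
    using 1(1) 2(1) by simp
  then show ?thesis
    by (rule that[of "\<lambda>k. if k = 1 then V1 else V2"]) (use 1 2 d exhaust_2 in \<open>auto split: if_splits\<close>, metis+)
qed

text \<open>By orthogonality \<open>h n k\<close> is the integral of \<open>V j * (V k)^2\<close>
  over \<open>I k\<close>, so its sign is that of a monic polynomial of degree \<open>n $ j\<close>
  with all its roots on one side of \<open>I k\<close>.\<close>

lemma h_sign:
  assumes "j \<noteq> k"
  shows "\<exists>\<sigma>::real. (\<sigma> = 1 \<or> \<sigma> = -1) \<and> (\<forall>n. \<sigma> ^ (n $ j) * h n k > 0)"
proof -
  define \<sigma> where "\<sigma> = (if \<beta> j < \<alpha> k then 1 else (-1::real))"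
  have sep: "\<beta> k < \<alpha> j \<or> \<beta> j < \<alpha> k"
  proof (rule ccontr)
    assume "\<not> ?thesis"
    then have "max (\<alpha> k) (\<alpha> j) \<in> I j \<inter> I k" using interval[of k] interval[of j] by auto
    then show False using I_disjoint[OF assms] by auto
  qed
  have "\<sigma> ^ (n $ j) * h n k > 0" for n
  proof -
    obtain V where V: "P n = V 1 * V 2" "\<And>k. lead_coeff (V k) = 1" "\<And>k. degree (V k) = n $ k"
      "\<And>k x. poly (V k) x = 0 \<Longrightarrow> x \<in> I k" by (rule P_split[of n]) blast
    have Pjk: "P n = V j * V k" using V(1) assms exhaust_2[of j] exhaust_2[of k] by (auto simp: mult.commute)
    have s: "\<sigma> ^ (n $ j) * poly (V j) x > 0" if "x \<in> I k" for x
    proof (cases "\<beta> j < \<alpha> k")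
      case True
      then show ?thesis using that V(4)[of j] poly_roots_left_pos[OF V(2)[of j], of "\<beta> j" x]
        by (auto simp: \<sigma>_def)
    next
      case False
      then show ?thesis using sep that V(4)[of j] poly_roots_right_sign[OF V(2)[of j], of "\<alpha> j" x]
        by (auto simp: \<sigma>_def V(3))
    qed
    have "h n k = J k (P n * V k)"
      using V(2)[of k] V(3)[of k] by (subst J_P) (auto simp: coeff_eq_0)
    also have "\<sigma> ^ (n $ j) * \<dots> = integral\<^sup>L (\<mu> k) (poly (smult (\<sigma> ^ (n $ j)) (V j * V k * V k)))"
      unfolding Pjk J_smult[symmetric] by (simp add: J_def)
    also have "\<dots> > 0"
    proof (rule integral_poly_pos)
      have "V i \<noteq> 0" for i using V(2)[of i] by auto
      then show "smult (\<sigma> ^ (n $ j)) (V j * V k * V k) \<noteq> 0" by (auto simp: \<sigma>_def)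
      fix x assume x: "x \<in> I k"
      have e: "poly (smult (\<sigma> ^ (n $ j)) (V j * V k * V k)) x = (poly (V k) x)\<^sup>2 * (\<sigma> ^ (n $ j) * poly (V j) x)"
        by (simp add: power2_eq_square)
      show "0 \<le> poly (smult (\<sigma> ^ (n $ j)) (V j * V k * V k)) x"
        unfolding e by (rule mult_nonneg_nonneg[OF zero_le_power2 less_imp_le[OF s[OF x]]])
    qed
    finally show ?thesis .
  qed
  moreover have "\<sigma> = 1 \<or> \<sigma> = -1" by (auto simp: \<sigma>_def)
  ultimately show ?thesis by blast
qed

text \<open>The indices \<open>n\<close> and \<open>n - e_k\<close> share the entry
  \<open>n $ j\<close> that fixes the sign of \<open>h\<close>.\<close>

lemma a_pos: "n $ k \<noteq> 0 \<Longrightarrow> a n k > 0"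
proof -
  assume n: "n $ k \<noteq> 0"
  obtain j where j: "j \<noteq> k" by (metis zero_neq_one)
  obtain \<sigma> where \<sigma>: "\<And>n. \<sigma> ^ (n $ j) * h n k > (0::real)" using h_sign[OF j] by blast
  have "(n - axis k 1) $ j = n $ j" using j by (simp add: axis_def)
  then have "(\<sigma> ^ (n $ j) * h n k) / (\<sigma> ^ (n $ j) * h (n - axis k 1) k) > 0"
    using \<sigma>[of n] \<sigma>[of "n - axis k 1"] by (metis divide_pos_pos)
  then show ?thesis using n by (auto simp: a_def split: if_splits)
qed

text \<open>The pairing of \<open>Q n\<close> with \<open>P (n - e_j)\<close> is evaluated twice: as
  a leading coefficient it is 1, and componentwise only the \<open>j\<close>-th integral
  survives.\<close>

lemma Q_lead:
  assumes "n $ j \<noteq> 0"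
  shows "coeff (Q n j) (n $ j - 1) * h (n - axis j 1) j = 1"
proof -
  let ?m = "n - axis j 1"
  have N: "msize n > 0" using assms msize_add_axis[of ?m j] diff_axis_add_axis[OF assms] by simp
  have "lform (Q n) (P ?m) = coeff (P ?m) (msize ?m)"
    using N assms by (subst lform_Q) (auto simp: msize_diff_axis)
  then have "1 = lform (Q n) (P ?m)" by simp
  also have "\<dots> = (\<Sum>k\<in>UNIV. J k (P ?m * Q n k))" by (simp add: lform_def mult.commute)
  also have "\<dots> = (\<Sum>k\<in>UNIV. if k = j then coeff (Q n j) (n $ j - 1) * h ?m j else 0)"
  proof (rule sum.cong[OF refl])
    fix k
    have c: "coeff (Q n k) i = 0" if "n $ k \<le> i" for i k using Q_class[of n] that by (simp add: typeI_class_def)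
    show "J k (P ?m * Q n k) = (if k = j then coeff (Q n j) (n $ j - 1) * h ?m j else 0)"
      using assms by (subst J_P) (auto simp: axis_def intro!: c split: if_splits)
  qed
  finally show ?thesis by simp
qed

section \<open>Recurrence of the type I forms\<close>

lemma lform_diff_left: "lform (\<lambda>k. A k - B k) p = lform A p - lform B p"
  by (simp add: lform_def left_diff_distrib sum_subtractf)
lemma lform_smult_left: "lform (\<lambda>k. smult r (A k)) p = r * lform A p"
  by (simp add: lform_def sum_distrib_left)
lemma lform_sum_left: "lform (\<lambda>k. \<Sum>j\<in>S. A j k) p = (\<Sum>j\<in>S. lform (A j) p)"
  unfolding lform_def sum_distrib_right J_sum by (rule sum.swap)
lemma lform_x_left: "lform (\<lambda>k. [:0, 1:] * A k) p = lform A ([:0, 1:] * p)"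
  by (simp add: lform_def mult_ac)

lemma lform_Q_P:
  assumes "\<And>k. n $ k \<le> m $ k"
  shows "lform (Q n) (P m) = 0"
proof -
  have c: "coeff (Q n k) i = 0" if "m $ k \<le> i" for k i
    using Q_class[of n] assms[of k] that unfolding typeI_class_def by (meson order_trans)
  have "J k (P m * Q n k) = 0" for k
    by (subst J_P) (auto simp: c)
  then show ?thesis by (simp add: lform_def mult.commute)
qed

text \<open>The defect \<open>D\<close> stays in the class of \<open>n\<close>, because at
  \<open>x^(n_k)\<close> the leading coefficients of \<open>x Q n k\<close> and
  \<open>Q (n + e_k) k\<close> cancel by the choice of \<open>a\<close>. Its moments below
  \<open>msize n - 1\<close> vanish by normalization. The last one vanishes because \<open>D\<close>
  annihilates the monic \<open>P (n - e_i)\<close>, by the type II recurrence. Normality then gives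
  zero.\<close>

lemma typeI_recurrence:
  assumes n: "\<And>k. n $ k \<noteq> 0"
  shows "[:0, 1:] * Q n k = Q (n - axis i 1) k + smult (b (n - axis i 1) i) (Q n k) + (\<Sum>j\<in>UNIV. smult (a n j) (Q (n + axis j 1) k))"
proof -
  let ?m = "n - axis i 1"
  define D where "D = (\<lambda>k. [:0, 1:] * Q n k - Q ?m k - smult (b ?m i) (Q n k) - (\<Sum>j\<in>UNIV. smult (a n j) (Q (n + axis j 1) k)))"
  have lD: "lform D p = lform (Q n) ([:0, 1:] * p) - lform (Q ?m) p - b ?m i * lform (Q n) p - (\<Sum>j\<in>UNIV. a n j * lform (Q (n + axis j 1)) p)" for p
    unfolding D_def lform_diff_left lform_smult_left lform_sum_left lform_x_left ..
  obtain N where N: "msize n = Suc (Suc N)"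
    using n[of 1] n[of 2] by (cases "n $ 1"; cases "n $ 2") (auto simp: msize_def)
  have Nm: "msize ?m = Suc N" using msize_diff_axis[OF n[of i]] N by simp
  have mi: "?m + axis i 1 = n" by (rule diff_axis_add_axis[OF n])
  have low: "lform D (monom 1 l) = 0" if "l < Suc N" for l
  proof -
    have "lform (Q n) ([:0, 1:] * monom 1 l) = (if l = N then 1 else 0)"
      using that N Q_moment[of "Suc l" n] by (simp flip: monom_Suc)
    moreover have "lform (Q ?m) (monom 1 l) = (if l = N then 1 else 0)"
      using that Nm Q_moment[of l ?m] by simp
    moreover have "lform (Q n) (monom 1 l) = 0" using that N Q_moment[of l n] by simp
    moreover have "lform (Q (n + axis j 1)) (monom 1 l) = 0" for j
      using that N Q_moment[of l "n + axis j 1"] by simp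
    ultimately show ?thesis unfolding lD by simp
  qed
  have "lform D (P ?m) = 0"
  proof -
    have 1: "lform (Q n) (P ?m) = 1"
      using N Nm P_coeff[of ?m] by (subst lform_Q) auto
    have "lform (Q n) ([:0, 1:] * P ?m) = lform (Q n) (P n) + b ?m i * lform (Q n) (P ?m) +
       (\<Sum>j\<in>UNIV. if ?m $ j = 0 then 0 else a ?m j * lform (Q n) (P (?m - axis j 1)))"
    proof -
      have e: "[:0, 1:] * P ?m = P n + smult (b ?m i) (P ?m) + (\<Sum>j\<in>UNIV. if ?m $ j = 0 then 0 else smult (a ?m j) (P (?m - axis j 1)))"
        using recurrence_a_b[unfolded recurrence_coeffs_def, THEN conjunct1, rule_format, of ?m i] unfolding mi .
      show ?thesis unfolding e lform_add lform_sum lform_smult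
        by (simp add: if_distrib[of "lform _"] cong: if_cong)
    qed
    also have "lform (Q n) (P n) = 0" by (rule lform_Q_P) simp
    also have "(\<Sum>j\<in>UNIV. if ?m $ j = 0 then 0 else a ?m j * lform (Q n) (P (?m - axis j 1))) = 0"
    proof (intro sum.neutral ballI)
      fix j
      have "lform (Q n) (P (?m - axis j 1)) = 0" if "?m $ j \<noteq> 0"
        using N Nm msize_diff_axis[OF that] by (subst lform_Q) (auto simp: coeff_eq_0)
      then show "(if ?m $ j = 0 then 0 else a ?m j * lform (Q n) (P (?m - axis j 1))) = 0" by simp
    qed
    finally have 2: "lform (Q n) ([:0, 1:] * P ?m) = b ?m i" using 1 by simp
    have 3: "lform (Q ?m) (P ?m) = 0" by (rule lform_Q_P) simp
    have 4: "lform (Q (n + axis j 1)) (P ?m) = 0" for j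
      using N Nm by (subst lform_Q) (auto simp: coeff_eq_0)
    show ?thesis unfolding lD 1 2 3 4 by simp
  qed
  moreover have "lform D (P ?m) = (\<Sum>l<Suc (Suc N). coeff (P ?m) l * lform D (monom 1 l))"
    by (rule lform_expand) (use Nm in auto)
  moreover have "coeff (P ?m) (Suc N) = 1" using P_coeff[of ?m] Nm by simp
  ultimately have top: "lform D (monom 1 (Suc N)) = 0" using low by simp
  have "typeI_class n D"
    unfolding typeI_class_def
  proof (intro allI impI)
    fix k l assume l: "n $ k \<le> l"
    have cQ: "coeff (Q p k) l' = 0" if "p $ k \<le> l'" for p l' using Q_class[of p] that by (simp add: typeI_class_def)
    have c1: "coeff (Q ?m k) l = 0" using l by (intro cQ) (auto simp: axis_def)
    have c2: "coeff (Q n k) l = 0" using l by (intro cQ)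
    have c3: "coeff (Q (n + axis j 1) k) l = 0" if "j \<noteq> k \<or> l \<noteq> n $ k" for j
      using that l by (intro cQ) (auto simp: axis_def)
    have "(\<Sum>j\<in>UNIV. a n j * coeff (Q (n + axis j 1) k) l) = (\<Sum>j\<in>UNIV. if j = k then a n k * coeff (Q (n + axis k 1) k) l else 0)"
      using c3 by (intro sum.cong) auto
    then have s: "(\<Sum>j\<in>UNIV. a n j * coeff (Q (n + axis j 1) k) l) = a n k * coeff (Q (n + axis k 1) k) l" by simp
    have "coeff ([:0, 1:] * Q n k) l = a n k * coeff (Q (n + axis k 1) k) l"
    proof (cases "l = n $ k")
      case True
      have "coeff (Q n k) (n $ k - 1) * h (n - axis k 1) k = 1" by (rule Q_lead[OF n])
      moreover have "coeff (Q (n + axis k 1) k) (n $ k) * h n k = 1"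
        using Q_lead[of "n + axis k 1" k] by (simp add: axis_def)
      moreover have "coeff ([:0, 1:] * Q n k) l = coeff (Q n k) (n $ k - 1)"
        unfolding True using n[of k] by (cases "n $ k") simp_all
      ultimately show ?thesis using True n[of k] h_nonzero[of n k] h_nonzero[of "n - axis k 1" k]
        by (auto simp: a_def field_simps)
    next
      case False
      then have "coeff ([:0, 1:] * Q n k) l = 0" using l by (cases l) (auto intro!: cQ)
      then show ?thesis using c3[of k] False by simp
    qed
    then show "coeff (D k) l = 0"
      unfolding D_def by (simp only: coeff_diff coeff_smult coeff_sum c1 c2 s diff_zero mult_zero_right diff_self)
  qed
  then have "D = (\<lambda>_. 0)" using low top N by (intro normalityI[of n]) (auto simp: less_Suc_eq)
  then have "D k = 0" by simp
  then show ?thesis unfolding D_def by (simp add: algebra_simps)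
qed

end

section \<open>Functions of the second kind\<close>

lemma ctrans_of_real: "ctrans M f (of_real x) = of_real (\<integral>t. f t / (x - t) \<partial>M)"
  unfolding ctrans_def by (simp flip: of_real_diff of_real_divide)

lemma Im_ctrans:
  fixes M :: "real measure"
  assumes "finite_measure M" "sets M = sets borel" "e > 0"
    "f \<in> borel_measurable borel" "AE t in M. \<bar>f t\<bar> \<le> B"
  shows "Im (ctrans M f (Complex x e)) = - (\<integral>t. f t * (e / ((x - t)\<^sup>2 + e\<^sup>2)) \<partial>M)"
proof -
  have "cauchy_density M f (max B 0) UNIV"
    unfolding cauchy_density_def cauchy_density_axioms_def using assms by (auto elim!: eventually_mono)
  then interpret cauchy_density M f "max B 0" UNIV .
  have sep: "e \<le> cmod (Complex x e - of_real t)" for t using upper_half_sep[of "Complex x e" t] assms(3) by simp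
  have "integrable M (\<lambda>t. complex_of_real (f t) / (Complex x e - of_real t))"
    by (rule integrand_integrable[OF assms(3)]) (rule sep)
  then have "Im (ctrans M f (Complex x e)) = (\<integral>t. Im (complex_of_real (f t) / (Complex x e - of_real t)) \<partial>M)"
    unfolding ctrans_def by simp
  also have "\<dots> = (\<integral>t. - (f t * (e / ((x - t)\<^sup>2 + e\<^sup>2))) \<partial>M)"
    by (rule Bochner_Integration.integral_cong) (auto simp: Im_divide)
  finally show ?thesis by simp
qed

lemma pois_eq_Im_ctrans:
  assumes "finite_measure M" "sets M = sets borel" "e > 0"
  shows "pois M x e = - Im (ctrans M (\<lambda>_. 1) (Complex x e))"
  using Im_ctrans[OF assms, of "\<lambda>_. 1" 1 x] by (simp add: pois_def)

lemma abs_Im_ctrans_le: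
  fixes M :: "real measure"
  assumes "finite_measure M" "sets M = sets borel" "e > 0"
    "f \<in> borel_measurable borel" "AE t in M. \<bar>f t\<bar> \<le> B"
  shows "\<bar>Im (ctrans M f (Complex x e))\<bar> \<le> B * pois M x e"
proof -
  have i: "integrable M (\<lambda>t. B * (e / ((x - t)\<^sup>2 + e\<^sup>2)))"
    by (intro integrable_mult_right pois_integrable assms)
  have m: "(\<lambda>t. f t * (e / ((x - t)\<^sup>2 + e\<^sup>2))) \<in> borel_measurable M"
  proof -
    note [measurable] = assms(4)
    have "(\<lambda>t. f t * (e / ((x - t)\<^sup>2 + e\<^sup>2))) \<in> borel_measurable borel" by measurable
    then show ?thesis using measurable_cong_sets[OF assms(2) refl] by blast
  qed
  have ae: "AE t in M. norm (f t * (e / ((x - t)\<^sup>2 + e\<^sup>2))) \<le> B * (e / ((x - t)\<^sup>2 + e\<^sup>2))"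
    using assms(5)
  proof (rule AE_mp, intro AE_I2 impI)
    fix t assume "\<bar>f t\<bar> \<le> B"
    then show "norm (f t * (e / ((x - t)\<^sup>2 + e\<^sup>2))) \<le> B * (e / ((x - t)\<^sup>2 + e\<^sup>2))"
      unfolding real_norm_def abs_mult abs_of_nonneg[OF poisson_kernel_nonneg[OF assms(3)]]
      by (rule mult_right_mono[OF _ poisson_kernel_nonneg[OF assms(3)]])
  qed
  have ii: "integrable M (\<lambda>t. f t * (e / ((x - t)\<^sup>2 + e\<^sup>2)))"
    by (rule Bochner_Integration.integrable_bound[OF i m], rule AE_mp[OF ae], rule AE_I2, rule impI)
      (unfold real_norm_def, rule order_trans[OF _ abs_ge_self])
  have "\<bar>Im (ctrans M f (Complex x e))\<bar> = \<bar>\<integral>t. f t * (e / ((x - t)\<^sup>2 + e\<^sup>2)) \<partial>M\<bar>"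
    unfolding Im_ctrans[OF assms] by simp
  also have "\<dots> \<le> (\<integral>t. \<bar>f t * (e / ((x - t)\<^sup>2 + e\<^sup>2))\<bar> \<partial>M)" by (rule integral_abs_bound)
  also have "\<dots> \<le> (\<integral>t. B * (e / ((x - t)\<^sup>2 + e\<^sup>2)) \<partial>M)"
    by (rule integral_mono_AE[OF integrable_abs[OF ii] i ae[unfolded real_norm_def]])
  also have "\<dots> = B * pois M x e" unfolding pois_def by (rule integral_mult_right_zero)
  finally show ?thesis .
qed

lemma poly_lipschitz:
  fixes p :: "real poly"
  obtains C where "C \<ge> 0" "\<And>x t. \<bar>x\<bar> \<le> R \<Longrightarrow> \<bar>t\<bar> \<le> R \<Longrightarrow> \<bar>poly p x - poly p t\<bar> \<le> C * \<bar>x - t\<bar>"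
proof -
  have "bounded (poly (pderiv p) ` {-R..R})"
    by (intro compact_imp_bounded compact_continuous_image continuous_intros) auto
  then obtain B where B: "\<And>x. x \<in> {-R..R} \<Longrightarrow> norm (poly (pderiv p) x) \<le> B" unfolding bounded_iff by blast
  have "norm (poly p x - poly p t) \<le> max B 0 * norm (x - t)" if "\<bar>x\<bar> \<le> R" "\<bar>t\<bar> \<le> R" for x t
  proof (rule field_differentiable_bound[where S="{-R..R}" and f'="poly (pderiv p)"])
    show "(poly p has_field_derivative poly (pderiv p) z) (at z within {-R..R})" for z
      by (rule DERIV_subset[OF poly_DERIV]) auto
    show "norm (poly (pderiv p) z) \<le> max B 0" if "z \<in> {-R..R}" for z using B[OF that] by simp
  qed (use that in auto)
  then show ?thesis using that[of "max B 0"] by auto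
qed

context angelesco_system
begin

definition L :: "nat^2 \<Rightarrow> complex \<Rightarrow> complex" where
  "L n z = (\<Sum>k\<in>UNIV. ctrans (\<mu> k) (poly (Q n k)) z)"

lemma poly_density: obtains B where "B > 0" "cauchy_density (\<mu> k) (poly p) B (I k)" "AE t in \<mu> k. \<bar>poly p t\<bar> \<le> B"
  "\<And>t. t \<in> I k \<Longrightarrow> \<bar>poly p t\<bar> \<le> B"
proof -
  have "bounded (poly p ` I k)"
    by (intro compact_imp_bounded compact_continuous_image continuous_intros) auto
  then obtain B where B: "\<And>x. x \<in> I k \<Longrightarrow> norm (poly p x) \<le> B" unfolding bounded_iff by blast
  have ae: "AE t in \<mu> k. t \<in> I k \<and> \<bar>poly p t\<bar> \<le> max B 1"
    using supp[of k] by (rule AE_mp) (use B in \<open>fastforce intro!: AE_I2 simp: le_max_iff_disj\<close>)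
  then have "cauchy_density (\<mu> k) (poly p) (max B 1) (I k)"
    unfolding cauchy_density_def cauchy_density_axioms_def using fin_meas sets_eq by (auto simp: borel_measurable_poly)
  moreover have "AE t in \<mu> k. \<bar>poly p t\<bar> \<le> max B 1" using ae by (auto elim!: eventually_mono)
  moreover have "\<bar>poly p t\<bar> \<le> max B 1" if "t \<in> I k" for t using B[OF that] by auto
  ultimately show ?thesis using that[of "max B 1"] by auto
qed

lemma far_from_interval:
  assumes "x0 \<notin> I k"
  obtains \<delta> where "\<delta> > 0" "\<And>z t. cmod (z - of_real x0) < \<delta> \<Longrightarrow> t \<in> I k \<Longrightarrow> \<delta> \<le> cmod (z - of_real t)"
    "\<And>x t. \<bar>x - x0\<bar> < \<delta> \<Longrightarrow> t \<in> I k \<Longrightarrow> \<delta> \<le> \<bar>x - t\<bar>"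
proof -
  define \<delta> where "\<delta> = (if x0 < \<alpha> k then \<alpha> k - x0 else x0 - \<beta> k) / 2"
  have d: "\<delta> > 0" using assms by (auto simp: \<delta>_def)
  have far: "2 * \<delta> \<le> \<bar>x0 - t\<bar>" if "t \<in> I k" for t using that assms by (auto simp: \<delta>_def)
  have 1: "\<delta> \<le> cmod (z - of_real t)" if "cmod (z - of_real x0) < \<delta>" "t \<in> I k" for z t
  proof -
    have "cmod (of_real x0 - of_real t) \<le> cmod (z - of_real t) + cmod (z - of_real x0)"
      using norm_triangle_ineq4[of "z - of_real t" "z - of_real x0"] by simp
    moreover have "cmod (of_real x0 - of_real t) = \<bar>x0 - t\<bar>" by (simp flip: of_real_diff)
    ultimately show ?thesis using far[OF that(2)] that(1) by simp
  qed
  have 2: "\<delta> \<le> \<bar>x - t\<bar>" if "\<bar>x - x0\<bar> < \<delta>" "t \<in> I k" for x t using far[OF that(2)] that(1) by linarith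
  show ?thesis using that[OF d 1 2] by blast
qed

text \<open>\<open>\<psi> k\<close> is \<open>Q n k\<close> divided by \<open>x0 - t\<close>, with
  the singularity cancelled by the root, so the sum is the boundary value of \<open>L n\<close> at
  \<open>x0\<close>. Suppose it is zero and write \<open>U = U(x0) + (t - x0) r\<close> with
  \<open>U\<close> of degree below \<open>msize n\<close>. The form annihilates \<open>r\<close>,
  whose degree is too small, so the \<open>\<psi> k\<close> annihilate \<open>U\<close>. As
  \<open>1 / (x0 - t)\<close> has constant sign on an interval without \<open>x0\<close>, this
  contradicts \<open>sign_polynomial\<close>.\<close>

lemma L_nonvanishing:
  fixes n :: "nat^2" and x0 :: real
  assumes n: "msize n \<noteq> 0" and x0: "\<And>k. x0 \<notin> I k \<or> poly (Q n k) x0 = 0"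
  defines "\<psi> \<equiv> \<lambda>k t. if x0 \<in> I k then - poly (synthetic_div (Q n k) x0) t else poly (Q n k) t / (x0 - t)"
  shows "(\<Sum>k\<in>UNIV. integral\<^sup>L (\<mu> k) (\<psi> k)) \<noteq> 0"
proof
  assume zero: "(\<Sum>k\<in>UNIV. integral\<^sup>L (\<mu> k) (\<psi> k)) = 0"
  define B where "B = (\<lambda>k. if x0 \<in> I k then synthetic_div (Q n k) x0 else Q n k)"
  define g where "g = (\<lambda>k t. if x0 \<in> I k then -1 else 1 / (x0 - t))"
  define s where "s = (\<lambda>k. if x0 \<in> I k then -1 else if \<beta> k < x0 then 1 else (-1::real))"
  have Bg: "\<psi> k t = poly (B k) t * g k t" for k t by (simp add: \<psi>_def B_def g_def)
  have Qs: "[:-x0, 1:] * synthetic_div (Q n k) x0 = Q n k" if "x0 \<in> I k" for k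
    using synthetic_div_correct'[of x0 "Q n k"] x0[of k] that by simp
  have Q\<psi>: "poly (Q n k) t = (x0 - t) * \<psi> k t" if "t \<in> I k" for k t
  proof (cases "x0 \<in> I k")
    case True
    have "poly (Q n k) t = (t - x0) * poly (synthetic_div (Q n k) x0) t"
      by (subst Qs[OF True, symmetric]) (simp add: algebra_simps)
    then show ?thesis using True by (simp add: \<psi>_def algebra_simps)
  next
    case False
    then have "t \<noteq> x0" using that by auto
    then show ?thesis using False by (simp add: \<psi>_def del: atLeastAtMost_iff)
  qed
  have "\<exists>k. B k \<noteq> 0"
  proof (rule ccontr)
    assume "\<not> ?thesis"
    then have B0: "B k = 0" for k by blast
    have "Q n k = 0" for k
    proof (cases "x0 \<in> I k")
      case True
      then have "synthetic_div (Q n k) x0 = 0" using B0[of k] unfolding B_def by (simp only: if_True)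
      then show ?thesis using Qs[OF True] by (simp only: mult_zero_right)
    next
      case False
      then show ?thesis using B0[of k] unfolding B_def by (simp only: if_False)
    qed
    then have "lform (Q n) (monom 1 (msize n - 1)) = 0" by (simp add: lform_def)
    then show False using Q_moment[of "msize n - 1" n] n by simp
  qed
  moreover have gc: "continuous_on (I k) (g k)" for k
  proof (cases "x0 \<in> I k")
    case False
    then show ?thesis unfolding g_def by (auto intro!: continuous_intros)
  qed (simp add: g_def)
  moreover have gm: "g k \<in> borel_measurable borel" for k unfolding g_def by simp
  moreover have "s k = 1 \<or> s k = -1" for k by (simp add: s_def)
  moreover have "s k * g k x > 0" if "x \<in> I k" for k x
    using that by (auto simp: s_def g_def)
  ultimately obtain U where U: "degree U < (\<Sum>k\<in>UNIV. if B k = 0 then 0 else degree (B k) + 1)"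
    "(\<Sum>k\<in>UNIV. \<integral>x. poly (B k) x * (g k x * poly U x) \<partial>\<mu> k) > 0"
    using sign_polynomial[of B g s] by blast
  have dB: "(if B k = 0 then 0 else degree (B k) + 1) \<le> n $ k" for k
  proof -
    have "(if B k = 0 then 0 else degree (B k) + 1) \<le> (if Q n k = 0 then 0 else degree (Q n k) + 1)"
      by (auto simp: B_def degree_synthetic_div)
    then show ?thesis using typeI_class_degree[OF Q_class, of n k] by linarith
  qed
  have dU: "degree U < msize n"
    by (rule less_le_trans[OF U(1)]) (unfold msize_sum, intro sum_mono dB)
  define r where "r = synthetic_div U x0"
  have Ur: "poly U t = poly U x0 + (t - x0) * poly r t" for t
  proof -
    have "poly ([:-x0, 1:] * r + [:poly U x0:]) t = poly U t" unfolding r_def by (simp only: synthetic_div_correct')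
    then show ?thesis by (simp add: algebra_simps)
  qed
  have \<psi>i: "integrable (\<mu> k) (\<psi> k)" for k
    unfolding Bg[abs_def] by (intro integrable_continuous continuous_intros gc borel_measurable_times gm borel_measurable_poly)
  have "(\<integral>x. poly (B k) x * (g k x * poly U x) \<partial>\<mu> k) = poly U x0 * integral\<^sup>L (\<mu> k) (\<psi> k) - J k (Q n k * r)" for k
  proof -
    have "(\<integral>x. poly (B k) x * (g k x * poly U x) \<partial>\<mu> k) = (\<integral>x. poly U x0 * \<psi> k x - poly (Q n k * r) x \<partial>\<mu> k)"
    proof (rule integral_cong_I)
      fix x assume x: "x \<in> I k"
      show "poly (B k) x * (g k x * poly U x) = poly U x0 * \<psi> k x - poly (Q n k * r) x"
        unfolding mult.assoc[symmetric] Bg[symmetric] Ur[of x] poly_mult Q\<psi>[OF x] by (simp add: algebra_simps)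
    qed (auto simp: Bg intro!: borel_measurable_times borel_measurable_diff gm borel_measurable_poly simp del: poly_mult)
    then show ?thesis using \<psi>i[of k] by (simp add: J_def del: poly_mult)
  qed
  then have "(\<Sum>k\<in>UNIV. \<integral>x. poly (B k) x * (g k x * poly U x) \<partial>\<mu> k) = poly U x0 * (\<Sum>k\<in>UNIV. integral\<^sup>L (\<mu> k) (\<psi> k)) - lform (Q n) r"
    by (simp add: sum_subtractf sum_distrib_left lform_def)
  also have "lform (Q n) r = 0"
  proof -
    have dr: "degree r = degree U - 1" by (simp add: r_def degree_synthetic_div)
    then have "lform (Q n) r = coeff r (msize n - 1)" using dU n by (subst lform_Q) auto
    also have "\<dots> = 0"
    \<comment> \<open>For constant \<open>U\<close> truncated subtraction only gives degree 0 for
      \<open>r\<close>, so \<open>r = 0\<close> is argued separately.\<close>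
    proof (cases "degree U = 0")
      case True
      then have "r = 0" unfolding r_def by (simp add: synthetic_div_eq_0_iff)
      then show ?thesis by simp
    next
      case False
      then show ?thesis using dr dU by (intro coeff_eq_0) auto
    qed
    finally show ?thesis .
  qed
  finally show False using U(2) zero by simp
qed

text \<open>The limit could only come from mass at \<open>x0\<close>, and points are null. The
  factor \<open>e m / |x0 + \<i> e m - t|\<close> is at most 1, so dominated convergence
  applies.\<close>

lemma scaled_ctrans_tendsto_0:
  assumes e0: "\<And>m. e m > 0" and el: "e \<longlonglongrightarrow> 0"
  shows "(\<lambda>m. of_real (e m) * ctrans (\<mu> k) (poly p) (Complex x0 (e m))) \<longlonglongrightarrow> 0"
proof -
  obtain B where B: "B > 0" "AE t in \<mu> k. \<bar>poly p t\<bar> \<le> B" "\<And>t. t \<in> I k \<Longrightarrow> \<bar>poly p t\<bar> \<le> B"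
    using poly_density[of k p] by metis
  have nz: "Complex x0 (e m) - of_real t \<noteq> 0" for m t using e0[of m] by (auto simp: complex_eq_iff)
  have cl: "(\<lambda>m. \<integral>t. of_real (e m) * (of_real (poly p t) / (Complex x0 (e m) - of_real t)) \<partial>\<mu> k) \<longlonglongrightarrow> (\<integral>t. 0 \<partial>\<mu> k)"
  proof (rule integral_dominated_convergence[where w="\<lambda>_. B"])
    show "(\<lambda>t. of_real (e m) * (of_real (poly p t) / (Complex x0 (e m) - of_real t))) \<in> borel_measurable (\<mu> k)" for m
      by simp
    show "AE t in \<mu> k. (\<lambda>m. of_real (e m) * (of_real (poly p t) / (Complex x0 (e m) - of_real t))) \<longlonglongrightarrow> 0"
      using finite_null[of "{x0}" k, simplified]
    proof (rule AE_mp, intro AE_I2 impI)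
      fix t assume t: "t \<noteq> x0"
      have "(\<lambda>m. of_real (e m) * (of_real (poly p t) / (Complex x0 (e m) - of_real t))) \<longlonglongrightarrow> of_real 0 * (of_real (poly p t) / (Complex x0 0 - of_real t))"
        by (intro tendsto_intros tendsto_Complex el) (use t in \<open>auto simp: complex_eq_iff\<close>)
      then show "(\<lambda>m. of_real (e m) * (of_real (poly p t) / (Complex x0 (e m) - of_real t))) \<longlonglongrightarrow> 0" by simp
    qed
    show "AE t in \<mu> k. cmod (of_real (e m) * (of_real (poly p t) / (Complex x0 (e m) - of_real t))) \<le> B" for m
      using B(2)
    proof (rule AE_mp, intro AE_I2 impI)
      fix t assume t: "\<bar>poly p t\<bar> \<le> B"
      have "e m \<le> cmod (Complex x0 (e m) - of_real t)" using abs_Im_le_cmod[of "Complex x0 (e m) - of_real t"] e0[of m] by simp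
      then have "e m / cmod (Complex x0 (e m) - of_real t) \<le> 1" using nz[of m t] by (simp add: divide_le_eq)
      then have "\<bar>poly p t\<bar> * (e m / cmod (Complex x0 (e m) - of_real t)) \<le> B * 1"
        using t B(1) e0[of m] by (intro mult_mono) auto
      then show "cmod (of_real (e m) * (of_real (poly p t) / (Complex x0 (e m) - of_real t))) \<le> B"
        using e0[of m] by (simp add: norm_mult norm_divide mult_ac)
    qed
  qed (auto simp: integrable_poly)
  moreover have "(\<integral>t. of_real (e m) * (of_real (poly p t) / (Complex x0 (e m) - of_real t)) \<partial>\<mu> k) = of_real (e m) * ctrans (\<mu> k) (poly p) (Complex x0 (e m))" for m
    unfolding ctrans_def by (rule integral_mult_right_zero)
  ultimately show ?thesis by simp
qed

text \<open>Off the interval the transform is continuous. At a root write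
  \<open>p = (t - x0) q\<close>; then \<open>p / (z - t) = - q + \<i> e q / (z - t)\<close> for
  \<open>z = x0 + \<i> e\<close>, and the second term tends to 0 after integration by
  \<open>scaled_ctrans_tendsto_0\<close>.\<close>

lemma ctrans_tendsto:
  assumes e0: "\<And>m. e m > 0" and el: "e \<longlonglongrightarrow> 0" and root: "x0 \<notin> I k \<or> poly p x0 = 0"
  shows "(\<lambda>m. ctrans (\<mu> k) (poly p) (Complex x0 (e m)))
     \<longlonglongrightarrow> of_real (integral\<^sup>L (\<mu> k) (\<lambda>t. if x0 \<in> I k then - poly (synthetic_div p x0) t else poly p t / (x0 - t)))"
proof (cases "x0 \<in> I k")
  case False
  obtain B where "cauchy_density (\<mu> k) (poly p) B (I k)" using poly_density[of k p] by metis
  then interpret cauchy_density "\<mu> k" "poly p" B "I k" .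
  obtain \<delta> where d: "\<delta> > 0" "\<And>z t. cmod (z - of_real x0) < \<delta> \<Longrightarrow> t \<in> I k \<Longrightarrow> \<delta> \<le> cmod (z - of_real t)"
    using far_from_interval[OF False] by metis
  have "isCont (ctrans (\<mu> k) (poly p)) (of_real x0)"
    by (rule ctrans_continuous[OF d(1)]) (use d in auto)
  moreover have "(\<lambda>m. Complex x0 (e m)) \<longlonglongrightarrow> Complex x0 0"
    by (intro tendsto_Complex tendsto_const el)
  then have "(\<lambda>m. Complex x0 (e m)) \<longlonglongrightarrow> of_real x0" by (simp add: complex_of_real_def)
  ultimately have "(\<lambda>m. ctrans (\<mu> k) (poly p) (Complex x0 (e m))) \<longlonglongrightarrow> ctrans (\<mu> k) (poly p) (of_real x0)"
    by (rule isCont_tendsto_compose)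
  then show ?thesis using False by (simp add: ctrans_of_real del: atLeastAtMost_iff)
next
  case True
  let ?q = "synthetic_div p x0"
  have p: "poly p t = (t - x0) * poly ?q t" for t
  proof -
    have "[:-x0, 1:] * ?q = p" using synthetic_div_correct'[of x0 p] root True by simp
    then have "poly ([:-x0, 1:] * ?q) t = poly p t" by (simp only:)
    then show ?thesis by (simp add: algebra_simps)
  qed
  have "ctrans (\<mu> k) (poly p) (Complex x0 (e m)) = - of_real (integral\<^sup>L (\<mu> k) (poly ?q)) + \<i> * (of_real (e m) * ctrans (\<mu> k) (poly ?q) (Complex x0 (e m)))" for m
  proof -
    let ?z = "Complex x0 (e m)"
    have nz: "?z - of_real t \<noteq> 0" for t using e0[of m] by (auto simp: complex_eq_iff)
    have z: "\<i> * of_real (e m) = ?z - of_real x0" by (simp add: complex_eq_iff)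
    obtain B where "cauchy_density (\<mu> k) (poly ?q) B (I k)" using poly_density[of k ?q] by metis
    then interpret cauchy_density "\<mu> k" "poly ?q" B "I k" .
    have i: "integrable (\<mu> k) (\<lambda>t. complex_of_real (poly ?q t) / (?z - of_real t))"
      by (rule integrand_integrable[of "e m"]) (use upper_half_sep[of ?z] e0[of m] in auto)
    have "ctrans (\<mu> k) (poly p) ?z = (\<integral>t. - of_real (poly ?q t) + (\<i> * of_real (e m)) * (of_real (poly ?q t) / (?z - of_real t)) \<partial>\<mu> k)"
      unfolding ctrans_def
    proof (rule Bochner_Integration.integral_cong[OF refl])
      fix t
      have "(of_real t - of_real x0) * q / w = - q + (w + (of_real t - of_real x0)) * (q / w)" if "w \<noteq> 0" for q w :: complex
        using that by (simp add: field_simps)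
      from this[OF nz[of t], of "of_real (poly ?q t)"]
      show "of_real (poly p t) / (?z - of_real t) = - of_real (poly ?q t) + (\<i> * of_real (e m)) * (of_real (poly ?q t) / (?z - of_real t))"
        unfolding z p by simp
    qed
    also have "\<dots> = - of_real (integral\<^sup>L (\<mu> k) (poly ?q)) + (\<i> * of_real (e m)) * ctrans (\<mu> k) (poly ?q) ?z"
    proof -
      define c where "c = \<i> * of_real (e m)"
      have "(\<integral>t. - of_real (poly ?q t) + c * (of_real (poly ?q t) / (?z - of_real t)) \<partial>\<mu> k) = (\<integral>t. - of_real (poly ?q t) \<partial>\<mu> k) + (\<integral>t. c * (of_real (poly ?q t) / (?z - of_real t)) \<partial>\<mu> k)"
        by (rule Bochner_Integration.integral_add) (intro integrable_minus integrable_of_real integrable_poly integrable_mult_right i)+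
      also have "(\<integral>t. c * (of_real (poly ?q t) / (?z - of_real t)) \<partial>\<mu> k) = c * ctrans (\<mu> k) (poly ?q) ?z"
        unfolding ctrans_def by (rule integral_mult_right_zero)
      also have "(\<integral>t. - complex_of_real (poly ?q t) \<partial>\<mu> k) = - of_real (integral\<^sup>L (\<mu> k) (poly ?q))" by simp
      finally show ?thesis unfolding c_def .
    qed
    finally show ?thesis by (simp only: mult.assoc)
  qed
  moreover have "(\<lambda>m. - of_real (integral\<^sup>L (\<mu> k) (poly ?q)) + \<i> * (of_real (e m) * ctrans (\<mu> k) (poly ?q) (Complex x0 (e m))))
     \<longlonglongrightarrow> - of_real (integral\<^sup>L (\<mu> k) (poly ?q)) + \<i> * 0"
    by (intro tendsto_intros scaled_ctrans_tendsto_0 e0 el)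
  ultimately show ?thesis using True by simp
qed

lemma ctrans_upper_bound:
  assumes "e > 0" "AE t in \<mu> k. \<bar>poly p t\<bar> \<le> B" "B > 0"
  shows "cmod (ctrans (\<mu> k) (poly p) (Complex x e)) \<le> B / e * measure (\<mu> k) UNIV"
proof -
  have "cauchy_density (\<mu> k) (poly p) B UNIV"
    unfolding cauchy_density_def cauchy_density_axioms_def using assms fin_meas sets_eq by (auto simp: borel_measurable_poly)
  then interpret cauchy_density "\<mu> k" "poly p" B UNIV .
  have "e \<le> cmod (Complex x e - of_real t)" for t using upper_half_sep[of "Complex x e" t] assms(1) by simp
  then show ?thesis using norm_ctrans_le[OF assms(1), of "Complex x e"] by simp
qed

lemma pois_far:
  assumes "\<delta> > 0" "\<And>t. t \<in> I k \<Longrightarrow> \<delta> \<le> \<bar>x - t\<bar>" "e > 0"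
  shows "pois (\<mu> k) x e \<le> e / \<delta>\<^sup>2 * measure (\<mu> k) UNIV"
proof -
  have "pois (\<mu> k) x e \<le> (\<integral>t. e / \<delta>\<^sup>2 \<partial>\<mu> k)"
    unfolding pois_def
  proof (rule integral_mono_AE[OF pois_integrable[OF fin_meas sets_eq assms(3)] fin.integrable_const])
    show "AE t in \<mu> k. e / ((x - t)\<^sup>2 + e\<^sup>2) \<le> e / \<delta>\<^sup>2"
      using supp[of k]
    proof (rule AE_mp, intro AE_I2 impI)
      fix t assume "t \<in> I k"
      then have "\<delta>\<^sup>2 \<le> (x - t)\<^sup>2" using assms(1,2) by (simp add: abs_le_square_iff[symmetric])
      then show "e / ((x - t)\<^sup>2 + e\<^sup>2) \<le> e / \<delta>\<^sup>2" using assms(1,3) by (intro frac_le) (auto simp: add_increasing2)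
    qed
  qed
  then show ?thesis by (simp add: mult.commute)
qed

lemma ctrans_far:
  assumes "x1 \<notin> I k"
  obtains \<delta> C where "\<delta> > 0" "C > 0"
    "\<And>z. cmod (z - of_real x1) < \<delta> \<Longrightarrow> cmod (ctrans (\<mu> k) (poly p) z) \<le> C"
    "\<And>z w. cmod (z - of_real x1) < \<delta> \<Longrightarrow> cmod (w - of_real x1) < \<delta> \<Longrightarrow>
        cmod (ctrans (\<mu> k) (poly p) z - ctrans (\<mu> k) (poly p) w) \<le> C * cmod (z - w)"
    "\<And>x e. \<bar>x - x1\<bar> < \<delta> \<Longrightarrow> 0 < e \<Longrightarrow> e < 1 \<Longrightarrow> pois (\<mu> k) x e \<le> C"
proof -
  obtain B where B: "B > 0" "cauchy_density (\<mu> k) (poly p) B (I k)" using poly_density[of k p] by metis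
  interpret cauchy_density "\<mu> k" "poly p" B "I k" by (rule B(2))
  obtain \<delta> where d: "\<delta> > 0" "\<And>z t. cmod (z - of_real x1) < \<delta> \<Longrightarrow> t \<in> I k \<Longrightarrow> \<delta> \<le> cmod (z - of_real t)"
    "\<And>x t. \<bar>x - x1\<bar> < \<delta> \<Longrightarrow> t \<in> I k \<Longrightarrow> \<delta> \<le> \<bar>x - t\<bar>"
    using far_from_interval[OF assms] by metis
  let ?m = "measure (\<mu> k) UNIV"
  define C where "C = 1 + B / \<delta> * ?m + B / \<delta>\<^sup>2 * ?m + 1 / \<delta>\<^sup>2 * ?m"
  have nn: "0 \<le> B / \<delta> * ?m" "0 \<le> B / \<delta>\<^sup>2 * ?m" "0 \<le> 1 / \<delta>\<^sup>2 * ?m" using B(1) d(1) by auto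
  show ?thesis
  proof (rule that[of \<delta> C])
    show "C > 0" unfolding C_def using nn by linarith
    show "cmod (ctrans (\<mu> k) (poly p) z) \<le> C" if "cmod (z - of_real x1) < \<delta>" for z
    proof -
      have "cmod (ctrans (\<mu> k) (poly p) z) \<le> B / \<delta> * ?m" using norm_ctrans_le[OF d(1), of z] d(2)[OF that] by simp
      then show ?thesis unfolding C_def using nn by linarith
    qed
    show "cmod (ctrans (\<mu> k) (poly p) z - ctrans (\<mu> k) (poly p) w) \<le> C * cmod (z - w)"
      if "cmod (z - of_real x1) < \<delta>" "cmod (w - of_real x1) < \<delta>" for z w
    proof -
      have "cmod (ctrans (\<mu> k) (poly p) z - ctrans (\<mu> k) (poly p) w) \<le> B / \<delta>\<^sup>2 * ?m * cmod (z - w)"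
        using ctrans_lipschitz[OF d(1) d(2)[OF that(1)] d(2)[OF that(2)]] by simp
      also have "\<dots> \<le> C * cmod (z - w)" using nn by (intro mult_right_mono) (auto simp: C_def)
      finally show ?thesis .
    qed
    show "pois (\<mu> k) x e \<le> C" if "\<bar>x - x1\<bar> < \<delta>" "0 < e" "e < 1" for x e
    proof -
      have "pois (\<mu> k) x e \<le> e / \<delta>\<^sup>2 * ?m" by (rule pois_far[OF d(1) d(3)[OF that(1)] that(2)])
      also have "\<dots> \<le> 1 / \<delta>\<^sup>2 * ?m" using that by (intro mult_right_mono divide_right_mono) auto
      finally show ?thesis using nn by (simp add: C_def)
    qed
  qed (rule d(1))
qed

lemma L_of_real: "\<exists>r. L n (of_real x) = of_real r"
  unfolding L_def ctrans_of_real of_real_sum[symmetric] by (rule exI, rule refl)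

text \<open>Near \<open>x1\<close> the function \<open>L n'\<close> is Lipschitz, and it is real on
  the real line and nonzero at \<open>x1\<close>. Replacing its value at \<open>x + \<i> e\<close>
  by the real number \<open>l\<close>, its value at \<open>x\<close>, changes
  \<open>L n / L n'\<close> by a bounded amount: the increment is \<open>O(e)\<close> and
  \<open>L n\<close> is \<open>O(1 / e)\<close>. What remains is \<open>Im (L n) / l\<close>,
  controlled by Poisson integrals.\<close>

lemma regular_point:
  fixes K :: "real measure"
  assumes fK: "finite_measure K" "sets K = sets borel"
    and eq: "\<And>z. Im z > 0 \<Longrightarrow> L n z = ctrans K (\<lambda>_. 1) z * L n' z" and n': "msize n' \<noteq> 0"
    and reg: "\<And>k. x1 \<notin> I k \<or> Q n' k = 0"
  shows "\<exists>\<delta>>0. \<exists>C\<ge>0. \<exists>k. \<forall>x e. \<bar>x - x1\<bar> < \<delta> \<longrightarrow> 0 < e \<longrightarrow> e < \<delta> \<longrightarrow> pois K x e \<le> C * (pois (\<mu> k) x e + 1)"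
proof -
  have "\<exists>\<delta> C. \<delta> > 0 \<and> C > 0 \<and> (\<forall>z w. cmod (z - of_real x1) < \<delta> \<longrightarrow> cmod (w - of_real x1) < \<delta> \<longrightarrow>
        cmod (ctrans (\<mu> k) (poly (Q n' k)) z - ctrans (\<mu> k) (poly (Q n' k)) w) \<le> C * cmod (z - w))" for k
  proof (cases "x1 \<in> I k")
    case True
    then have "Q n' k = 0" using reg[of k] by blast
    then have "ctrans (\<mu> k) (poly (Q n' k)) z = 0" for z by (simp add: ctrans_def)
    then show ?thesis by (intro exI[of _ 1]) simp
  next
    case False
    then show ?thesis using ctrans_far[OF False, of "Q n' k"] by metis
  qed
  then obtain d1 C1 where d1: "\<And>k. d1 k > 0" "\<And>k. C1 k > 0"
    "\<And>k z w. cmod (z - of_real x1) < d1 k \<Longrightarrow> cmod (w - of_real x1) < d1 k \<Longrightarrow>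
        cmod (ctrans (\<mu> k) (poly (Q n' k)) z - ctrans (\<mu> k) (poly (Q n' k)) w) \<le> C1 k * cmod (z - w)" by metis
  define d2 where "d2 = min (d1 1) (d1 2)"
  define \<Lambda> where "\<Lambda> = C1 1 + C1 2"
  have d2: "d2 > 0" "\<And>k. d2 \<le> d1 k" using d1(1) exhaust_2 by (auto simp: d2_def min_le_iff_disj, metis order_refl)
  have lip: "cmod (L n' z - L n' w) \<le> \<Lambda> * cmod (z - w)" if "cmod (z - of_real x1) < d2" "cmod (w - of_real x1) < d2" for z w
  proof -
    have "cmod (L n' z - L n' w) = cmod (\<Sum>k\<in>UNIV. ctrans (\<mu> k) (poly (Q n' k)) z - ctrans (\<mu> k) (poly (Q n' k)) w)"
      by (simp add: L_def sum_subtractf)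
    also have "\<dots> \<le> (\<Sum>k\<in>UNIV. C1 k * cmod (z - w))"
      by (rule order_trans[OF norm_sum], rule sum_mono, rule d1(3)) (use that d2(2) less_le_trans in blast)+
    finally show ?thesis by (simp add: \<Lambda>_def sum_2 distrib_right)
  qed
  have L0: "\<Lambda> > 0" using d1(2) by (simp add: \<Lambda>_def add_pos_pos)
  define c0 where "c0 = cmod (L n' (of_real x1))"
  have "c0 > 0"
  proof -
    have e: "integral\<^sup>L (\<mu> k) (\<lambda>t. poly (Q n' k) t / (x1 - t)) = integral\<^sup>L (\<mu> k) (\<lambda>t. if x1 \<in> I k then - poly (synthetic_div (Q n' k) x1) t else poly (Q n' k) t / (x1 - t))" for k
      using reg[of k] by (cases "x1 \<in> I k") (simp_all del: atLeastAtMost_iff)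
    have "x1 \<notin> I k \<or> poly (Q n' k) x1 = 0" for k using reg[of k] by auto
    from L_nonvanishing[OF n' this]
    have "(\<Sum>k\<in>UNIV. integral\<^sup>L (\<mu> k) (\<lambda>t. poly (Q n' k) t / (x1 - t))) \<noteq> 0" unfolding e .
    then have "of_real (\<Sum>k\<in>UNIV. integral\<^sup>L (\<mu> k) (\<lambda>t. poly (Q n' k) t / (x1 - t))) \<noteq> (0::complex)" by (simp only: of_real_eq_0_iff not_False_eq_True)
    then have "L n' (of_real x1) \<noteq> 0" unfolding L_def ctrans_of_real of_real_sum .
    then show ?thesis by (simp add: c0_def)
  qed
  define d3 where "d3 = min d2 (c0 / (2 * \<Lambda>))"
  have d3: "d3 > 0" "d3 \<le> d2" using d2(1) \<open>c0 > 0\<close> L0 by (auto simp: d3_def)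
  have low: "c0 / 2 \<le> cmod (L n' z)" if z: "cmod (z - of_real x1) < d3" for z
  proof -
    have "cmod (L n' z - L n' (of_real x1)) \<le> \<Lambda> * cmod (z - of_real x1)"
      using z d3 d2(1) by (intro lip) auto
    also have "\<dots> \<le> \<Lambda> * (c0 / (2 * \<Lambda>))" using z L0 by (intro mult_left_mono) (auto simp: d3_def)
    also have "\<dots> = c0 / 2" using L0 by simp
    finally show ?thesis using norm_triangle_ineq2[of "L n' (of_real x1)" "L n' z"] by (simp add: c0_def norm_minus_commute)
  qed
  have "\<exists>B. B > 0 \<and> (AE t in \<mu> k. \<bar>poly (Q n k) t\<bar> \<le> B)" for k using poly_density[of k "Q n k"] by metis
  then obtain B where B: "\<And>k. B k > 0" "\<And>k. AE t in \<mu> k. \<bar>poly (Q n k) t\<bar> \<le> B k" by metis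
  \<comment> \<open>Only the interval of \<open>k0\<close> can contain \<open>x1\<close>; the
    Poisson integral of the other measure stays bounded near \<open>x1\<close> and goes into the
    constant.\<close>
  define k0 where "k0 = (if x1 \<in> I 1 then 1 else (2::2))"
  have far: "x1 \<notin> I k" if "k \<noteq> k0" for k
    using that exhaust_2[of k] disjoint by (auto simp: k0_def split: if_splits)
  have "\<exists>\<delta> C. \<delta> > 0 \<and> C > 0 \<and> (k \<noteq> k0 \<longrightarrow> (\<forall>x e. \<bar>x - x1\<bar> < \<delta> \<longrightarrow> 0 < e \<longrightarrow> e < 1 \<longrightarrow> pois (\<mu> k) x e \<le> C))" for k
  proof (cases "k = k0")
    case False
    then show ?thesis using ctrans_far[OF far[OF False], of 0] by metis
  qed (auto intro: exI[of _ 1])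
  then obtain d4 C4 where d4: "\<And>k. d4 k > 0" "\<And>k. C4 k > 0"
    "\<And>k x e. k \<noteq> k0 \<Longrightarrow> \<bar>x - x1\<bar> < d4 k \<Longrightarrow> 0 < e \<Longrightarrow> e < 1 \<Longrightarrow> pois (\<mu> k) x e \<le> C4 k" by metis
  define \<delta> where "\<delta> = min (min (d3 / 2) (1/2)) (min (d4 1) (d4 2))"
  have \<delta>: "\<delta> > 0" "\<delta> \<le> d3 / 2" "\<delta> < 1" "\<And>k. \<delta> \<le> d4 k"
  proof -
    show "\<delta> \<le> d4 k" for k using exhaust_2[of k] by (auto simp: \<delta>_def min_le_iff_disj)
  qed (use d3 d4(1) in \<open>auto simp: \<delta>_def min_less_iff_disj min_le_iff_disj\<close>)
  define S where "S = (\<Sum>k\<in>UNIV. B k * measure (\<mu> k) UNIV)"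
  define B' where "B' = (\<Sum>k\<in>UNIV. B k * (1 + C4 k))"
  have S0: "S \<ge> 0" unfolding S_def using B(1) by (intro sum_nonneg mult_nonneg_nonneg) (auto intro: less_imp_le)
  have B'0: "B' \<ge> 0" unfolding B'_def using B(1) d4(2) by (intro sum_nonneg mult_nonneg_nonneg) (auto intro!: less_imp_le add_pos_pos)
  define C where "C = B' / (c0 / 2) + S * \<Lambda> / ((c0 / 2) * (c0 / 2))"
  have C0: "C \<ge> 0" unfolding C_def using B'0 S0 L0 \<open>c0 > 0\<close> by (intro add_nonneg_nonneg divide_nonneg_nonneg mult_nonneg_nonneg) auto
  have "pois K x e \<le> C * (pois (\<mu> k0) x e + 1)" if x: "\<bar>x - x1\<bar> < \<delta>" and e: "0 < e" "e < \<delta>" for x e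
  proof -
    let ?z = "Complex x e"
    let ?p = "pois (\<mu> k0) x e"
    have p0: "0 \<le> ?p" by (rule pois_nonneg[OF e(1)])
    have zx: "?z - of_real x = \<i> * of_real e" by (simp add: complex_eq_iff)
    have nz: "cmod (?z - of_real x1) < d3"
    proof -
      have "cmod (?z - of_real x1) \<le> \<bar>x - x1\<bar> + \<bar>e\<bar>" using cmod_le[of "?z - of_real x1"] by simp
      then show ?thesis using x e \<delta>(2) by linarith
    qed
    have nx: "cmod (of_real x - of_real x1 :: complex) < d3"
      using x \<delta>(2) d3(1) by (simp flip: of_real_diff)
    obtain l where l: "L n' (of_real x) = of_real l" using L_of_real by blast
    have al: "c0 / 2 \<le> \<bar>l\<bar>" using low[OF nx] unfolding l by simp
    have lz: "c0 / 2 \<le> cmod (L n' ?z)" by (rule low[OF nz])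
    have nonz: "L n' ?z \<noteq> 0" "l \<noteq> 0" using lz al \<open>c0 > 0\<close> by auto
    have dl: "cmod (L n' ?z - of_real l) \<le> \<Lambda> * e"
      using lip[of ?z "of_real x"] nz nx d3(2) e(1) unfolding zx l by (simp add: norm_mult)
    have imL: "\<bar>Im (L n ?z)\<bar> \<le> B' * (?p + 1)"
    proof -
      have "\<bar>Im (ctrans (\<mu> k) (poly (Q n k)) ?z)\<bar> \<le> B k * (1 + C4 k) * (?p + 1)" for k
      proof -
        have pk: "pois (\<mu> k) x e \<le> (1 + C4 k) * (?p + 1)"
        proof (cases "k = k0")
          case True
          have "1 * ?p \<le> (1 + C4 k) * (?p + 1)" using p0 d4(2)[of k] by (intro mult_mono) auto
          then show ?thesis using True by simp
        next
          case False
          have "pois (\<mu> k) x e \<le> C4 k" using d4(3)[OF False] x e \<delta>(3) \<delta>(4)[of k] by auto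
          also have "\<dots> \<le> (1 + C4 k) * 1" by simp
          also have "\<dots> \<le> (1 + C4 k) * (?p + 1)" using p0 d4(2)[of k] by (intro mult_left_mono) auto
          finally show ?thesis .
        qed
        have "\<bar>Im (ctrans (\<mu> k) (poly (Q n k)) ?z)\<bar> \<le> B k * pois (\<mu> k) x e"
          by (rule abs_Im_ctrans_le[OF fin_meas sets_eq e(1) borel_measurable_poly B(2)])
        also have "\<dots> \<le> B k * ((1 + C4 k) * (?p + 1))" using pk B(1)[of k] by (intro mult_left_mono) auto
        finally show ?thesis by (simp add: mult.assoc)
      qed
      then have "(\<Sum>k\<in>UNIV. \<bar>Im (ctrans (\<mu> k) (poly (Q n k)) ?z)\<bar>) \<le> (\<Sum>k\<in>UNIV. B k * (1 + C4 k) * (?p + 1))"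
        by (rule sum_mono)
      moreover have "\<bar>Im (L n ?z)\<bar> \<le> (\<Sum>k\<in>UNIV. \<bar>Im (ctrans (\<mu> k) (poly (Q n k)) ?z)\<bar>)"
        unfolding L_def Im_sum by (rule sum_abs)
      ultimately show ?thesis by (simp add: B'_def sum_distrib_right)
    qed
    have normL: "cmod (L n ?z) * e \<le> S"
    proof -
      have "cmod (L n ?z) \<le> (\<Sum>k\<in>UNIV. B k / e * measure (\<mu> k) UNIV)"
        unfolding L_def by (rule order_trans[OF norm_sum], rule sum_mono, rule ctrans_upper_bound[OF e(1) B(2) B(1)])
      also have "\<dots> = S / e" by (simp add: S_def sum_divide_distrib)
      finally show ?thesis using e(1) by (simp add: field_simps)
    qed
    have F: "ctrans K (\<lambda>_. 1) ?z = L n ?z / L n' ?z" using eq[of ?z] e(1) nonz(1) by simp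
    have split: "L n ?z / L n' ?z = L n ?z / of_real l - L n ?z * (L n' ?z - of_real l) / (of_real l * L n' ?z)"
      using nonz by (simp add: field_simps)
    have "pois K x e \<le> cmod (L n ?z * (L n' ?z - of_real l) / (of_real l * L n' ?z)) + \<bar>Im (L n ?z / of_real l)\<bar>"
    proof -
      have "pois K x e = - Im (ctrans K (\<lambda>_. 1) ?z)" by (rule pois_eq_Im_ctrans[OF fK e(1)])
      also have "\<dots> = - Im (L n ?z / of_real l) + Im (L n ?z * (L n' ?z - of_real l) / (of_real l * L n' ?z))"
        unfolding F split by (simp del: Im_divide_of_real)
      also have "\<dots> \<le> \<bar>Im (L n ?z / of_real l)\<bar> + cmod (L n ?z * (L n' ?z - of_real l) / (of_real l * L n' ?z))"
        by (intro add_mono abs_ge_minus_self order_trans[OF abs_ge_self abs_Im_le_cmod])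
      finally show ?thesis by simp
    qed
    also have "\<bar>Im (L n ?z / of_real l)\<bar> \<le> B' / (c0 / 2) * (?p + 1)"
    proof -
      have "\<bar>Im (L n ?z / of_real l)\<bar> = \<bar>Im (L n ?z)\<bar> / \<bar>l\<bar>" by (simp add: Im_divide_of_real)
      also have "\<dots> \<le> (B' * (?p + 1)) / (c0 / 2)" using imL al \<open>c0 > 0\<close> B'0 p0 by (intro frac_le) auto
      finally show ?thesis by (simp only: times_divide_eq_left)
    qed
    also have "cmod (L n ?z * (L n' ?z - of_real l) / (of_real l * L n' ?z)) \<le> S * \<Lambda> / ((c0 / 2) * (c0 / 2))"
    proof -
      have "cmod (L n ?z) * cmod (L n' ?z - of_real l) \<le> cmod (L n ?z) * (\<Lambda> * e)" by (intro mult_left_mono dl) auto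
      also have "\<dots> = (cmod (L n ?z) * e) * \<Lambda>" by simp
      also have "\<dots> \<le> S * \<Lambda>" using normL L0 by (intro mult_right_mono) auto
      finally have "cmod (L n ?z) * cmod (L n' ?z - of_real l) \<le> S * \<Lambda>" .
      moreover have "(c0 / 2) * (c0 / 2) \<le> \<bar>l\<bar> * cmod (L n' ?z)" using al lz \<open>c0 > 0\<close> by (intro mult_mono) auto
      ultimately show ?thesis unfolding norm_divide norm_mult norm_of_real using \<open>c0 > 0\<close> S0 L0
        by (intro frac_le) auto
    qed
    also have "S * \<Lambda> / ((c0 / 2) * (c0 / 2)) + B' / (c0 / 2) * (?p + 1) \<le> C * (?p + 1)"
    proof -
      have "0 \<le> S * \<Lambda> / ((c0 / 2) * (c0 / 2))" using S0 L0 by simp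
      then have "S * \<Lambda> / ((c0 / 2) * (c0 / 2)) * 1 \<le> S * \<Lambda> / ((c0 / 2) * (c0 / 2)) * (?p + 1)" using p0 by (intro mult_left_mono) auto
      then show ?thesis unfolding C_def distrib_right by simp
    qed
    finally show ?thesis by simp
  qed
  then show ?thesis using \<delta>(1) C0 by blast
qed

text \<open>Eliminating \<open>\<mu>\<^sub>k\<close> from \<open>L\<^sub>n\<close> and \<open>L\<^sub>n\<^sub>'\<close> leaves a bounded quantity, so the ratio is bounded where the
  imaginary part of \<open>L\<^sub>n\<^sub>'\<close> is bounded away from zero; there the lower bound on \<open>\<mu>\<^sub>k\<close> enters.\<close>

lemma interval_point:
  fixes K :: "real measure"
  assumes eq: "\<And>z. Im z > 0 \<Longrightarrow> L n z = ctrans K (\<lambda>_. 1) z * L n' z"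
    and x1: "x1 \<in> I k" "poly (Q n' k) x1 \<noteq> 0"
  shows "\<exists>\<delta>>0. \<exists>C\<ge>0. \<forall>x e. x \<in> I k \<longrightarrow> \<bar>x - x1\<bar> < \<delta> \<longrightarrow> 0 < e \<longrightarrow> e < \<delta> \<longrightarrow> cmod (ctrans K (\<lambda>_. 1) (Complex x e)) \<le> C"
proof -
  let ?A = "Q n k" and ?A' = "Q n' k"
  obtain j where j: "j \<noteq> k" by (metis zero_neq_one)
  have UN: "UNIV = {k, j}" using j exhaust_2[of j] exhaust_2[of k] by (auto simp: UNIV_2)
  have Lsplit: "L m z = ctrans (\<mu> k) (poly (Q m k)) z + ctrans (\<mu> j) (poly (Q m j)) z" for m z
    unfolding L_def UN using j by simp
  have xj: "x1 \<notin> I j" using x1(1) I_disjoint[OF j] by auto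
  define s where "s = sgn (poly ?A' x1)"
  \<comment> \<open>Continuity keeps \<open>s * poly (Q n' k)\<close> above half the size of its
    value at \<open>x1\<close>.\<close>
  define c1 where "c1 = \<bar>poly ?A' x1\<bar> / 2"
  have c1: "c1 > 0" using x1 by (simp add: c1_def)
  obtain d1 where d1: "d1 > 0" "\<And>t. \<bar>t - x1\<bar> < d1 \<Longrightarrow> c1 \<le> s * poly ?A' t"
  proof -
    have "isCont (poly ?A') x1" by simp
    then obtain d where d: "d > 0" "\<And>t. \<bar>t - x1\<bar> < d \<Longrightarrow> \<bar>poly ?A' t - poly ?A' x1\<bar> < c1"
      unfolding continuous_at_eps_delta using c1 by (auto simp: dist_real_def)
    have "c1 \<le> s * poly ?A' t" if "\<bar>t - x1\<bar> < d" for t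
      using d(2)[OF that] x1(2) by (auto simp: s_def c1_def sgn_if abs_if split: if_splits)
    then show ?thesis using that d(1) by blast
  qed
  have s1: "\<bar>s\<bar> = 1" using x1(2) by (simp add: s_def abs_sgn_eq)
  obtain M where M: "M > 0" "\<And>t. t \<in> I k \<Longrightarrow> \<bar>poly ?A' t\<bar> \<le> M" "AE t in \<mu> k. \<bar>poly ?A' t\<bar> \<le> M"
    using poly_density[of k ?A'] by metis
  obtain MA where MA: "MA > 0" "\<And>t. t \<in> I k \<Longrightarrow> \<bar>poly ?A t\<bar> \<le> MA"
    using poly_density[of k ?A] by metis
  obtain MJ where MJ: "MJ > 0" "AE t in \<mu> j. \<bar>poly (Q n' j) t\<bar> \<le> MJ"
    using poly_density[of j "Q n' j"] by metis
  obtain d2 C2 where d2: "d2 > 0" "C2 > 0" "\<And>z. cmod (z - of_real x1) < d2 \<Longrightarrow> cmod (ctrans (\<mu> j) (poly (Q n j)) z) \<le> C2"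
    using ctrans_far[OF xj, of "Q n j"] by metis
  obtain d3 C3 where d3: "d3 > 0" "C3 > 0" "\<And>z. cmod (z - of_real x1) < d3 \<Longrightarrow> cmod (ctrans (\<mu> j) (poly (Q n' j)) z) \<le> C3"
    using ctrans_far[OF xj, of "Q n' j"] by metis
  obtain d4 where d4: "d4 > 0" "\<And>x t. \<bar>x - x1\<bar> < d4 \<Longrightarrow> t \<in> I j \<Longrightarrow> d4 \<le> \<bar>x - t\<bar>"
    using far_from_interval[OF xj] by metis
  let ?mk = "measure (\<mu> k) UNIV" and ?mj = "measure (\<mu> j) UNIV"
  define E where "E = M / (d1/2)\<^sup>2 * ?mk + MJ * (1 / d4\<^sup>2 * ?mj)"
  have E0: "E \<ge> 0" using M(1) MJ(1) by (simp add: E_def)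
  \<comment> \<open>The mass near \<open>x\<close> contributes at least
    \<open>c1 / (2 * e) * (c * e) = 2 * c2\<close> to the imaginary part of \<open>L n'\<close>, and
    the errors, at most \<open>E * e\<close>, use up no more than \<open>c2\<close> of it.\<close>
  define c2 where "c2 = c1 * c / 4"
  have c2: "c2 > 0" using c1 c_pos by (simp add: c2_def)
  define \<delta> where "\<delta> = Min {d1/2, d2/2, d3/2, d4, (\<beta> k - \<alpha> k) / 2, c2 / (E + 1), 1}"
  have \<delta>: "\<delta> > 0" "\<delta> \<le> d1/2" "\<delta> \<le> d2/2" "\<delta> \<le> d3/2" "\<delta> \<le> d4" "\<delta> \<le> (\<beta> k - \<alpha> k) / 2" "\<delta> \<le> c2 / (E + 1)" "\<delta> \<le> 1"
  proof -
    show "\<delta> > 0" unfolding \<delta>_def using d1(1) d2(1) d3(1) d4(1) interval[of k] c2 E0 by (subst Min_gr_iff) auto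
    have m: "\<delta> \<le> y" if "y \<in> {d1/2, d2/2, d3/2, d4, (\<beta> k - \<alpha> k) / 2, c2 / (E + 1), 1}" for y
      unfolding \<delta>_def by (rule Min_le) (use that in auto)
    show "\<delta> \<le> d1/2" "\<delta> \<le> d2/2" "\<delta> \<le> d3/2" "\<delta> \<le> d4" "\<delta> \<le> (\<beta> k - \<alpha> k) / 2" "\<delta> \<le> c2 / (E + 1)" "\<delta> \<le> 1"
      by (rule m, simp)+
  qed
  have low: "c2 \<le> cmod (L n' (Complex x e))" if x: "x \<in> I k" "\<bar>x - x1\<bar> < \<delta>" and e: "0 < e" "e < \<delta>" for x e
  proof -
    \<comment> \<open>An interval of length \<open>e\<close> on one side of \<open>x\<close> that
      stays inside \<open>I k\<close>, so that \<open>lower\<close> applies up to the endpoints of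
      \<open>I k\<close>.\<close>
    define u where "u = (if x + e \<le> \<beta> k then x else x - e)"
    have u: "\<alpha> k \<le> u" "u + e \<le> \<beta> k" "\<And>t. t \<in> {u..u+e} \<Longrightarrow> \<bar>x - t\<bar> \<le> e"
      using x e \<delta>(6) by (auto simp: u_def abs_le_iff split: if_splits)
    let ?P = "\<lambda>t. e / ((x - t)\<^sup>2 + e\<^sup>2)"
    have P0: "0 \<le> ?P t" for t by (rule poisson_kernel_nonneg[OF e(1)])
    have pt: "c1 / (2 * e) * indicator {u..u+e} t - M * (e / (d1/2)\<^sup>2) \<le> s * (poly ?A' t * ?P t)" if t: "t \<in> I k" for t
    proof (cases "\<bar>x - t\<bar> < d1/2")
      case True
      then have "\<bar>t - x1\<bar> < d1" using x(2) \<delta>(2) by linarith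
      then have a: "c1 \<le> s * poly ?A' t" by (rule d1(2))
      have "c1 / (2 * e) * indicator {u..u+e} t \<le> c1 * ?P t"
      proof (cases "t \<in> {u..u+e}")
        case True
        have "c1 * (1 / (2 * e)) \<le> c1 * ?P t"
          by (rule mult_left_mono[OF poisson_kernel_ge[OF e(1) u(3)[OF True]]]) (use c1 in simp)
        then show ?thesis using True by simp
      next
        case False
        then show ?thesis using mult_nonneg_nonneg[OF less_imp_le[OF c1] P0[of t]] by simp
      qed
      also have "\<dots> \<le> (s * poly ?A' t) * ?P t" by (rule mult_right_mono[OF a P0])
      finally show ?thesis using M(1) e(1) by (simp add: mult.assoc) (smt (verit) divide_nonneg_nonneg mult_nonneg_nonneg zero_le_power2)
    next
      case False
      then have "t \<notin> {u..u+e}" using u(3)[of t] e \<delta>(2) by auto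
      moreover have "?P t \<le> e / (d1/2)\<^sup>2"
      proof -
        have "(d1/2)\<^sup>2 \<le> (x - t)\<^sup>2" using False d1(1) by (subst abs_le_square_iff[symmetric]) auto
        then show ?thesis using d1(1) e(1) by (intro frac_le) (auto simp: add_increasing2)
      qed
      then have "\<bar>s * (poly ?A' t * ?P t)\<bar> \<le> M * (e / (d1/2)\<^sup>2)"
        unfolding abs_mult s1 abs_of_nonneg[OF P0] using M(2)[OF t] M(1) P0[of t] by (simp only: mult_1) (intro mult_mono, auto)
      moreover have "c1 / (2 * e) * indicator {u..u+e} t = 0" using \<open>t \<notin> {u..u+e}\<close> by simp
      moreover have "v - w \<le> y" if "\<bar>y\<bar> \<le> w" "v = 0" for v w y :: real using that by linarith
      ultimately show ?thesis by blast
    qed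
    have iP: "integrable (\<mu> k) (\<lambda>t. s * (poly ?A' t * ?P t))"
      by (intro integrable_mult_right integrable_continuous continuous_intros borel_measurable_times borel_measurable_poly)
         (use e(1) in \<open>auto simp: add_nonneg_eq_0_iff\<close>)
    have iL: "integrable (\<mu> k) (\<lambda>t. c1 / (2 * e) * indicator {u..u+e} t - M * (e / (d1/2)\<^sup>2))"
      by (intro Bochner_Integration.integrable_diff integrable_mult_right fin.integrable_const) (auto simp: fin.emeasure_eq_measure)
    have "(\<integral>t. c1 / (2 * e) * indicator {u..u+e} t - M * (e / (d1/2)\<^sup>2) \<partial>\<mu> k) \<le> (\<integral>t. s * (poly ?A' t * ?P t) \<partial>\<mu> k)"
    proof (rule integral_mono_AE[OF iL iP])
      show "AE t in \<mu> k. c1 / (2 * e) * indicator {u..u+e} t - M * (e / (d1/2)\<^sup>2) \<le> s * (poly ?A' t * ?P t)"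
        using supp[of k] by (rule AE_mp) (intro AE_I2 impI pt)
    qed
    also have "(\<integral>t. c1 / (2 * e) * indicator {u..u+e} t - M * (e / (d1/2)\<^sup>2) \<partial>\<mu> k) = c1 / (2 * e) * measure (\<mu> k) {u..u+e} - M * (e / (d1/2)\<^sup>2) * ?mk"
      by (subst Bochner_Integration.integral_diff) (auto simp: fin.emeasure_eq_measure sets_eq mult.commute)
    finally have "c1 / (2 * e) * measure (\<mu> k) {u..u+e} - M * (e / (d1/2)\<^sup>2) * ?mk \<le> s * (\<integral>t. poly ?A' t * ?P t \<partial>\<mu> k)"
      by (simp only: integral_mult_right_zero)
    moreover have "c1 / (2 * e) * (c * e) \<le> c1 / (2 * e) * measure (\<mu> k) {u..u+e}"
      using lower[of k u "u + e"] u e c1 by (intro mult_left_mono) auto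
    moreover have "c1 / (2 * e) * (c * e) = 2 * c2" using e(1) by (simp add: c2_def)
    moreover have "s * (\<integral>t. poly ?A' t * ?P t \<partial>\<mu> k) \<le> \<bar>Im (ctrans (\<mu> k) (poly ?A') (Complex x e))\<bar>"
      unfolding Im_ctrans[OF fin_meas sets_eq e(1) borel_measurable_poly M(3)] using s1 abs_ge_self[of "s * (\<integral>t. poly ?A' t * ?P t \<partial>\<mu> k)"]
      by (simp add: abs_mult)
    ultimately have 1: "2 * c2 - M * (e / (d1/2)\<^sup>2) * ?mk \<le> \<bar>Im (ctrans (\<mu> k) (poly ?A') (Complex x e))\<bar>" by linarith
    have 2: "\<bar>Im (ctrans (\<mu> j) (poly (Q n' j)) (Complex x e))\<bar> \<le> MJ * (e / d4\<^sup>2 * ?mj)"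
    proof -
      have "\<bar>Im (ctrans (\<mu> j) (poly (Q n' j)) (Complex x e))\<bar> \<le> MJ * pois (\<mu> j) x e"
        by (rule abs_Im_ctrans_le[OF fin_meas sets_eq e(1) borel_measurable_poly MJ(2)])
      also have "\<dots> \<le> MJ * (e / d4\<^sup>2 * ?mj)"
        using x \<delta>(5) MJ(1) by (intro mult_left_mono pois_far[OF d4(1) d4(2) e(1)]) auto
      finally show ?thesis .
    qed
    have "M * (e / (d1/2)\<^sup>2) * ?mk + MJ * (e / d4\<^sup>2 * ?mj) = E * e" by (simp add: E_def algebra_simps)
    also have "\<dots> \<le> (E + 1) * (c2 / (E + 1))" using E0 e \<delta>(7) by (intro mult_mono) auto
    also have "\<dots> = c2" using E0 by simp
    finally have 3: "M * (e / (d1/2)\<^sup>2) * ?mk + MJ * (e / d4\<^sup>2 * ?mj) \<le> c2" .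
    have "c2 \<le> \<bar>Im (L n' (Complex x e))\<bar>"
      using 1 2 3 unfolding Lsplit by simp
    then show ?thesis using abs_Im_le_cmod order_trans by blast
  qed
  define R where "R = max \<bar>\<alpha> k\<bar> \<bar>\<beta> k\<bar>"
  have IR: "\<bar>t\<bar> \<le> R" if "t \<in> I k" for t using that by (auto simp: R_def)
  obtain l1 where l1: "l1 \<ge> 0" "\<And>x t. \<bar>x\<bar> \<le> R \<Longrightarrow> \<bar>t\<bar> \<le> R \<Longrightarrow> \<bar>poly ?A x - poly ?A t\<bar> \<le> l1 * \<bar>x - t\<bar>"
    using poly_lipschitz[of R ?A] by metis
  obtain l2 where l2: "l2 \<ge> 0" "\<And>x t. \<bar>x\<bar> \<le> R \<Longrightarrow> \<bar>t\<bar> \<le> R \<Longrightarrow> \<bar>poly ?A' x - poly ?A' t\<bar> \<le> l2 * \<bar>x - t\<bar>"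
    using poly_lipschitz[of R ?A'] by metis
  define D0 where "D0 = (M * l1 + MA * l2) * ?mk + (M * C2 + MA * C3)"
  define C where "C = MA / c1 + D0 / (c1 * c2)"
  have D0: "D0 \<ge> 0" unfolding D0_def using M(1) MA(1) l1(1) l2(1) d2(2) d3(2) by (intro add_nonneg_nonneg mult_nonneg_nonneg) auto
  have "cmod (ctrans K (\<lambda>_. 1) (Complex x e)) \<le> C" if x: "x \<in> I k" "\<bar>x - x1\<bar> < \<delta>" and e: "0 < e" "e < \<delta>" for x e
  proof -
    let ?z = "Complex x e" and ?F = "ctrans K (\<lambda>_. 1) (Complex x e)"
    have nz: "cmod (?z - of_real x1) < 2 * \<delta>"
      using cmod_le[of "?z - of_real x1"] x e by simp
    have lz: "c2 \<le> cmod (L n' ?z)" by (rule low[OF x e])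
    have a': "c1 \<le> \<bar>poly ?A' x\<bar>" using d1(2)[of x] x \<delta>(2) d1(1) s1 abs_ge_self[of "s * poly ?A' x"] by (simp add: abs_mult)
    \<comment> \<open>The numerator of the \<open>\<mu> k\<close>-part vanishes at
      \<open>t = x\<close>, so Lipschitz bounds cancel the denominator and the integrand stays
      bounded; the other measure is far from \<open>x1\<close>.\<close>
    define D where "D = of_real (poly ?A' x) * L n ?z - of_real (poly ?A x) * L n' ?z"
    have Db: "cmod D \<le> D0"
    proof -
      obtain BA where BA: "cauchy_density (\<mu> k) (poly ?A) BA (I k)" using poly_density[of k ?A] by metis
      obtain BA' where BA': "cauchy_density (\<mu> k) (poly ?A') BA' (I k)" using poly_density[of k ?A'] by metis
      have sep: "e \<le> cmod (?z - of_real t)" for t using abs_Im_le_cmod[of "?z - of_real t"] e(1) by simp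
      have i1: "integrable (\<mu> k) (\<lambda>t. of_real (poly ?A t) / (?z - of_real t))"
        by (rule cauchy_density.integrand_integrable[OF BA e(1)]) (rule sep)
      have i2: "integrable (\<mu> k) (\<lambda>t. of_real (poly ?A' t) / (?z - of_real t))"
        by (rule cauchy_density.integrand_integrable[OF BA' e(1)]) (rule sep)
      define G where "G = (\<lambda>t. of_real (poly ?A' x) * (of_real (poly ?A t) / (?z - of_real t)) - of_real (poly ?A x) * (of_real (poly ?A' t) / (?z - of_real t)))"
      have iG: "integrable (\<mu> k) G" unfolding G_def by (intro Bochner_Integration.integrable_diff integrable_mult_right i1 i2)
      have DG: "D = integral\<^sup>L (\<mu> k) G + (of_real (poly ?A' x) * ctrans (\<mu> j) (poly (Q n j)) ?z - of_real (poly ?A x) * ctrans (\<mu> j) (poly (Q n' j)) ?z)"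
      proof -
        have "integral\<^sup>L (\<mu> k) G = of_real (poly ?A' x) * ctrans (\<mu> k) (poly ?A) ?z - of_real (poly ?A x) * ctrans (\<mu> k) (poly ?A') ?z"
          unfolding G_def ctrans_def
          by (subst Bochner_Integration.integral_diff[OF integrable_mult_right[OF i1] integrable_mult_right[OF i2]])
             (simp only: integral_mult_right_zero)
        then show ?thesis unfolding D_def Lsplit by (simp add: algebra_simps)
      qed
      have Gb: "cmod (G t) \<le> M * l1 + MA * l2" if t: "t \<in> I k" for t
      proof -
        have nzt: "?z - of_real t \<noteq> 0" using sep[of t] e(1) by auto
        have xt: "\<bar>x - t\<bar> \<le> cmod (?z - of_real t)" using abs_Re_le_cmod[of "?z - of_real t"] by simp
        have "G t = of_real (poly ?A' x * (poly ?A t - poly ?A x) - poly ?A x * (poly ?A' t - poly ?A' x)) / (?z - of_real t)"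
        proof -
          have "poly ?A' x * (poly ?A t - poly ?A x) - poly ?A x * (poly ?A' t - poly ?A' x) = poly ?A' x * poly ?A t - poly ?A x * poly ?A' t"
            by (simp add: algebra_simps)
          then show ?thesis unfolding G_def by (simp add: diff_divide_distrib)
        qed
        then have "cmod (G t) = \<bar>poly ?A' x * (poly ?A t - poly ?A x) - poly ?A x * (poly ?A' t - poly ?A' x)\<bar> / cmod (?z - of_real t)"
          by (simp only: norm_divide norm_of_real)
        also have "\<dots> \<le> ((M * l1 + MA * l2) * cmod (?z - of_real t)) / cmod (?z - of_real t)"
        proof (rule divide_right_mono)
          have "\<bar>poly ?A' x * (poly ?A t - poly ?A x) - poly ?A x * (poly ?A' t - poly ?A' x)\<bar>
            \<le> \<bar>poly ?A' x\<bar> * \<bar>poly ?A t - poly ?A x\<bar> + \<bar>poly ?A x\<bar> * \<bar>poly ?A' t - poly ?A' x\<bar>"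
            using abs_triangle_ineq4 by (simp add: abs_mult[symmetric])
          also have "\<dots> \<le> M * (l1 * \<bar>x - t\<bar>) + MA * (l2 * \<bar>x - t\<bar>)"
            using M(1,2) MA x(1) l1 l2 IR[OF t] IR[OF x(1)] by (intro add_mono mult_mono) (auto simp: abs_minus_commute)
          also have "\<dots> = (M * l1 + MA * l2) * \<bar>x - t\<bar>" by (simp add: algebra_simps)
          also have "\<dots> \<le> (M * l1 + MA * l2) * cmod (?z - of_real t)"
            using xt M(1) MA(1) l1(1) l2(1) by (intro mult_left_mono) auto
          finally show "\<bar>poly ?A' x * (poly ?A t - poly ?A x) - poly ?A x * (poly ?A' t - poly ?A' x)\<bar> \<le> (M * l1 + MA * l2) * cmod (?z - of_real t)" .
        qed simp
        finally show ?thesis using nzt by simp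
      qed
      have "cmod (integral\<^sup>L (\<mu> k) G) \<le> (M * l1 + MA * l2) * measure (\<mu> k) (space (\<mu> k))"
      proof (rule cauchy_density.norm_integral_le[OF BA iG])
        show "AE t in \<mu> k. cmod (G t) \<le> M * l1 + MA * l2" using supp[of k] by (rule AE_mp) (intro AE_I2 impI Gb)
      qed
      moreover have "cmod (of_real (poly ?A' x) * ctrans (\<mu> j) (poly (Q n j)) ?z) \<le> M * C2"
        unfolding norm_mult norm_of_real using M(1) M(2)[OF x(1)] d2(2,3) nz \<delta>(3) by (intro mult_mono) auto
      moreover have "cmod (of_real (poly ?A x) * ctrans (\<mu> j) (poly (Q n' j)) ?z) \<le> MA * C3"
        unfolding norm_mult norm_of_real using MA(1) MA(2)[OF x(1)] d3(2,3) nz \<delta>(4) by (intro mult_mono) auto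
      ultimately show ?thesis
        unfolding DG D0_def by (simp only: space_eq) (smt (verit) norm_triangle_ineq norm_triangle_ineq4)
    qed
    have "of_real (poly ?A' x) * ?F * L n' ?z = of_real (poly ?A x) * L n' ?z + D"
      using eq[of ?z] e(1) unfolding D_def by (simp add: mult_ac)
    then have "\<bar>poly ?A' x\<bar> * cmod ?F * cmod (L n' ?z) = cmod (of_real (poly ?A x) * L n' ?z + D)"
      by (metis norm_mult norm_of_real)
    also have "\<dots> \<le> MA * cmod (L n' ?z) + D0"
    proof -
      have "cmod (of_real (poly ?A x) * L n' ?z + D) \<le> \<bar>poly ?A x\<bar> * cmod (L n' ?z) + cmod D"
        by (rule order_trans[OF norm_triangle_ineq]) (simp add: norm_mult)
      also have "\<dots> \<le> MA * cmod (L n' ?z) + D0" by (intro add_mono mult_right_mono MA(2) x(1) Db) auto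
      finally show ?thesis .
    qed
    finally have "\<bar>poly ?A' x\<bar> * cmod ?F * cmod (L n' ?z) \<le> MA * cmod (L n' ?z) + D0" .
    moreover have "c1 * cmod ?F * cmod (L n' ?z) \<le> \<bar>poly ?A' x\<bar> * cmod ?F * cmod (L n' ?z)"
      by (intro mult_right_mono a') auto
    moreover have "D0 \<le> D0 / c2 * cmod (L n' ?z)"
    proof -
      have "D0 / c2 * c2 \<le> D0 / c2 * cmod (L n' ?z)" using lz D0 c2 by (intro mult_left_mono) auto
      then show ?thesis using c2 by simp
    qed
    ultimately have "(c1 * cmod ?F) * cmod (L n' ?z) \<le> (MA + D0 / c2) * cmod (L n' ?z)"
      by (simp add: distrib_right)
    then have "c1 * cmod ?F \<le> MA + D0 / c2" by (rule mult_right_le_imp_le) (use lz c2 in linarith)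
    then have "cmod ?F \<le> (MA + D0 / c2) / c1" using c1 by (simp add: field_simps)
    also have "\<dots> = C" by (simp add: C_def add_divide_distrib mult.commute)
    finally show ?thesis .
  qed
  moreover have "C \<ge> 0" unfolding C_def using MA(1) c1 c2 D0 by (intro add_nonneg_nonneg divide_nonneg_nonneg mult_nonneg_nonneg) auto
  ultimately show ?thesis using \<delta>(1) by blast
qed

section \<open>Absence of atoms and absolute continuity\<close>

lemma atom_le:
  fixes K :: "real measure"
  assumes "finite_measure K" "sets K = sets borel" "e > 0"
  shows "measure K {x} \<le> e * cmod (ctrans K (\<lambda>_. 1) (Complex x e))"
proof -
  interpret finite_measure K by (rule assms(1))
  have s: "{x} \<in> sets K" using assms(2) by simp
  have "(\<integral>t. 1 / e * indicator {x} t \<partial>K) \<le> pois K x e"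
    unfolding pois_def
  proof (rule integral_mono[OF _ pois_integrable[OF assms]])
    show "integrable K (\<lambda>t. 1 / e * indicator {x} t)" using s by (intro integrable_mult_right) (auto simp: emeasure_eq_measure)
    show "1 / e * indicator {x} t \<le> e / ((x - t)\<^sup>2 + e\<^sup>2)" for t
      using assms(3) by (auto split: split_indicator simp: power2_eq_square add_nonneg_pos)
  qed
  also have "(\<integral>t. 1 / e * indicator {x} t \<partial>K) = 1 / e * measure K {x}"
    by (subst integral_mult_right_zero) (simp add: s)
  also have "pois K x e \<le> cmod (ctrans K (\<lambda>_. 1) (Complex x e))"
    unfolding pois_eq_Im_ctrans[OF assms] using abs_Im_le_cmod[of "ctrans K (\<lambda>_. 1) (Complex x e)"] by linarith
  finally show ?thesis using assms(3) by (simp add: field_simps)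
qed

text \<open>An atom would keep \<open>e\<close> times the modulus of the transform away from 0 at
  \<open>x0 + \<i> e\<close>. If \<open>Q n' k\<close> is nonzero at \<open>x0\<close> for some
  \<open>I k\<close> containing \<open>x0\<close>, the transform is bounded by
  \<open>interval_point\<close>; otherwise \<open>e * L n\<close> tends to 0 while
  \<open>L n'\<close> has a nonzero limit.\<close>

lemma no_atom:
  fixes K :: "real measure"
  assumes fK: "finite_measure K" "sets K = sets borel"
    and eq: "\<And>z. Im z > 0 \<Longrightarrow> L n z = ctrans K (\<lambda>_. 1) z * L n' z" and n': "msize n' \<noteq> 0"
  shows "measure K {x0} = 0"
proof -
  define e where "e = (\<lambda>m. inverse (real (Suc m)))"
  have e0: "e m > 0" for m by (simp add: e_def)
  have el: "e \<longlonglongrightarrow> 0" unfolding e_def by (rule LIMSEQ_inverse_real_of_nat)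
  let ?F = "\<lambda>m. ctrans K (\<lambda>_. 1) (Complex x0 (e m))"
  have "(\<lambda>m. e m * cmod (?F m)) \<longlonglongrightarrow> 0"
  proof (cases "\<forall>k. x0 \<notin> I k \<or> poly (Q n' k) x0 = 0")
    case True
    define lv where "lv = (\<Sum>k\<in>UNIV. integral\<^sup>L (\<mu> k) (\<lambda>t. if x0 \<in> I k then - poly (synthetic_div (Q n' k) x0) t else poly (Q n' k) t / (x0 - t)))"
    have l0: "lv \<noteq> 0" unfolding lv_def by (rule L_nonvanishing[OF n']) (use True in blast)
    have l1: "(\<lambda>m. L n' (Complex x0 (e m))) \<longlonglongrightarrow> of_real lv"
      unfolding L_def lv_def of_real_sum by (intro tendsto_sum ctrans_tendsto e0 el) (use True in blast)
    have l2: "(\<lambda>m. of_real (e m) * L n (Complex x0 (e m))) \<longlonglongrightarrow> (\<Sum>k\<in>(UNIV::2 set). 0)"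
      unfolding L_def sum_distrib_left by (intro tendsto_sum scaled_ctrans_tendsto_0 e0 el)
    have "(\<lambda>m. of_real (e m) * L n (Complex x0 (e m)) / L n' (Complex x0 (e m))) \<longlonglongrightarrow> (\<Sum>k\<in>(UNIV::2 set). 0) / of_real lv"
      by (rule tendsto_divide[OF l2 l1]) (use l0 in simp)
    then have "(\<lambda>m. cmod (of_real (e m) * L n (Complex x0 (e m)) / L n' (Complex x0 (e m)))) \<longlonglongrightarrow> 0"
      by (intro tendsto_norm_zero) simp
    moreover have "eventually (\<lambda>m. cmod (of_real (e m) * L n (Complex x0 (e m)) / L n' (Complex x0 (e m))) = e m * cmod (?F m)) sequentially"
    proof -
      have "eventually (\<lambda>m. L n' (Complex x0 (e m)) \<noteq> 0) sequentially"
        by (rule tendsto_imp_eventually_ne[OF l1]) (use l0 in simp)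
      then show ?thesis
      proof eventually_elim
        case (elim m)
        have "L n (Complex x0 (e m)) / L n' (Complex x0 (e m)) = ?F m" using eq[of "Complex x0 (e m)"] e0[of m] elim by simp
        then have "of_real (e m) * L n (Complex x0 (e m)) / L n' (Complex x0 (e m)) = of_real (e m) * ?F m"
          by (metis times_divide_eq_right)
        then show ?case using e0[of m] by (simp only: norm_mult norm_of_real abs_of_pos)
      qed
    qed
    ultimately show ?thesis by (rule Lim_transform_eventually)
  next
    case False
    then obtain k where k: "x0 \<in> I k" "poly (Q n' k) x0 \<noteq> 0" by blast
    from interval_point[OF eq k] obtain \<delta> C where d: "\<delta> > 0" "C \<ge> 0"
      "\<And>x e. x \<in> I k \<Longrightarrow> \<bar>x - x0\<bar> < \<delta> \<Longrightarrow> 0 < e \<Longrightarrow> e < \<delta> \<Longrightarrow> cmod (ctrans K (\<lambda>_. 1) (Complex x e)) \<le> C"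
      by blast
    have ev: "eventually (\<lambda>m. norm (e m * cmod (?F m)) \<le> e m * C) sequentially"
      using order_tendstoD(2)[OF el d(1)]
    proof eventually_elim
      case (elim m)
      have "cmod (?F m) \<le> C" using d(3)[OF k(1), of "e m"] d(1) e0[of m] elim by simp
      then show ?case using e0[of m] by (simp add: abs_mult mult_left_mono)
    qed
    have "(\<lambda>m. e m * C) \<longlonglongrightarrow> 0 * C" by (intro tendsto_intros el)
    then show ?thesis by (intro Lim_null_comparison[OF ev]) simp
  qed
  then have "measure K {x0} \<le> 0"
    by (rule LIMSEQ_le_const) (use atom_le[OF fK e0] in blast)
  then show ?thesis using measure_nonneg[of K "{x0}"] by simp
qed

text \<open>Off the finite set \<open>S\<close> of endpoints and roots every point has a
  neighbourhood in which the Poisson integrals of \<open>K\<close> are dominated. Rational endpoints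
  make countably many such neighbourhoods suffice, and the points of \<open>S\<close> carry no
  atom.\<close>

theorem ratio_measure_absolutely_continuous:
  fixes K :: "real measure"
  assumes fK: "finite_measure K" "sets K = sets borel"
    and eq: "\<And>z. Im z > 0 \<Longrightarrow> L n z = ctrans K (\<lambda>_. 1) z * L n' z" and n': "msize n' \<noteq> 0"
  shows "absolutely_continuous lborel K"
  unfolding absolutely_continuous_def
proof
  fix N :: "real set" assume N: "N \<in> null_sets lborel"
  interpret finite_measure K by (rule fK(1))
  define S where "S = (\<Union>k. {\<alpha> k, \<beta> k} \<union> (if Q n' k = 0 then {} else {x. poly (Q n' k) x = 0}))"
  have finS: "finite S" unfolding S_def by (auto simp: poly_roots_finite)
  define G where "G = {ab :: real \<times> real. ab \<in> \<rat> \<times> \<rat> \<and> emeasure K (N \<inter> {fst ab<..<snd ab}) = 0}"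
  have cG: "countable G" by (rule countable_subset[of _ "\<rat> \<times> \<rat>"]) (auto simp: G_def countable_rat)
  have local: "\<exists>ab\<in>G. x1 \<in> {fst ab<..<snd ab}" if x1: "x1 \<notin> S" for x1
  proof -
    have "\<exists>\<delta>>0. \<exists>C\<ge>0. \<exists>k. \<forall>x e. \<bar>x - x1\<bar> < \<delta> \<longrightarrow> 0 < e \<longrightarrow> e < \<delta> \<longrightarrow> pois K x e \<le> C * (pois (\<mu> k) x e + 1)"
    proof (cases "\<forall>k. x1 \<notin> I k \<or> Q n' k = 0")
      case True
      show ?thesis by (rule regular_point[OF fK eq n' spec[OF True]])
    next
      case False
      then obtain k where k: "x1 \<in> I k" "Q n' k \<noteq> 0" by blast
      have S: "{\<alpha> k, \<beta> k} \<subseteq> S" "{x. poly (Q n' k) x = 0} \<subseteq> S" unfolding S_def using k(2) by (force, force)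
      have p: "poly (Q n' k) x1 \<noteq> 0" using x1 S(2) by blast
      have ends: "x1 \<noteq> \<alpha> k" "x1 \<noteq> \<beta> k" using x1 S(1) by (blast, blast)
      obtain \<delta> C where d: "\<delta> > 0" "C \<ge> 0" and d3: "\<forall>x e. x \<in> I k \<longrightarrow> \<bar>x - x1\<bar> < \<delta> \<longrightarrow> 0 < e \<longrightarrow> e < \<delta> \<longrightarrow> cmod (ctrans K (\<lambda>_. 1) (Complex x e)) \<le> C"
      proof -
        have "\<exists>\<delta>>0. \<exists>C\<ge>0. \<forall>x e. x \<in> I k \<longrightarrow> \<bar>x - x1\<bar> < \<delta> \<longrightarrow> 0 < e \<longrightarrow> e < \<delta> \<longrightarrow> cmod (ctrans K (\<lambda>_. 1) (Complex x e)) \<le> C"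
          by (rule interval_point[OF _ k(1) p]) (rule eq)
        then show thesis using that by blast
      qed
      \<comment> \<open>The bound from \<open>interval_point\<close> holds only for \<open>x\<close>
        in \<open>I k\<close>; in the interior this is a full neighbourhood of \<open>x1\<close>,
        which is why the endpoints belong to \<open>S\<close>.\<close>
      define \<delta>' where "\<delta>' = min \<delta> (min (x1 - \<alpha> k) (\<beta> k - x1))"
      have d': "\<delta>' > 0" "\<delta>' \<le> \<delta>" using d(1) k(1) ends by (auto simp: \<delta>'_def)
      have "pois K x e \<le> C * (pois (\<mu> k) x e + 1)" if "\<bar>x - x1\<bar> < \<delta>'" "0 < e" "e < \<delta>'" for x e
      proof -
        have "x \<in> I k" using that(1) by (auto simp: \<delta>'_def)
        then have "cmod (ctrans K (\<lambda>_. 1) (Complex x e)) \<le> C" using that d'(2) by (intro d3[rule_format]) auto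
        then have "pois K x e \<le> C" unfolding pois_eq_Im_ctrans[OF fK that(2)]
          using abs_Im_le_cmod[of "ctrans K (\<lambda>_. 1) (Complex x e)"] by linarith
        also have "C * 1 \<le> C * (pois (\<mu> k) x e + 1)" using d(2) pois_nonneg[OF that(2), of "\<mu> k" x] by (intro mult_left_mono) auto
        finally show ?thesis by simp
      qed
      then show ?thesis using d'(1) d(2) by blast
    qed
    then obtain \<delta> C k where d: "\<delta> > 0" "C \<ge> 0"
      "\<And>x e. \<bar>x - x1\<bar> < \<delta> \<Longrightarrow> 0 < e \<Longrightarrow> e < \<delta> \<Longrightarrow> pois K x e \<le> C * (pois (\<mu> k) x e + 1)" by blast
    obtain a where a: "a \<in> \<rat>" "x1 - \<delta> < a" "a < x1" using Rats_dense_in_real[of "x1 - \<delta>" x1] d(1) by auto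
    obtain b where b: "b \<in> \<rat>" "x1 < b" "b < x1 + \<delta>" using Rats_dense_in_real[of x1 "x1 + \<delta>"] d(1) by auto
    have "emeasure K (N \<inter> {a<..<b}) = 0"
      by (rule poisson_dominated_null[OF fK fin_meas sets_eq ac d(1,2) _ N, of a b k]) (use a b in \<open>auto intro!: d(3)\<close>)
    then show ?thesis using a b by (intro bexI[of _ "(a, b)"]) (auto simp: G_def)
  qed
  have "N \<subseteq> (\<Union>x\<in>S. {x}) \<union> (\<Union>ab\<in>G. N \<inter> {fst ab<..<snd ab})" using local by fastforce
  moreover have "(\<Union>x\<in>S. {x}) \<union> (\<Union>ab\<in>G. N \<inter> {fst ab<..<snd ab}) \<in> null_sets K"
  proof (intro null_sets.Un null_sets_UN')
    show "countable S" using finS by (rule countable_finite)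
    show "{x} \<in> null_sets K" for x
      using no_atom[OF fK eq n', of x] by (simp add: null_sets_def emeasure_eq_measure fK(2))
    show "countable G" by (rule cG)
    show "N \<inter> {fst ab<..<snd ab} \<in> null_sets K" if "ab \<in> G" for ab
      using that N by (auto simp: G_def null_sets_def fK(2))
  qed
  moreover have "N \<in> sets K" unfolding fK(2) using null_setsD2[OF N] by simp
  ultimately show "N \<in> null_sets K" using null_sets_subset by blast
qed

end

section \<open>Jacobi matrices on subtrees\<close>

text \<open>Potential and weights are abstract so that shifting them by
  \<open>Z \<mapsto> Z @ Y\<close> gives the matrix of the subtree below \<open>Y\<close>, with the
  edge to its parent cut.\<close>

definition jac :: "(vertex \<Rightarrow> real) \<Rightarrow> (vertex \<Rightarrow> real) \<Rightarrow> (vertex \<Rightarrow> complex) \<Rightarrow> vertex \<Rightarrow> complex" where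
  "jac V W f Y = of_real (V Y) * f Y + of_real (sqrt (W Y)) * (if Y = [] then 0 else f (tl Y))
     + (\<Sum>i\<in>UNIV. of_real (sqrt (W (i # Y))) * f (i # Y))"

lemma jacobi_jac: "jacobi \<mu> \<kappa> = jac (potV \<mu> \<kappa>) (weightW \<mu>)"
  by (intro ext) (simp add: jacobi_def jac_def)

lemma jac_comb: "jac V W (\<lambda>x. c * f x + g x) = (\<lambda>x. c * jac V W f x + jac V W g x)"
  by (intro ext) (simp add: jac_def sum_2 algebra_simps)

text \<open>The subtree below \<open>Y\<close> consists of the vertices \<open>Z @ Y\<close>; it is relabelled by \<open>Z\<close>.\<close>

definition embed :: "vertex \<Rightarrow> (vertex \<Rightarrow> complex) \<Rightarrow> vertex \<Rightarrow> complex" where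
  "embed Y f X = (if X \<in> range (\<lambda>Z. Z @ Y) then f (take (length X - length Y) X) else 0)"

definition restr :: "vertex \<Rightarrow> (vertex \<Rightarrow> complex) \<Rightarrow> vertex \<Rightarrow> complex" where
  "restr Y f Z = f (Z @ Y)"

lemma embed_append [simp]: "embed Y f (Z @ Y) = f Z"
  by (auto simp: embed_def)

lemma embed_outside: "X \<notin> range (\<lambda>Z. Z @ Y) \<Longrightarrow> embed Y f X = 0"
  by (simp add: embed_def)

lemma inj_append: "inj (\<lambda>Z. Z @ Y)"
  by (auto simp: inj_def)

lemma restr_ell2: "f \<in> ell2 \<Longrightarrow> restr Y f \<in> ell2"
proof -
  assume "f \<in> ell2"
  then have "(\<lambda>x. (cmod (f x))\<^sup>2) summable_on range (\<lambda>Z. Z @ Y)"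
    unfolding ell2_def by (auto intro: summable_on_subset_banach)
  then have "((\<lambda>x. (cmod (f x))\<^sup>2) \<circ> (\<lambda>Z. Z @ Y)) summable_on UNIV"
    using summable_on_reindex[OF inj_append[of Y], of "\<lambda>x. (cmod (f x))\<^sup>2"] by simp
  then show ?thesis by (simp add: ell2_def restr_def o_def)
qed

lemma embed_ell2: "f \<in> ell2 \<Longrightarrow> embed Y f \<in> ell2"
proof -
  assume f: "f \<in> ell2"
  have "((\<lambda>x. (cmod (embed Y f x))\<^sup>2) \<circ> (\<lambda>Z. Z @ Y)) summable_on UNIV"
    using f by (simp add: ell2_def o_def)
  then have "(\<lambda>x. (cmod (embed Y f x))\<^sup>2) summable_on range (\<lambda>Z. Z @ Y)"
    using summable_on_reindex[OF inj_append[of Y], of "\<lambda>x. (cmod (embed Y f x))\<^sup>2"] by simp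
  then have "(\<lambda>x. (cmod (embed Y f x))\<^sup>2) summable_on UNIV"
    by (subst summable_on_cong_neutral[where T="range (\<lambda>Z. Z @ Y)" and g="\<lambda>x. (cmod (embed Y f x))\<^sup>2"])
       (auto simp: embed_outside)
  then show ?thesis by (simp add: ell2_def)
qed

lemma inner_embed: "ell2_inner f (embed Y g) = ell2_inner (restr Y f) g"
proof -
  have "ell2_inner f (embed Y g) = infsum (\<lambda>x. f x * cnj (embed Y g x)) (range (\<lambda>Z. Z @ Y))"
    unfolding ell2_inner_def by (rule infsum_cong_neutral) (auto simp: embed_outside)
  also have "\<dots> = infsum ((\<lambda>x. f x * cnj (embed Y g x)) \<circ> (\<lambda>Z. Z @ Y)) UNIV"
    by (rule infsum_reindex[OF inj_append])
  finally show ?thesis by (simp add: ell2_inner_def restr_def o_def)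
qed

lemma restr_embed [simp]: "restr Y (embed Y f) = f"
  by (intro ext) (simp add: restr_def)

lemma not_proper_suffix: "Y \<noteq> [] \<Longrightarrow> tl Y \<noteq> Z @ Y"
  by (metis append_Nil2 append_eq_append_conv2 diff_less length_append length_greater_0_conv length_tl less_irrefl_nat not_add_less2 zero_less_one)

text \<open>The subtree is joined to the rest of the tree only by the edge from \<open>Y\<close> to
  its parent; a zero value there disconnects it.\<close>

lemma jac_restr:
  assumes "Y = [] \<or> f (tl Y) = 0"
  shows "restr Y (jac V W f) = jac (\<lambda>Z. V (Z @ Y)) (\<lambda>Z. W (Z @ Y)) (restr Y f)"
proof
  fix Z
  show "restr Y (jac V W f) Z = jac (\<lambda>Z. V (Z @ Y)) (\<lambda>Z. W (Z @ Y)) (restr Y f) Z"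
    using assms by (cases Z) (auto simp: restr_def jac_def)
qed

text \<open>As a compression of the whole matrix, the subtree matrix inherits its symmetry and its
  form bound.\<close>

lemma jac_subtree: "jac (\<lambda>Z. V (Z @ Y)) (\<lambda>Z. W (Z @ Y)) f = restr Y (jac V W (embed Y f))"
proof -
  have "Y = [] \<or> embed Y f (tl Y) = 0" using not_proper_suffix[of Y] by (auto intro!: embed_outside)
  from jac_restr[of Y "embed Y f" V W, OF this] show ?thesis by simp
qed

lemma symmetric_op_subtree:
  assumes "symmetric_op (jac V W)"
  shows "symmetric_op (jac (\<lambda>Z. V (Z @ Y)) (\<lambda>Z. W (Z @ Y)))"
proof -
  interpret symmetric_op "jac V W" by (rule assms)
  show ?thesis
  proof
    show "jac (\<lambda>Z. V (Z @ Y)) (\<lambda>Z. W (Z @ Y)) f \<in> ell2" if "f \<in> ell2" for f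
      unfolding jac_subtree by (intro restr_ell2 T_ell2 embed_ell2 that)
    show "ell2_inner (jac (\<lambda>Z. V (Z @ Y)) (\<lambda>Z. W (Z @ Y)) f) f \<in> \<real>" if "f \<in> ell2" for f
      unfolding jac_subtree inner_embed[symmetric] by (intro T_real embed_ell2 that)
  qed (rule jac_comb)
qed

lemma ell2_norm_embed: "f \<in> ell2 \<Longrightarrow> ell2_norm (embed Y f) = ell2_norm f"
proof -
  assume f: "f \<in> ell2"
  have "complex_of_real ((ell2_norm (embed Y f))\<^sup>2) = of_real ((ell2_norm f)\<^sup>2)"
    using ell2_norm_square[OF embed_ell2[OF f, of Y]] ell2_norm_square[OF f] by (simp add: inner_embed)
  then have "(ell2_norm (embed Y f))\<^sup>2 = (ell2_norm f)\<^sup>2" by (simp only: of_real_eq_iff)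
  then show ?thesis by (rule power2_eq_imp_eq) auto
qed

lemma subtree_bound:
  assumes "symmetric_op (jac V W)" "\<And>f. f \<in> ell2 \<Longrightarrow> cmod (ell2_inner (jac V W f) f) \<le> R * (ell2_norm f)\<^sup>2" "f \<in> ell2"
  shows "cmod (ell2_inner (jac (\<lambda>Z. V (Z @ Y)) (\<lambda>Z. W (Z @ Y)) f) f) \<le> R * (ell2_norm f)\<^sup>2"
  unfolding jac_subtree inner_embed[symmetric] using assms(2)[OF embed_ell2[OF assms(3), of Y]] by (simp add: ell2_norm_embed assms(3))

lemma finite_lists_le: "finite {Z :: vertex. length Z \<le> k}"
  using finite_lists_length_le[of "UNIV :: 2 set" k] by simp

text \<open>Pairing the Krylov vectors \<open>T\<^sup>k \<delta>\<close> with a formal solution \<open>g\<close> of the three-term recurrence on the tree gives the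
  moments of the spectral measure at the root. The solution need not be square summable, because the Krylov
  vectors are finitely supported.\<close>

lemma krylov_moments:
  fixes V W :: "vertex \<Rightarrow> real" and g :: "nat \<Rightarrow> vertex \<Rightarrow> real" and q :: "nat \<Rightarrow> real"
  assumes sym: "symmetric_op (jac V W)"
    and g: "\<And>j Z. jac V W (\<lambda>X. of_real (g j X)) Z = of_real (g (Suc j) Z - (if Z = [] then q j else 0))"
    and g0: "\<And>Z. g 0 Z = 0"
  shows "g (Suc m) [] = (\<Sum>l\<le>m. symmetric_op.moment (jac V W) (delta []) l * q (m - l))"
proof -
  interpret T: symmetric_op "jac V W" by (rule sym)
  let ?T = "jac V W"
  define u where "u = (\<lambda>k. (?T ^^ k) (delta []))"
  have ue: "u k \<in> ell2" for k unfolding u_def by auto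
  have us: "u k Z = 0" if "length Z > k" for k Z
    using that
  proof (induction k arbitrary: Z)
    case 0
    then show ?case by (auto simp: u_def delta_def)
  next
    case (Suc k)
    have "u k Z = 0" "u k (tl Z) = 0" "\<And>i. u k (i # Z) = 0" using Suc by auto
    then show ?case by (simp add: u_def jac_def)
  qed
  \<comment> \<open>Truncation makes the solution square summable. At level \<open>Suc k\<close> it
    is invisible on the support of \<open>u k\<close>, whose vertices have their children at level
    \<open>Suc k\<close> at most.\<close>
  define tr where "tr = (\<lambda>N j X. if length X \<le> N then complex_of_real (g j X) else 0)"
  have tre: "tr N j \<in> ell2" for N j
    by (rule ell2_finite_support, rule finite_subset[OF _ finite_lists_le[of N]]) (auto simp: tr_def)
  define S where "S = (\<lambda>k j. \<Sum>Z | length Z \<le> k. u k Z * of_real (g j Z))"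
  have pair: "ell2_inner (u k) (tr N j) = S k j" if "k \<le> N" for k N j
  proof -
    have "ell2_inner (u k) (tr N j) = (\<Sum>Z | length Z \<le> k. u k Z * cnj (tr N j Z))"
      by (rule ell2_inner_finite[OF finite_lists_le]) (auto simp: us)
    also have "\<dots> = S k j" unfolding S_def using that by (intro sum.cong) (auto simp: tr_def)
    finally show ?thesis .
  qed
  \<comment> \<open>Symmetry moves the operator onto the solution, which raises \<open>j\<close> at
    the cost of the inhomogeneity at the root; unrolling down to \<open>g 0 = 0\<close> produces the
    convolution.\<close>
  have step: "S (Suc k) j = S k (Suc j) - u k [] * of_real (q j)" for k j
  proof -
    let ?N = "Suc k"
    have "S (Suc k) j = ell2_inner (?T (u k)) (tr ?N j)" using pair[of "Suc k" ?N j] by (simp add: u_def)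
    also have "\<dots> = ell2_inner (u k) (?T (tr ?N j))" by (rule T.T_sym[OF ue tre])
    also have "\<dots> = (\<Sum>Z | length Z \<le> k. u k Z * cnj (?T (tr ?N j) Z))"
      by (rule ell2_inner_finite[OF finite_lists_le]) (auto simp: us)
    also have "\<dots> = (\<Sum>Z | length Z \<le> k. u k Z * of_real (g (Suc j) Z) - (if Z = [] then u k [] * of_real (q j) else 0))"
    proof (rule sum.cong[OF refl])
      fix Z :: vertex assume Z: "Z \<in> {Z. length Z \<le> k}"
      have "?T (tr ?N j) Z = ?T (\<lambda>X. of_real (g j X)) Z"
        unfolding jac_def using Z by (auto simp: tr_def)
      then show "u k Z * cnj (?T (tr ?N j) Z) = u k Z * of_real (g (Suc j) Z) - (if Z = [] then u k [] * of_real (q j) else 0)"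
        unfolding g by (simp add: right_diff_distrib)
    qed
    also have "\<dots> = S k (Suc j) - u k [] * of_real (q j)"
      unfolding sum_subtractf S_def
      using sum.delta[OF finite_lists_le[of k], of "[]" "\<lambda>_. u k [] * of_real (q j)"] by simp
    finally show ?thesis .
  qed
  have c: "u k [] = of_real (T.moment (delta []) k)" for k
    using T.pow_real[OF delta_ell2, of k "[]"] by (simp add: u_def)
  have S0: "S k 0 = 0" for k by (simp add: S_def g0)
  have "S k (Suc m) = (\<Sum>l\<le>m. u (k + l) [] * of_real (q (m - l)))" for k m
  proof (induction m arbitrary: k)
    case 0
    show ?case using step[of k 0] S0 by simp
  next
    case (Suc m)
    have "S k (Suc (Suc m)) = u k [] * of_real (q (Suc m)) + S (Suc k) (Suc m)" using step[of k "Suc m"] by simp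
    also have "\<dots> = (\<Sum>l\<le>Suc m. u (k + l) [] * of_real (q (Suc m - l)))"
      unfolding Suc sum.atMost_Suc_shift by simp
    finally show ?case .
  qed
  from this[of 0 m] have "S 0 (Suc m) = of_real (\<Sum>l\<le>m. T.moment (delta []) l * q (m - l))"
    by (simp add: c)
  moreover have "S 0 (Suc m) = of_real (g (Suc m) [])"
    by (simp add: S_def u_def delta_def)
  ultimately show ?thesis by (simp only: of_real_eq_iff)
qed

context angelesco_system
begin

text \<open>These are the coefficients of \<open>L n\<close> in powers of
  \<open>1 / z\<close>.\<close>

definition qm :: "nat^2 \<Rightarrow> nat \<Rightarrow> real" where "qm n j = lform (Q n) (monom 1 j)"

lemma I_bounded: obtains R where "R > 0" "\<And>k t. t \<in> I k \<Longrightarrow> \<bar>t\<bar> \<le> R"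
proof -
  define R where "R = 1 + \<bar>\<alpha> 1\<bar> + \<bar>\<beta> 1\<bar> + \<bar>\<alpha> 2\<bar> + \<bar>\<beta> 2\<bar>"
  have "\<bar>t\<bar> \<le> R" if "t \<in> I k" for k t using that exhaust_2[of k] by (auto simp: R_def)
  moreover have "R > 0" by (simp add: R_def add_pos_nonneg)
  ultimately show ?thesis using that by blast
qed

lemma L_series:
  assumes R: "R > 0" "\<And>k t. t \<in> I k \<Longrightarrow> \<bar>t\<bar> \<le> R" "R < cmod z"
  shows "(\<lambda>j. of_real (qm n j) / z ^ Suc j) sums L n z" "summable (\<lambda>j. cmod (of_real (qm n j) / z ^ Suc j))"
proof -
  have J: "(\<integral>t. poly (Q n k) t * t ^ j \<partial>\<mu> k) = J k (Q n k * monom 1 j)" for k j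
    unfolding J_def by (rule Bochner_Integration.integral_cong) (auto simp: poly_monom)
  have q: "of_real (qm n j) / z ^ Suc j = (\<Sum>k\<in>UNIV. of_real (\<integral>t. poly (Q n k) t * t ^ j \<partial>\<mu> k) / z ^ Suc j)" for j
    unfolding qm_def lform_def J by (simp add: sum_divide_distrib del: power_Suc)
  have s: "(\<lambda>j. of_real (\<integral>t. poly (Q n k) t * t ^ j \<partial>\<mu> k) / z ^ Suc j) sums ctrans (\<mu> k) (poly (Q n k)) z"
    and a: "summable (\<lambda>j. cmod (of_real (\<integral>t. poly (Q n k) t * t ^ j \<partial>\<mu> k) / z ^ Suc j))" for k
  proof -
    obtain B where "cauchy_density (\<mu> k) (poly (Q n k)) B (I k)" using poly_density[of k "Q n k"] by metis
    then interpret cauchy_density "\<mu> k" "poly (Q n k)" B "I k" .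
    show "(\<lambda>j. of_real (\<integral>t. poly (Q n k) t * t ^ j \<partial>\<mu> k) / z ^ Suc j) sums ctrans (\<mu> k) (poly (Q n k)) z"
      by (rule ctrans_sums[of R]) (use R in auto)
    show "summable (\<lambda>j. cmod (of_real (\<integral>t. poly (Q n k) t * t ^ j \<partial>\<mu> k) / z ^ Suc j))"
      by (rule ctrans_abs_summable[of R]) (use R in auto)
  qed
  show "(\<lambda>j. of_real (qm n j) / z ^ Suc j) sums L n z"
    unfolding q L_def by (rule sums_sum) (rule s)
  show "summable (\<lambda>j. cmod (of_real (qm n j) / z ^ Suc j))"
  proof (rule summable_comparison_test'[where N=0])
    show "summable (\<lambda>j. \<Sum>k\<in>UNIV. cmod (of_real (\<integral>t. poly (Q n k) t * t ^ j \<partial>\<mu> k) / z ^ Suc j))"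
      by (rule summable_sum) (rule a)
    show "norm (cmod (of_real (qm n j) / z ^ Suc j)) \<le> (\<Sum>k\<in>UNIV. cmod (of_real (\<integral>t. poly (Q n k) t * t ^ j \<partial>\<mu> k) / z ^ Suc j))" for j
      unfolding q real_norm_def abs_norm_cancel by (rule norm_sum)
  qed
qed

text \<open>For large \<open>|z|\<close> everything is a series in \<open>1 / z\<close>, and
  \<open>conv\<close> is the Cauchy product; the product starts at \<open>1 / z^2\<close>, matching
  \<open>q0\<close>. Analyticity extends the identity to the whole upper half-plane.\<close>

lemma L_factor:
  fixes K :: "real measure"
  assumes K: "real_distribution K" "AE x in K. \<bar>x\<bar> \<le> RK"
    and q0: "qm n 0 = 0" and conv: "\<And>m. qm n (Suc m) = (\<Sum>l\<le>m. (\<integral>x. x ^ l \<partial>K) * qm n' (m - l))"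
    and z: "Im z > 0"
  shows "L n z = ctrans K (\<lambda>_. 1) z * L n' z"
proof -
  interpret K: real_distribution K by (rule K(1))
  have cd: "cauchy_density K (\<lambda>_. 1) 1 {- max RK 0..max RK 0}"
    unfolding cauchy_density_def cauchy_density_axioms_def
    using K.finite_measure_axioms K(2) by (auto elim!: eventually_mono)
  interpret KC: cauchy_density K "\<lambda>_. 1" 1 "{- max RK 0..max RK 0}" by (rule cd)
  obtain R where R: "R > 0" "\<And>k t. t \<in> I k \<Longrightarrow> \<bar>t\<bar> \<le> R" using I_bounded by blast
  define R' where "R' = max R (max RK 0)"
  have R': "R' > 0" "\<And>k t. t \<in> I k \<Longrightarrow> \<bar>t\<bar> \<le> R'" "\<And>t. t \<in> {- max RK 0..max RK 0} \<Longrightarrow> \<bar>t\<bar> \<le> R'"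
    using R by (auto simp: R'_def le_max_iff_disj)
  have big: "L n z = ctrans K (\<lambda>_. 1) z * L n' z" if z: "R' < cmod z" for z
  proof -
    have z0: "z \<noteq> 0" using z R'(1) by auto
    let ?c = "\<lambda>j. complex_of_real (\<integral>x. x ^ j \<partial>K) / z ^ Suc j"
    let ?q = "\<lambda>j. complex_of_real (qm n' j) / z ^ Suc j"
    have c: "?c sums ctrans K (\<lambda>_. 1) z" using KC.ctrans_sums[OF R'(3) _ z] R'(1) by simp
    have ca: "summable (\<lambda>j. cmod (?c j))" using KC.ctrans_abs_summable[OF R'(3) _ z] R'(1) by simp
    have "(\<lambda>m. \<Sum>l\<le>m. ?c l * ?q (m - l)) sums ((\<Sum>j. ?c j) * (\<Sum>j. ?q j))"
      by (rule Cauchy_product_sums[OF ca L_series(2)[OF R'(1,2) z]])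
    moreover have "(\<Sum>j. ?c j) = ctrans K (\<lambda>_. 1) z" using c by (rule sums_unique[symmetric])
    moreover have "(\<Sum>j. ?q j) = L n' z" using L_series(1)[OF R'(1,2) z] by (rule sums_unique[symmetric])
    moreover have "(\<Sum>l\<le>m. ?c l * ?q (m - l)) = complex_of_real (qm n (Suc m)) / z ^ Suc (Suc m)" for m
    proof -
      have "?c l * ?q (m - l) = of_real ((\<integral>x. x ^ l \<partial>K) * qm n' (m - l)) / z ^ Suc (Suc m)" if "l \<le> m" for l
      proof -
        have "z ^ Suc l * z ^ Suc (m - l) = z ^ Suc (Suc m)" using that by (simp flip: power_add)
        then show ?thesis by simp
      qed
      then show ?thesis unfolding conv of_real_sum sum_divide_distrib by (intro sum.cong) auto
    qed
    ultimately have "(\<lambda>m. complex_of_real (qm n (Suc m)) / z ^ Suc (Suc m)) sums (ctrans K (\<lambda>_. 1) z * L n' z)" by simp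
    then have s: "(\<lambda>m. complex_of_real (qm n m) / z ^ Suc m) sums (ctrans K (\<lambda>_. 1) z * L n' z)"
      by (subst (asm) sums_Suc_iff) (simp add: q0)
    have "(\<lambda>m. complex_of_real (qm n m) / z ^ Suc m) sums L n z" by (rule L_series(1)[OF R'(1,2) z])
    then show ?thesis using s by (rule sums_unique2)
  qed
  have hol: "L m holomorphic_on {z. Im z > 0}" for m
  proof -
    have "ctrans (\<mu> k) (poly (Q m k)) holomorphic_on {z. Im z > 0}" for k
      using poly_density[of k "Q m k"] cauchy_density.ctrans_holomorphic by metis
    then show ?thesis unfolding L_def by (intro holomorphic_on_sum) blast
  qed
  show ?thesis
  proof (rule analytic_continuation_open[where s="{z. Im z > 0 \<and> R' < cmod z}" and s'="{z. Im z > 0}" and f="L n" and g="\<lambda>z. ctrans K (\<lambda>_. 1) z * L n' z"])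
    show "open {z. Im z > 0 \<and> R' < cmod z}"
      by (intro open_Collect_conj open_Collect_less continuous_intros)
    show "open {z. Im z > 0}" by (intro open_Collect_less continuous_intros)
    show "connected {z. Im z > 0}" by (intro convex_connected convex_halfspace_Im_gt)
    show "{z. Im z > 0 \<and> R' < cmod z} \<noteq> {}"
      using R'(1) by (auto intro!: exI[of _ "\<i> * of_real (R' + 1)"] simp: norm_mult)
    show "(\<lambda>z. ctrans K (\<lambda>_. 1) z * L n' z) holomorphic_on {z. Im z > 0}"
      by (intro holomorphic_on_mult hol KC.ctrans_holomorphic)
  qed (use hol big z in auto)
qed

section \<open>The type I moments along the tree\<close>

lemma proj_pos: "proj Y $ k \<noteq> 0"
  by (induction Y) (auto simp: axis_def)

lemma msize_proj: "msize (proj Y) \<ge> 2"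
  using proj_pos[of Y 1] proj_pos[of Y 2] by (simp add: msize_def)

lemma weight_pos: "weightW \<mu> (i # Y) > 0"
  by (simp add: rec_eq a_pos proj_pos)

definition idx :: "2 \<Rightarrow> vertex \<Rightarrow> 2" where "idx i Y = (if Y = [] then i else hd Y)"

text \<open>At the root, \<open>(1,1) - e_1 = e_2\<close> and \<open>(1,1) - e_2 = e_1\<close> bring
  the coefficient selected by \<open>\<kappa> = e_i\<close> into the pattern of all other
  vertices.\<close>

lemma potV_b: "potV \<mu> (axis i 1) Y = b (proj Y - axis (idx i Y) 1) (idx i Y)"
proof (cases Y)
  case Nil
  have "proj [] - axis 1 1 = axis 2 1" "proj [] - axis 2 1 = axis 1 1"
    by (auto simp: vec_eq_iff axis_def forall_2)
  then show ?thesis using Nil exhaust_2[of i] by (auto simp: idx_def rec_eq axis_def)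
next
  case (Cons j X)
  then show ?thesis by (simp add: idx_def rec_eq)
qed

text \<open>The type I recurrence at the index of \<open>Y\<close>, paired with \<open>x^j\<close>:
  the lower neighbour has the index of the parent, the upper ones those of the children.\<close>

lemma qm_recurrence:
  "qm (proj Y) (Suc j) = qm (proj Y - axis (idx i Y) 1) j + potV \<mu> (axis i 1) Y * qm (proj Y) j
     + (\<Sum>k\<in>UNIV. weightW \<mu> (k # Y) * qm (proj (k # Y)) j)"
proof -
  let ?n = "proj Y" and ?i = "idx i Y"
  have "lform (\<lambda>k. [:0, 1:] * Q ?n k) (monom 1 j) = lform (\<lambda>k. Q (?n - axis ?i 1) k + smult (b (?n - axis ?i 1) ?i) (Q ?n k) + (\<Sum>l\<in>UNIV. smult (a ?n l) (Q (?n + axis l 1) k))) (monom 1 j)"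
    by (subst typeI_recurrence[OF proj_pos, of Y _ ?i]) (rule refl)
  also have "\<dots> = lform (Q (?n - axis ?i 1)) (monom 1 j) + b (?n - axis ?i 1) ?i * lform (Q ?n) (monom 1 j) + (\<Sum>l\<in>UNIV. a ?n l * lform (Q (?n + axis l 1)) (monom 1 j))"
  proof -
    have add: "lform (\<lambda>k. A k + B k) p = lform A p + lform B p" for A B p
      by (simp add: lform_def distrib_right sum.distrib)
    show ?thesis unfolding add lform_smult_left lform_sum_left ..
  qed
  also have "lform (\<lambda>k. [:0, 1:] * Q ?n k) (monom 1 j) = lform (Q ?n) (monom 1 (Suc j))"
    unfolding lform_x_left by (simp add: monom_Suc)
  finally show ?thesis by (simp add: qm_def potV_b rec_eq)
qed

lemma qm_zero: "qm (proj Y) 0 = 0"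
  using msize_proj[of Y] Q_moment[of 0 "proj Y"] by (simp add: qm_def)

text \<open>The moment recurrence has weight \<open>a\<close> towards the children and 1 towards the
  parent; these products of square roots symmetrize it into the form of the Jacobi matrix.\<close>

fun path_weight :: "vertex \<Rightarrow> vertex \<Rightarrow> real" where
  "path_weight Y [] = 1"
| "path_weight Y (i # Z) = sqrt (weightW \<mu> (i # Z @ Y)) * path_weight Y Z"

text \<open>At the root of the subtree the term towards the parent is cut off; the resulting deficit
  is a moment of the index one step below, and serves as \<open>q\<close> in
  \<open>krylov_moments\<close>.\<close>

lemma subtree_solution:
  "jac (\<lambda>Z. potV \<mu> (axis i 1) (Z @ Y)) (\<lambda>Z. weightW \<mu> (Z @ Y)) (\<lambda>X. of_real (path_weight Y X * qm (proj (X @ Y)) j)) Z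
    = of_real (path_weight Y Z * qm (proj (Z @ Y)) (Suc j) - (if Z = [] then qm (proj Y - axis (idx i Y) 1) j else 0))"
proof -
  let ?g = "\<lambda>X. path_weight Y X * qm (proj (X @ Y)) j"
  have ch: "sqrt (weightW \<mu> (k # Z @ Y)) * ?g (k # Z) = path_weight Y Z * (weightW \<mu> (k # Z @ Y) * qm (proj (k # Z @ Y)) j)" for k
    using weight_pos[of k "Z @ Y"] by (simp del: weightW.simps(2) proj.simps(2))
  have par: "sqrt (weightW \<mu> (Z @ Y)) * (if Z = [] then 0 else ?g (tl Z)) = path_weight Y Z * qm (proj (Z @ Y) - axis (idx i (Z @ Y)) 1) j
      - (if Z = [] then qm (proj Y - axis (idx i Y) 1) j else 0)"
    by (cases Z) (simp_all add: idx_def)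
  have "jac (\<lambda>Z. potV \<mu> (axis i 1) (Z @ Y)) (\<lambda>Z. weightW \<mu> (Z @ Y)) (\<lambda>X. of_real (?g X)) Z =
     of_real (potV \<mu> (axis i 1) (Z @ Y) * ?g Z + sqrt (weightW \<mu> (Z @ Y)) * (if Z = [] then 0 else ?g (tl Z))
       + (\<Sum>k\<in>UNIV. sqrt (weightW \<mu> (k # Z @ Y)) * ?g (k # Z)))"
    unfolding jac_def by simp
  also have "\<dots> = of_real (path_weight Y Z * qm (proj (Z @ Y)) (Suc j) - (if Z = [] then qm (proj Y - axis (idx i Y) 1) j else 0))"
    unfolding ch par qm_recurrence[of "Z @ Y" j i] by (simp add: algebra_simps sum_distrib_left del: weightW.simps proj.simps potV.simps)
  finally show ?thesis .
qed

text \<open>The moment problem provides \<open>K\<close>, the Krylov pairing expresses the moments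
  of \<open>L n\<close> as a convolution of those of \<open>K\<close> and of \<open>L n'\<close>,
  and \<open>L_factor\<close> turns this into the ratio to which the absolute continuity theorem
  applies.\<close>

lemma subtree_root_measure:
  fixes Y :: vertex and i :: 2
  assumes sym: "symmetric_op (jacobi \<mu> (axis i 1))"
    and bd: "\<And>f. f \<in> ell2 \<Longrightarrow> cmod (ell2_inner (jacobi \<mu> (axis i 1) f) f) \<le> R * (ell2_norm f)\<^sup>2" and R: "R > 0"
  defines "TY \<equiv> jac (\<lambda>Z. potV \<mu> (axis i 1) (Z @ Y)) (\<lambda>Z. weightW \<mu> (Z @ Y))"
  shows "\<exists>K. real_distribution K \<and> (AE x in K. \<bar>x\<bar> \<le> R) \<and> absolutely_continuous lborel K \<and>
     (\<forall>p. integral\<^sup>L K (poly p) = symmetric_op.mfun TY (delta []) p)"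
proof -
  have symY: "symmetric_op TY" unfolding TY_def by (rule symmetric_op_subtree) (use sym in \<open>simp only: jacobi_jac\<close>)
  interpret T: symmetric_op TY by (rule symY)
  have bdY: "cmod (ell2_inner (TY f) f) \<le> R * (ell2_norm f)\<^sup>2" if "f \<in> ell2" for f
    unfolding TY_def by (rule subtree_bound[OF sym[unfolded jacobi_jac] bd[unfolded jacobi_jac] that])
  obtain K where K: "real_distribution K" "AE x in K. \<bar>x\<bar> \<le> R" "\<And>p. integral\<^sup>L K (poly p) = T.mfun (delta []) p"
    using T.op_moment_measure[OF R bdY delta_ell2 ell2_norm_delta] by blast
  interpret K: real_distribution K by (rule K(1))
  let ?n = "proj Y" and ?n' = "proj Y - axis (idx i Y) 1"
  have mom: "(\<integral>x. x ^ l \<partial>K) = T.moment (delta []) l" for l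
  proof -
    have "(\<integral>x. x ^ l \<partial>K) = integral\<^sup>L K (poly (monom 1 l))"
      by (rule Bochner_Integration.integral_cong) (auto simp: poly_monom)
    also have "\<dots> = (\<Sum>i\<le>l. coeff (monom 1 l) i * T.moment (delta []) i)"
      unfolding K(3) by (rule T.mfun_bound) (rule degree_monom_le)
    also have "\<dots> = (\<Sum>i\<le>l. if i = l then T.moment (delta []) i else 0)" by (intro sum.cong) auto
    finally show ?thesis by simp
  qed
  have "qm ?n (Suc m) = (\<Sum>l\<le>m. T.moment (delta []) l * qm ?n' (m - l))" for m
  proof -
    have "path_weight Y [] * qm (proj ([] @ Y)) (Suc m) = (\<Sum>l\<le>m. T.moment (delta []) l * qm ?n' (m - l))"
      unfolding TY_def
      by (rule krylov_moments[OF symY[unfolded TY_def], where g="\<lambda>j Z. path_weight Y Z * qm (proj (Z @ Y)) j"])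
         (rule subtree_solution, simp add: qm_zero)
    then show ?thesis by simp
  qed
  then have conv: "qm ?n (Suc m) = (\<Sum>l\<le>m. (\<integral>x. x ^ l \<partial>K) * qm ?n' (m - l))" for m by (simp only: mom)
  have n': "msize ?n' \<noteq> 0" using msize_proj[of Y] msize_diff_axis[OF proj_pos] by simp
  have "absolutely_continuous lborel K"
  proof (rule ratio_measure_absolutely_continuous[OF K.finite_measure_axioms K.events_eq_borel _ n'])
    show "L ?n z = ctrans K (\<lambda>_. 1) z * L ?n' z" if "Im z > 0" for z
      by (rule L_factor[OF K(1,2) qm_zero conv that])
  qed
  then show ?thesis using K by blast
qed

theorem E_null_vanishes:
  assumes res: "spectral_resolution (jacobi \<mu> (axis i 1)) E"
    and N: "N \<in> null_sets lborel" and f: "f \<in> ell2"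
  shows "E N f = (\<lambda>x. 0)"
proof -
  interpret resolved_op "jacobi \<mu> (axis i 1)" E
    by unfold_locales (use res in \<open>simp_all add: jacobi_jac jac_comb\<close>)
  let ?A = "jacobi \<mu> (axis i 1)"
  have Nb: "N \<in> sets borel" using null_setsD2[OF N] by simp
  \<comment> \<open>The induction runs over the whole range of \<open>E N\<close> at once, because
    the vanishing at the parent is needed for all iterates of \<open>\<psi>\<close>, which stay in
    this range.\<close>
  have "\<forall>\<psi>\<in>ell2. E N \<psi> = \<psi> \<longrightarrow> \<psi> Y = 0" for Y
  proof (induction Y rule: length_induct)
    case (1 Y)
    define TY where "TY = jac (\<lambda>Z. potV \<mu> (axis i 1) (Z @ Y)) (\<lambda>Z. weightW \<mu> (Z @ Y))"
    have symY: "symmetric_op TY" unfolding TY_def by (rule symmetric_op_subtree) (use A.symmetric_op_axioms in \<open>simp only: jacobi_jac\<close>)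
    interpret T: symmetric_op TY by (rule symY)
    have parent: "Y = [] \<or> \<phi> (tl Y) = 0" if "\<phi> \<in> ell2" "E N \<phi> = \<phi>" for \<phi>
      using 1[rule_format, of "tl Y" \<phi>] that by (cases Y) auto
    obtain K where K: "real_distribution K" "AE x in K. \<bar>x\<bar> \<le> rad" "absolutely_continuous lborel K"
      "\<And>p. integral\<^sup>L K (poly p) = T.mfun (delta []) p"
      using subtree_root_measure[OF A.symmetric_op_axioms form_bound rad_pos, of Y] unfolding TY_def by blast
    interpret K: real_distribution K by (rule K(1))
    have KN: "emeasure K N = 0" using K(3) N unfolding absolutely_continuous_def by auto
    show ?case
    proof (intro ballI impI)
      fix \<psi> assume \<psi>: "\<psi> \<in> ell2" "E N \<psi> = \<psi>"
      have inv: "(?A ^^ k) \<psi> \<in> ell2 \<and> E N ((?A ^^ k) \<psi>) = (?A ^^ k) \<psi> \<and> restr Y ((?A ^^ k) \<psi>) = (TY ^^ k) (restr Y \<psi>)" for k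
      proof (induction k)
        case 0
        show ?case using \<psi> by simp
      next
        case (Suc k)
        let ?\<phi> = "(?A ^^ k) \<psi>"
        have "restr Y (?A ?\<phi>) = TY (restr Y ?\<phi>)"
          unfolding jacobi_jac TY_def by (rule jac_restr) (use parent Suc in \<open>simp add: jacobi_jac\<close>)
        moreover have "E N (?A ?\<phi>) = ?A ?\<phi>" using E_commute[OF Nb, of ?\<phi>] Suc by simp
        ultimately show ?case using Suc A_ell2 by simp
      qed
      have rY: "restr Y \<psi> \<in> ell2" by (rule restr_ell2[OF \<psi>(1)])
      have popY: "pop ?A p \<psi> Y = pop TY p (restr Y \<psi>) []" for p
      proof -
        have "(?A ^^ k) \<psi> Y = (TY ^^ k) (restr Y \<psi>) []" for k
          using inv[of k] by (metis append_Nil restr_def)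
        then show ?thesis by (simp add: pop_def)
      qed
      have bound: "cmod (\<psi> Y) \<le> ell2_norm (restr Y \<psi>) * sqrt e + sqrt e" if e: "e > 0" for e
      proof -
        obtain p where p: "(\<integral>x. (poly p x)\<^sup>2 \<partial>K) \<le> e" "(ell2_norm (\<lambda>x. pop ?A p \<psi> x - \<psi> x))\<^sup>2 \<le> e"
          using E_range_approximation[OF Nb \<psi> K(1,2) KN e] by blast
        have d: "(\<lambda>x. pop ?A p \<psi> x - \<psi> x) \<in> ell2"
          using ell2_comb[OF \<psi>(1) A.pop_ell2[OF \<psi>(1), of p], of "-1"] by simp
        have "cmod (pop ?A p \<psi> Y - \<psi> Y) \<le> ell2_norm (\<lambda>x. pop ?A p \<psi> x - \<psi> x)" by (rule ell2_norm_point[OF d])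
        also have "\<dots> \<le> sqrt e" by (rule real_le_rsqrt[OF p(2)])
        finally have 1: "cmod (pop ?A p \<psi> Y - \<psi> Y) \<le> sqrt e" .
        \<comment> \<open>The value at \<open>Y\<close> is a pairing with the point mass at the root
          of the subtree, so \<open>p\<close> can be moved onto that point mass, where its norm is
          an integral against \<open>K\<close>.\<close>
        have "pop ?A p \<psi> Y = ell2_inner (pop TY p (restr Y \<psi>)) (delta [])" by (simp add: popY)
        also have "\<dots> = ell2_inner (restr Y \<psi>) (pop TY p (delta []))" by (rule T.pop_sym[OF rY delta_ell2])
        finally have "cmod (pop ?A p \<psi> Y) \<le> ell2_norm (restr Y \<psi>) * ell2_norm (pop TY p (delta []))"
          using ell2_cauchy_schwarz[OF rY T.pop_ell2[OF delta_ell2]] by simp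
        also have "ell2_norm (pop TY p (delta [])) \<le> sqrt e"
        proof (rule real_le_rsqrt)
          have "complex_of_real ((ell2_norm (pop TY p (delta [])))\<^sup>2) = of_real (T.mfun (delta []) (p * p))"
            using T.inner_pop_pop[OF delta_ell2[of "[]"], where p=p and q=p] ell2_norm_square[OF T.pop_ell2[OF delta_ell2], of p "[]"] by simp
          then have "(ell2_norm (pop TY p (delta [])))\<^sup>2 = integral\<^sup>L K (poly (p * p))" by (simp only: of_real_eq_iff K(4))
          also have "poly (p * p) = (\<lambda>x. (poly p x)\<^sup>2)" by (auto simp: power2_eq_square)
          finally show "(ell2_norm (pop TY p (delta [])))\<^sup>2 \<le> e" using p(1) by simp
        qed
        finally have 2: "cmod (pop ?A p \<psi> Y) \<le> ell2_norm (restr Y \<psi>) * sqrt e"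
          by (simp add: mult_left_mono)
        show ?thesis using 1 2 norm_triangle_ineq4[of "pop ?A p \<psi> Y" "pop ?A p \<psi> Y - \<psi> Y"] by simp
      qed
      have "((\<lambda>e. ell2_norm (restr Y \<psi>) * sqrt e + sqrt e) \<longlongrightarrow> ell2_norm (restr Y \<psi>) * sqrt 0 + sqrt 0) (at_right 0)"
        by (intro tendsto_intros)
      then have "cmod (\<psi> Y) \<le> ell2_norm (restr Y \<psi>) * sqrt 0 + sqrt 0"
        by (rule tendsto_lowerbound) (auto simp: eventually_at_right_field intro!: exI[of _ 1] bound)
      then show "\<psi> Y = 0" by simp
    qed
  qed
  then show ?thesis using E_ell2[OF Nb f] E_idem[OF Nb f] by (intro ext) blast
qed

lemma purely_ac: "purely_ac_spectrum (jacobi \<mu> (axis i 1))"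
  unfolding purely_ac_spectrum_def
proof (intro allI impI ballI)
  fix E and f :: "vertex \<Rightarrow> complex" assume res: "spectral_resolution (jacobi \<mu> (axis i 1)) E" and f: "f \<in> ell2"
  interpret resolved_op "jacobi \<mu> (axis i 1)" E
    by unfold_locales (use res in \<open>simp_all add: jacobi_jac jac_comb\<close>)
  show "absolutely_continuous lborel (spectral_measure E f)"
    unfolding absolutely_continuous_def
  proof
    fix N :: "real set" assume N: "N \<in> null_sets lborel"
    have "N \<in> sets borel" using null_setsD2[OF N] by simp
    then show "N \<in> null_sets (spectral_measure E f)"
      by (simp add: null_sets_def emeasure_spectral[OF f] E_null_vanishes[OF res N f] ell2_norm_def)
  qed
qed

end

section \<open>Angelesco systems with densities bounded below\<close>

text \<open>The complement of the support is a union of open null sets, of which countably many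
  suffice by Lindelof.\<close>

lemma null_outside_msupp:
  assumes "sets \<nu> = sets borel"
  shows "AE x in \<nu>. x \<in> msupp \<nu>"
proof -
  let ?U = "{U. open U \<and> emeasure \<nu> U = 0}"
  have eq: "- msupp \<nu> = \<Union>?U"
    by (auto simp: msupp_def)
  obtain \<F>' where F: "\<F>' \<subseteq> ?U" "countable \<F>'" "\<Union>\<F>' = \<Union>?U"
    using Lindelof[of ?U] by blast
  have "U \<in> null_sets \<nu>" if "U \<in> \<F>'" for U
    using that F(1) assms by (auto simp: null_sets_def)
  then have "\<Union>\<F>' \<in> null_sets \<nu>"
    using null_sets_UN'[OF F(2), of "\<lambda>U. U"] by simp
  then have "- msupp \<nu> \<in> null_sets \<nu>"
    unfolding eq F(3) .
  then show ?thesis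
    by (rule AE_not_in[THEN eventually_mono]) simp
qed

lemma convex_hull_interval:
  fixes S :: "real set"
  assumes "compact S" "infinite S"
  obtains u v where "u < v" "convex hull S = {u..v}"
proof -
  have "connected (convex hull S)" "compact (convex hull S)"
    using assms(1) by (auto intro: convex_connected compact_convex_hull)
  then obtain u v where uv: "convex hull S = {u..v}"
    using connected_compact_interval_1 by blast
  have "infinite (convex hull S)"
    using assms(2) hull_subset[of S convex] finite_subset by blast
  then have "u < v"
    unfolding uv using infinite_Icc_iff by blast
  then show ?thesis using that uv by blast
qed

text \<open>A bounded inverse density is a density bounded below by a positive constant; integrated
  over subintervals of the convex hulls, this is the axiom \<open>lower\<close> of
  \<open>angelesco_system\<close>.\<close>

theorem theorem3p5p3:
  fixes \<mu> :: "2 \<Rightarrow> real measure" and w :: "2 \<Rightarrow> real \<Rightarrow> real"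
  assumes "angelesco \<mu>"
    and "\<And>k. w k \<in> borel_measurable borel"
    and "\<And>k x. 0 \<le> w k x"
    and "\<And>k. \<mu> k = density lborel (\<lambda>x. ennreal (w k x))"
    and "\<And>k. \<exists>C. AE x in lborel. x \<in> convex hull (msupp (\<mu> k)) \<longrightarrow>
                  0 < w k x \<and> inverse (w k x) \<le> C"
  shows "\<forall>i::2. purely_ac_spectrum (jacobi \<mu> (axis i 1))"
proof
  fix i :: 2
  have fin: "finite_measure (\<mu> k)" and sets: "sets (\<mu> k) = sets borel"
    and comp: "compact (msupp (\<mu> k))" and inf: "infinite (msupp (\<mu> k))" for k
    using assms(1) by (auto simp: angelesco_def)
  have "\<forall>k. \<exists>u v. u < v \<and> convex hull (msupp (\<mu> k)) = {u..v}"
    using convex_hull_interval[OF comp inf] by metis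
  then obtain \<alpha> \<beta> where \<Delta>: "\<alpha> k < \<beta> k" "convex hull (msupp (\<mu> k)) = {\<alpha> k..\<beta> k}" for k
    by metis
  from assms(5) obtain C where C: "AE x in lborel. x \<in> {\<alpha> k..\<beta> k} \<longrightarrow> 0 < w k x \<and> inverse (w k x) \<le> C k" for k
    unfolding \<Delta>(2) by metis
  \<comment> \<open>One constant for both densities; the maximum with 1 keeps it positive.\<close>
  define c where "c = inverse (max 1 (max (C 1) (C 2)))"
  have c: "c > 0" by (simp add: c_def)
  have w_lower: "AE x in lborel. x \<in> {\<alpha> k..\<beta> k} \<longrightarrow> c \<le> w k x" for k
    using C[of k]
  proof eventually_elim
    case (elim x)
    have "C k \<le> max 1 (max (C 1) (C 2))"
      using exhaust_2[of k] by (auto simp: le_max_iff_disj)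
    with elim have "x \<in> {\<alpha> k..\<beta> k} \<longrightarrow> 0 < w k x \<and> inverse (w k x) \<le> inverse c"
      by (auto simp: c_def)
    then show ?case
      using c by (auto simp: inverse_le_iff_le)
  qed
  interpret angelesco_system \<mu> \<alpha> \<beta> c
  proof (rule angelesco_system.intro)
    show "finite_measure (\<mu> k)" for k by (rule fin)
    show "sets (\<mu> k) = sets borel" for k by (rule sets)
    show "AE x in \<mu> k. x \<in> {\<alpha> k..\<beta> k}" for k
      using null_outside_msupp[OF sets] by eventually_elim (use hull_subset[of "msupp (\<mu> k)" convex] \<Delta>(2) in blast)
    show "absolutely_continuous lborel (\<mu> k)" for k
      unfolding assms(4)[of k] by (rule absolutely_continuousI_density) (use assms(2)[of k] in measurable)
    show "c > 0" by (rule c)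
    show "\<alpha> k < \<beta> k" for k by (rule \<Delta>)
    show "{\<alpha> 1..\<beta> 1} \<inter> {\<alpha> 2..\<beta> 2} = {}"
      using assms(1) by (simp add: angelesco_def \<Delta>(2))
    show "c * (v - u) \<le> measure (\<mu> k) {u..v}" if "\<alpha> k \<le> u" "u \<le> v" "v \<le> \<beta> k" for k u v
    proof -
      have "ennreal (c * (v - u)) = (\<integral>\<^sup>+x. ennreal c * indicator {u..v} x \<partial>lborel)"
        using that c by (simp add: nn_integral_cmult ennreal_mult)
      also have "\<dots> \<le> (\<integral>\<^sup>+x. ennreal (w k x) * indicator {u..v} x \<partial>lborel)"
        by (rule nn_integral_mono_AE, use w_lower[of k] in eventually_elim)
           (use that in \<open>auto simp: indicator_def ennreal_leI\<close>)
      also have "\<dots> = emeasure (\<mu> k) {u..v}"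
        unfolding assms(4)[of k] by (rule emeasure_density[symmetric]) (use assms(2)[of k] in auto)
      also have "\<dots> = ennreal (measure (\<mu> k) {u..v})"
        using finite_measure.emeasure_eq_measure[OF fin] .
      finally show ?thesis by (simp add: ennreal_le_iff)
    qed
  qed
  show "purely_ac_spectrum (jacobi \<mu> (axis i 1))"
    by (rule purely_ac)
qed

end
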